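(* Let $\nabla$ be a torsion-free connection on a smooth manifold $M$ and $X\in\mathfrak{X}(M)$. Then $X\in\mathrm{aff}_0(M,\nabla)$ if and only if $X\in\mathrm{aff}(M,\nabla)$ and the parallel flow of $X$ is equal to its actual flow, meaning that for every $(t,m)\in\mathbb{R}\times M$ such that $\Psi^X_{2t}(m)$ is defined, we have $$\Theta^X_{t,m}=(\Psi^X_{-t})_{*\Psi^X_t(m)}.$$
   Context: $M$ is a smooth manifold of positive dimension; a connection on $M$ is an affine connection on $TM$. $\Psi^X$ denotes the local flow of $X$. An affine diffeomorphism is a diffeomorphism whose tangent map commutes with parallel transport along every curve. A vector field $X$ is affine, $X\in\mathrm{aff}(M,\nabla)$, if its flow is a local one-parameter group of affine diffeomorphisms of $(M,\nabla)$; equivalently, $[X,\nabla_YZ]-\nabla_Y[X,Z]=\nabla_{[X,Y]}Z$ for all $Y,Z\in\mathfrak{X}(M)$. For torsion-free $\nabla$, $\mathrm{aff}_0(M,\nabla)=\{X\in\mathrm{aff}(M,\nabla)\mid\nabla X=0\}$. For $(t,m)$ such that $\Psi^X_{2t}(m)$ is defined, the parallel flow along $X$ from time $t$ to $m$ is the map $\Theta^X_{t,m}:T_{\Psi^X_t(m)}M\to T_mM$ given by $\Theta^X_{t,m}=P^\gamma_{2t,0}\circ(\Psi^X_{-t})^*_{\Psi^X_{2t}(m)}$, where $\gamma$ is the integral curve of $X$ starting at $m$, $P^\gamma_{2t,0}$ is the parallel transport along $\gamma$ from $\gamma(2t)$ to $\gamma(0)=m$ with respect to $\nabla$ (in general with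 respect to the associated torsion-free connection, which here is $\nabla$ itself), and $(\Psi^X_{-t})^*_{\Psi^X_{2t}(m)}$ is the pullback of vectors by $\Psi^X_{-t}$, i.e. the tangent map of $\Psi^X_t$ at $\Psi^X_t(m)$, from $T_{\Psi^X_t(m)}M$ to $T_{\Psi^X_{2t}(m)}M$. $(\Psi^X_{-t})_{*\Psi^X_t(m)}:T_{\Psi^X_t(m)}M\to T_mM$ is the tangent map of $\Psi^X_{-t}$. *)

theory Defs
  imports "HOL-Analysis.Analysis"
begin

section \<open>Smooth maps between Euclidean spaces\<close>

text \<open>
  On an open subset of a Euclidean space, differentiability of class \<open>C\<^sup>k\<close> is expressed by
  recursion through the directional derivatives. Only open sets \<open>S\<close> are used below.
\<close>

fun C_k_on :: "nat \<Rightarrow> 'b::euclidean_space set \<Rightarrow> ('b \<Rightarrow> 'c::euclidean_space) \<Rightarrow> bool" where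
  "C_k_on 0 S f \<longleftrightarrow> continuous_on S f"
| "C_k_on (Suc k) S f \<longleftrightarrow>
     (\<forall>x\<in>S. f differentiable (at x)) \<and>
     (\<forall>v. C_k_on k S (\<lambda>x. frechet_derivative f (at x) v))"

definition smooth_on :: "'b::euclidean_space set \<Rightarrow> ('b \<Rightarrow> 'c::euclidean_space) \<Rightarrow> bool" where
  "smooth_on S f \<longleftrightarrow> (\<forall>k. C_k_on k S f)"


section \<open>Smooth manifolds\<close>

text \<open>
  A chart is a pair of a domain and a coordinate map; the values of the coordinate map off the
  domain are irrelevant. The dimension of the manifold is the dimension of the model space
  \<open>'e\<close>, which is positive for every type of class \<open>euclidean_space\<close>. The atlas is any smooth
  atlas, maximal or not.
\<close>

type_synonym ('a, 'e) chart = "'a set \<times> ('a \<Rightarrow> 'e)"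

record ('a, 'e) manifold =
  mtop :: "'a topology"
  atlas :: "('a, 'e) chart set"

definition chart_inv :: "('a, 'e) chart \<Rightarrow> 'e \<Rightarrow> 'a" where
  "chart_inv c = inv_into (fst c) (snd c)"

definition charts_at :: "('a, 'e) manifold \<Rightarrow> 'a \<Rightarrow> ('a, 'e) chart set" where
  "charts_at M p = {c \<in> atlas M. p \<in> fst c}"

definition smooth_manifold :: "('a, 'e::euclidean_space) manifold \<Rightarrow> bool" where
  "smooth_manifold M \<longleftrightarrow>
     Hausdorff_space (mtop M) \<and> second_countable (mtop M) \<and>
     topspace (mtop M) = (\<Union>c\<in>atlas M. fst c) \<and>
     (\<forall>c\<in>atlas M. openin (mtop M) (fst c) \<and> open (snd c ` fst c) \<and>
        homeomorphic_map (subtopology (mtop M) (fst c))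
          (subtopology euclidean (snd c ` fst c)) (snd c)) \<and>
     (\<forall>c\<in>atlas M. \<forall>d\<in>atlas M.
        smooth_on (snd c ` (fst c \<inter> fst d)) (\<lambda>x. snd d (chart_inv c x)))"

definition smooth_fun :: "('a, 'e::euclidean_space) manifold \<Rightarrow> ('a \<Rightarrow> real) \<Rightarrow> bool" where
  "smooth_fun M f \<longleftrightarrow> (\<forall>c\<in>atlas M. smooth_on (snd c ` fst c) (\<lambda>x. f (chart_inv c x)))"

definition smooth_map_on ::
  "('a, 'e::euclidean_space) manifold \<Rightarrow> 'a set \<Rightarrow> ('a \<Rightarrow> 'a) \<Rightarrow> bool" where
  "smooth_map_on M U F \<longleftrightarrow>
     continuous_map (subtopology (mtop M) U) (mtop M) F \<and>
     (\<forall>c\<in>atlas M. \<forall>d\<in>atlas M.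
        smooth_on (snd c ` {p \<in> U \<inter> fst c. F p \<in> fst d}) (\<lambda>x. snd d (F (chart_inv c x))))"

definition diffeo_between ::
  "('a, 'e::euclidean_space) manifold \<Rightarrow> 'a set \<Rightarrow> 'a set \<Rightarrow> ('a \<Rightarrow> 'a) \<Rightarrow> bool" where
  "diffeo_between M U V F \<longleftrightarrow>
     openin (mtop M) U \<and> openin (mtop M) V \<and> bij_betw F U V \<and>
     smooth_map_on M U F \<and> smooth_map_on M V (inv_into U F)"


section \<open>Tangent vectors and vector fields\<close>

text \<open>
  A tangent vector at \<open>p\<close> assigns to every chart around \<open>p\<close> its coordinate vector, subject to the
  transformation law under change of charts. It is \<open>0\<close> on all other charts, so that
  two tangent vectors at \<open>p\<close> are equal iff their coordinates are. In particular,
  the tangent space at a point outside of the manifold contains only the zero function, and hence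
  vector fields are determined by their values on the manifold.
\<close>

type_synonym ('a, 'e) tangent = "('a, 'e) chart \<Rightarrow> 'e"
type_synonym ('a, 'e) vfield = "'a \<Rightarrow> ('a, 'e) tangent"

definition tangent_space ::
  "('a, 'e::euclidean_space) manifold \<Rightarrow> 'a \<Rightarrow> ('a, 'e) tangent set" where
  "tangent_space M p =
     {v. (\<forall>c. c \<notin> charts_at M p \<longrightarrow> v c = 0) \<and>
         (\<forall>c\<in>charts_at M p. \<forall>d\<in>charts_at M p.
            v d = frechet_derivative (\<lambda>x. snd d (chart_inv c x)) (at (snd c p)) (v c))}"

definition vector_fields :: "('a, 'e::euclidean_space) manifold \<Rightarrow> ('a, 'e) vfield set" where
  "vector_fields M =
     {X. (\<forall>p. X p \<in> tangent_space M p) \<and>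
         (\<forall>c\<in>atlas M. smooth_on (snd c ` fst c) (\<lambda>x. X (chart_inv c x) c))}"

text \<open>
  The coordinates of the image vector are computed from those of \<open>v\<close> in one
  (arbitrarily chosen) chart around \<open>p\<close>. Only the germ of \<open>F\<close> at \<open>p\<close> matters, so \<open>F\<close> may be a
  map which is meaningful only on a neighbourhood of \<open>p\<close>.
\<close>

definition tangent_map ::
  "('a, 'e::euclidean_space) manifold \<Rightarrow> ('a \<Rightarrow> 'a) \<Rightarrow> 'a \<Rightarrow> ('a, 'e) tangent \<Rightarrow> ('a, 'e) tangent"
  where
  "tangent_map M F p v =
     (let c = (SOME c. c \<in> charts_at M p) in
      (\<lambda>d. if d \<in> charts_at M (F p)
           then frechet_derivative (\<lambda>x. snd d (F (chart_inv c x))) (at (snd c p)) (v c)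
           else 0))"

text \<open>The coordinate expression \<open>[X,Y] = DY(X) - DX(Y)\<close>.\<close>

definition lie_bracket ::
  "('a, 'e::euclidean_space) manifold \<Rightarrow> ('a, 'e) vfield \<Rightarrow> ('a, 'e) vfield \<Rightarrow> ('a, 'e) vfield"
  where
  "lie_bracket M X Y =
     (\<lambda>p c. if c \<in> charts_at M p
            then frechet_derivative (\<lambda>x. Y (chart_inv c x) c) (at (snd c p)) (X p c)
               - frechet_derivative (\<lambda>x. X (chart_inv c x) c) (at (snd c p)) (Y p c)
            else 0)"


section \<open>Affine connections\<close>

type_synonym ('a, 'e) conn = "('a, 'e) vfield \<Rightarrow> ('a, 'e) vfield \<Rightarrow> ('a, 'e) vfield"

text \<open>
  Covariant derivatives in the sense of Koszul, where \<open>nabla X Y\<close> is the derivative of \<open>Y\<close>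
  along \<open>X\<close>; the values on arguments which are not smooth vector fields are irrelevant.
  In the Leibniz rule, the derivative of \<open>f\<close> along \<open>X\<close> is computed in the chart \<open>c\<close>.
\<close>

definition affine_connection ::
  "('a, 'e::euclidean_space) manifold \<Rightarrow> ('a, 'e) conn \<Rightarrow> bool" where
  "affine_connection M nabla \<longleftrightarrow>
     (\<forall>X\<in>vector_fields M. \<forall>Y\<in>vector_fields M. nabla X Y \<in> vector_fields M) \<and>
     (\<forall>X\<in>vector_fields M. \<forall>X'\<in>vector_fields M. \<forall>Y\<in>vector_fields M.
        nabla (\<lambda>p c. X p c + X' p c) Y = (\<lambda>p c. nabla X Y p c + nabla X' Y p c)) \<and>
     (\<forall>f. \<forall>X\<in>vector_fields M. \<forall>Y\<in>vector_fields M. smooth_fun M f \<longrightarrow>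
        nabla (\<lambda>p c. f p *\<^sub>R X p c) Y = (\<lambda>p c. f p *\<^sub>R nabla X Y p c)) \<and>
     (\<forall>X\<in>vector_fields M. \<forall>Y\<in>vector_fields M. \<forall>Y'\<in>vector_fields M.
        nabla X (\<lambda>p c. Y p c + Y' p c) = (\<lambda>p c. nabla X Y p c + nabla X Y' p c)) \<and>
     (\<forall>f. \<forall>X\<in>vector_fields M. \<forall>Y\<in>vector_fields M. smooth_fun M f \<longrightarrow>
        (\<forall>p. \<forall>c\<in>charts_at M p.
           nabla X (\<lambda>p c. f p *\<^sub>R Y p c) p c =
             frechet_derivative (\<lambda>x. f (chart_inv c x)) (at (snd c p)) (X p c) *\<^sub>R Y p c
             + f p *\<^sub>R nabla X Y p c))"

definition torsion_free ::
  "('a, 'e::euclidean_space) manifold \<Rightarrow> ('a, 'e) conn \<Rightarrow> bool" where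
  "torsion_free M nabla \<longleftrightarrow>
     (\<forall>X\<in>vector_fields M. \<forall>Y\<in>vector_fields M.
        (\<lambda>p c. nabla X Y p c - nabla Y X p c) = lie_bracket M X Y)"

text \<open>
  The bilinear map whose components are the Christoffel symbols of the connection in the chart
  \<open>c\<close> at the point \<open>p\<close>: the coordinates of \<open>nabla Y Z\<close> are \<open>DZ(Y) + \<Gamma>(Y,Z)\<close>.
\<close>

definition christoffel ::
  "('a, 'e::euclidean_space) manifold \<Rightarrow> ('a, 'e) conn \<Rightarrow> ('a, 'e) chart \<Rightarrow> 'a \<Rightarrow> 'e \<Rightarrow> 'e \<Rightarrow> 'e"
  where
  "christoffel M nabla c p u v =
     (THE w. \<forall>Y\<in>vector_fields M. \<forall>Z\<in>vector_fields M. Y p c = u \<and> Z p c = v \<longrightarrow>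
        nabla Y Z p c = frechet_derivative (\<lambda>x. Z (chart_inv c x) c) (at (snd c p)) u + w)"


section \<open>Curves and parallel transport\<close>

definition smooth_curve ::
  "('a, 'e::euclidean_space) manifold \<Rightarrow> real set \<Rightarrow> (real \<Rightarrow> 'a) \<Rightarrow> bool" where
  "smooth_curve M J \<gamma> \<longleftrightarrow>
     open J \<and> is_interval J \<and>
     continuous_map (subtopology euclideanreal J) (mtop M) \<gamma> \<and>
     (\<forall>c\<in>atlas M. smooth_on {t\<in>J. \<gamma> t \<in> fst c} (\<lambda>t. snd c (\<gamma> t)))"

text \<open>
  \<open>V\<close> is a parallel vector field along \<open>\<gamma>\<close> on the interval \<open>I\<close>, i.e. its
  covariant derivative \<open>V' + \<Gamma>(\<gamma>', V)\<close> vanishes. At an end point of \<open>I\<close>, \<open>V'\<close> is a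
  one-sided derivative.
\<close>

definition parallel_along ::
  "('a, 'e::euclidean_space) manifold \<Rightarrow> ('a, 'e) conn \<Rightarrow> real set \<Rightarrow> (real \<Rightarrow> 'a) \<Rightarrow>
   (real \<Rightarrow> ('a, 'e) tangent) \<Rightarrow> bool" where
  "parallel_along M nabla I \<gamma> V \<longleftrightarrow>
     (\<forall>t\<in>I. V t \<in> tangent_space M (\<gamma> t) \<and>
        (\<forall>c\<in>charts_at M (\<gamma> t).
           ((\<lambda>s. V s c) has_vector_derivative
              - christoffel M nabla c (\<gamma> t)
                  (vector_derivative (\<lambda>s. snd c (\<gamma> s)) (at t)) (V t c)) (at t within I)))"

text \<open>Parallel transport along \<open>\<gamma>\<close> from \<open>\<gamma> a\<close> to \<open>\<gamma> b\<close>, where \<open>b < a\<close> is allowed.\<close>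

definition parallel_transport ::
  "('a, 'e::euclidean_space) manifold \<Rightarrow> ('a, 'e) conn \<Rightarrow> (real \<Rightarrow> 'a) \<Rightarrow> real \<Rightarrow> real \<Rightarrow>
   ('a, 'e) tangent \<Rightarrow> ('a, 'e) tangent" where
  "parallel_transport M nabla \<gamma> a b v =
     (THE w. \<exists>V. parallel_along M nabla (closed_segment a b) \<gamma> V \<and> V a = v \<and> V b = w)"

text \<open>
  A smooth curve on a compact interval is the restriction of a smooth curve on
  an open interval \<open>J\<close> containing it.
\<close>

definition affine_diffeo ::
  "('a, 'e::euclidean_space) manifold \<Rightarrow> ('a, 'e) conn \<Rightarrow> 'a set \<Rightarrow> 'a set \<Rightarrow> ('a \<Rightarrow> 'a) \<Rightarrow> bool"
  where
  "affine_diffeo M nabla U V F \<longleftrightarrow>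
     diffeo_between M U V F \<and>
     (\<forall>J \<gamma>. smooth_curve M J \<gamma> \<and> \<gamma> ` J \<subseteq> U \<longrightarrow>
        (\<forall>a\<in>J. \<forall>b\<in>J. \<forall>v\<in>tangent_space M (\<gamma> a).
           tangent_map M F (\<gamma> b) (parallel_transport M nabla \<gamma> a b v) =
           parallel_transport M nabla (F \<circ> \<gamma>) a b (tangent_map M F (\<gamma> a) v)))"


section \<open>Local flows\<close>

definition integral_curve ::
  "('a, 'e::euclidean_space) manifold \<Rightarrow> ('a, 'e) vfield \<Rightarrow> real set \<Rightarrow> (real \<Rightarrow> 'a) \<Rightarrow> bool"
  where
  "integral_curve M X J \<gamma> \<longleftrightarrow>
     open J \<and> is_interval J \<and>
     continuous_map (subtopology euclideanreal J) (mtop M) \<gamma> \<and>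
     (\<forall>t\<in>J. \<forall>c\<in>charts_at M (\<gamma> t).
        ((\<lambda>s. snd c (\<gamma> s)) has_vector_derivative X (\<gamma> t) c) (at t))"

text \<open>
  The maximal local flow: the flow of \<open>X\<close> at time \<open>t\<close> is defined at \<open>m\<close> iff there is an
  integral curve starting at \<open>m\<close> which exists up to time \<open>t\<close> (negative \<open>t\<close> allowed).
\<close>

definition flow_dom ::
  "('a, 'e::euclidean_space) manifold \<Rightarrow> ('a, 'e) vfield \<Rightarrow> real \<Rightarrow> 'a set" where
  "flow_dom M X t = {m. \<exists>J \<gamma>. integral_curve M X J \<gamma> \<and> 0 \<in> J \<and> t \<in> J \<and> \<gamma> 0 = m}"

definition flow ::
  "('a, 'e::euclidean_space) manifold \<Rightarrow> ('a, 'e) vfield \<Rightarrow> real \<Rightarrow> 'a \<Rightarrow> 'a" where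
  "flow M X t m =
     (THE p. \<exists>J \<gamma>. integral_curve M X J \<gamma> \<and> 0 \<in> J \<and> t \<in> J \<and> \<gamma> 0 = m \<and> \<gamma> t = p)"


section \<open>Affine vector fields and the parallel flow\<close>

definition aff ::
  "('a, 'e::euclidean_space) manifold \<Rightarrow> ('a, 'e) conn \<Rightarrow> ('a, 'e) vfield set" where
  "aff M nabla =
     {X \<in> vector_fields M.
        \<forall>t. affine_diffeo M nabla (flow_dom M X t) (flow_dom M X (- t)) (flow M X t)}"

definition aff0 ::
  "('a, 'e::euclidean_space) manifold \<Rightarrow> ('a, 'e) conn \<Rightarrow> ('a, 'e) vfield set" where
  "aff0 M nabla =
     {X \<in> aff M nabla. \<forall>Y\<in>vector_fields M. nabla Y X = (\<lambda>p c. 0)}"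

text \<open>
  For torsion-free \<open>nabla\<close>. The pullback of vectors by the flow at time \<open>-t\<close> is the tangent map
  of the flow at time \<open>t\<close>; the transport is along the integral curve of \<open>X\<close> starting at \<open>m\<close>.
\<close>

definition parallel_flow ::
  "('a, 'e::euclidean_space) manifold \<Rightarrow> ('a, 'e) conn \<Rightarrow> ('a, 'e) vfield \<Rightarrow> real \<Rightarrow> 'a \<Rightarrow>
   ('a, 'e) tangent \<Rightarrow> ('a, 'e) tangent" where
  "parallel_flow M nabla X t m w =
     parallel_transport M nabla (\<lambda>s. flow M X s m) (2 * t) 0
       (tangent_map M (flow M X t) (flow M X t m) w)"

end

theory Submission
  imports Defs
begin

text \<open>
  Affinity of \<open>X\<close> is part of both sides, so for an affine field \<open>X\<close> with flow \<open>\<Psi>\<close> the claim is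
  that \<open>nabla X = 0\<close> iff the parallel flow of \<open>X\<close> is its flow. Both conditions concern the fields
  \<open>V(s) = T\<Psi>\<^sub>s\<^sub>-\<^sub>t(w)\<close> which the flow produces from a tangent vector \<open>w\<close> at \<open>\<gamma>(t)\<close> along an integral
  curve \<open>\<gamma>\<close>. In a chart, \<open>V' = DX(V)\<close> (lemma \<open>pushforward_has_derivative\<close>). The covariant
  derivative of \<open>V\<close> along \<open>\<gamma>\<close> is therefore \<open>DX(V) + \<Gamma>(X,V)\<close>, and absence of torsion makes this equal
  to \<open>nabla\<^sub>V X\<close> (lemma \<open>nabla_field_torsion_free\<close>). Hence \<open>nabla X\<close> measures exactly the failure of
  the flow to transport vectors in parallel along its own trajectories.

  If \<open>nabla X = 0\<close>, then \<open>V\<close> is parallel, and parallel transport from \<open>\<gamma>(2t)\<close> to \<open>\<gamma>(0)\<close> takes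
  \<open>V(2t) = T\<Psi>\<^sub>t(w)\<close> to \<open>V(0) = T\<Psi>\<^sub>-\<^sub>t(w)\<close>. Conversely, let \<open>u\<close> be a tangent vector at \<open>p\<close> and
  \<open>W(s) = T\<Psi>\<^sub>s(u)\<close>. The hypothesis at time \<open>s/2\<close>, applied to the vector \<open>W(s/2)\<close>, says that parallel
  transport from \<open>s\<close> to \<open>0\<close> takes \<open>W(s)\<close> to \<open>u\<close>. So \<open>W\<close> is the parallel field through \<open>u\<close>, and
  comparing the derivatives of the two at \<open>s = 0\<close> gives \<open>DX(u) = - \<Gamma>(X,u)\<close>, that is \<open>nabla\<^sub>u X = 0\<close>.

  Three ingredients need work. First, affinity says that each single map \<open>\<Psi>\<^sub>t\<close> is smooth on an open
  domain, which gives no information on the joint dependence on time and point. The derivative of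
  \<open>T\<Psi>\<^sub>r\<close> at \<open>r = 0\<close> is obtained from an estimate for finite differences
  (lemma \<open>flow_coord_estimate\<close>), and the group property moves it to other times. Secondly, the
  Christoffel map is extracted from an operator on global vector fields, so bump functions and frames
  are needed to see that it is well defined and continuous (lemmas \<open>exists_bump\<close>, \<open>frame_exists\<close>,
  \<open>nabla_frame\<close>, \<open>christoffel_frame\<close>). Thirdly, flow and parallel transport are given by definite
  descriptions and so depend on uniqueness, a consequence of Gronwall's inequality, and for the converse
  direction on short-time existence, a consequence of the Picard-Lindeloef theorem.
\<close>

section \<open>Calculus of C_k maps and bump functions\<close>

lemma C_k_on_cong_imp:
  assumes "open S"
  shows "(\<And>x. x \<in> S \<Longrightarrow> f x = g x) \<Longrightarrow> C_k_on k S f \<Longrightarrow> C_k_on k S g"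
proof (induction k arbitrary: f g)
  case 0
  then show ?case by (auto cong: continuous_on_cong)
next
  case (Suc k)
  have D: "(g has_derivative frechet_derivative f (at x)) (at x)" if x: "x \<in> S" for x
  proof (rule has_derivative_transform_within_open[OF _ assms x])
    show "(f has_derivative frechet_derivative f (at x)) (at x)"
      using Suc.prems(2) x by (simp add: frechet_derivative_works)
  qed (use Suc.prems(1) in auto)
  then have eq: "frechet_derivative f (at x) v = frechet_derivative g (at x) v" if "x \<in> S" for x v
    using frechet_derivative_at that by metis
  have "C_k_on k S (\<lambda>x. frechet_derivative g (at x) v)" for v
    by (rule Suc.IH[OF eq]) (use Suc.prems(2) in auto)
  then show ?case
    using D by (auto simp: differentiable_def)
qed

lemma C_k_on_SucI:
  assumes "open S" and D: "\<And>x. x \<in> S \<Longrightarrow> (f has_derivative f' x) (at x)"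
    and C: "\<And>v. C_k_on k S (\<lambda>x. f' x v)"
  shows "C_k_on (Suc k) S f"
proof -
  have "f' x v = frechet_derivative f (at x) v" if "x \<in> S" for x v
    using D[OF that] frechet_derivative_at by metis
  then have "C_k_on k S (\<lambda>x. frechet_derivative f (at x) v)" for v
    by (rule C_k_on_cong_imp[OF assms(1) _ C])
  then show ?thesis
    using D by (auto simp: differentiable_def)
qed

lemma C_k_on_SucD:
  assumes "C_k_on (Suc k) S f"
  shows "x \<in> S \<Longrightarrow> (f has_derivative frechet_derivative f (at x)) (at x)"
    and "C_k_on k S (\<lambda>x. frechet_derivative f (at x) v)"
  using assms by (auto simp: frechet_derivative_works)

lemma C_k_on_Suc_imp: "C_k_on (Suc k) S f \<Longrightarrow> C_k_on k S f"
proof (induction k arbitrary: f)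
  case 0
  then show ?case
    by (auto intro!: continuous_at_imp_continuous_on differentiable_imp_continuous_within)
next
  case (Suc k)
  then show ?case by (metis C_k_on.simps(2))
qed

lemma C_k_on_subset: "C_k_on k S f \<Longrightarrow> T \<subseteq> S \<Longrightarrow> C_k_on k T f"
  by (induction k arbitrary: f) (auto intro: continuous_on_subset)

lemma C_k_on_local:
  assumes "\<And>x. x \<in> S \<Longrightarrow> \<exists>T. open T \<and> x \<in> T \<and> C_k_on k T f"
  shows "C_k_on k S f"
  using assms
proof (induction k arbitrary: f)
  case 0
  show ?case
    unfolding C_k_on.simps
  proof (rule continuous_at_imp_continuous_on, rule ballI)
    fix x assume "x \<in> S"
    then show "isCont f x"
      using 0 by (metis C_k_on.simps(1) continuous_on_eq_continuous_at)
  qed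
next
  case (Suc k)
  have "f differentiable at x" if "x \<in> S" for x
    using Suc.prems[OF that] by auto
  moreover have "C_k_on k S (\<lambda>x. frechet_derivative f (at x) v)" for v
    by (rule Suc.IH) (use Suc.prems in force)
  ultimately show ?case by simp
qed

lemma C_k_on_const: "open S \<Longrightarrow> C_k_on k S (\<lambda>x. a)"
proof (induction k arbitrary: a)
  case (Suc k)
  show ?case by (rule C_k_on_SucI[where f'="\<lambda>x v. 0"]) (use Suc in auto)
qed auto

lemma C_k_on_add:
  assumes "open S"
  shows "C_k_on k S f \<Longrightarrow> C_k_on k S g \<Longrightarrow> C_k_on k S (\<lambda>x. f x + g x)"
proof (induction k arbitrary: f g)
  case 0
  then show ?case by (auto intro: continuous_intros)
next
  case (Suc k)
  show ?case
    by (rule C_k_on_SucI[OF assms has_derivative_add[OF C_k_on_SucD(1)[OF Suc.prems(1)]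
              C_k_on_SucD(1)[OF Suc.prems(2)]] Suc.IH])
      (use Suc.prems assms in auto)
qed

lemma C_k_on_sum:
  assumes "open S" and "\<And>i. i \<in> I \<Longrightarrow> C_k_on k S (f i)"
  shows "C_k_on k S (\<lambda>x. \<Sum>i\<in>I. f i x)"
  using assms(2) by (induction I rule: infinite_finite_induct) (auto intro: C_k_on_const C_k_on_add assms(1))

lemma C_k_on_bounded_linear:
  assumes "open S" and "bounded_linear h"
  shows "C_k_on k S f \<Longrightarrow> C_k_on k S (\<lambda>x. h (f x))"
proof (induction k arbitrary: f)
  case 0
  then show ?case using assms bounded_linear.continuous_on by auto
next
  case (Suc k)
  show ?case
    by (rule C_k_on_SucI[OF assms(1) bounded_linear.has_derivative[OF assms(2) C_k_on_SucD(1)[OF Suc.prems]] Suc.IH])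
      (use Suc.prems assms in auto)
qed

lemma C_k_on_scaleR:
  fixes f :: "'b::euclidean_space \<Rightarrow> real"
  assumes "open S"
  shows "C_k_on k S f \<Longrightarrow> C_k_on k S g \<Longrightarrow> C_k_on k S (\<lambda>x. f x *\<^sub>R g x)"
proof (induction k arbitrary: f g)
  case 0
  then show ?case by (auto intro: continuous_intros)
next
  case (Suc k)
  show ?case
    by (rule C_k_on_SucI[OF assms has_derivative_scaleR[OF C_k_on_SucD(1)[OF Suc.prems(1)]
              C_k_on_SucD(1)[OF Suc.prems(2)]] C_k_on_add[OF assms Suc.IH Suc.IH]])
      (use Suc.prems assms C_k_on_Suc_imp in auto)
qed

lemma C_k_on_mult:
  fixes f g :: "'b::euclidean_space \<Rightarrow> real"
  assumes "open S" and "C_k_on k S f" and "C_k_on k S g"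
  shows "C_k_on k S (\<lambda>x. f x * g x)"
  using C_k_on_scaleR[OF assms] by simp

text \<open>
  Expanding the chain rule over the standard basis turns \<open>D(g \<circ> f)(x) v\<close> into a sum of products of
  functions \<open>Df(x) v \<bullet> b\<close> and \<open>Dg(f x) b\<close>; the latter are again compositions with \<open>f\<close>, of a function
  with one derivative less.
\<close>

lemma C_k_on_compose:
  fixes f :: "'b::euclidean_space \<Rightarrow> 'c::euclidean_space"
    and g :: "'c \<Rightarrow> 'd::euclidean_space"
  assumes S: "open S" and T: "open T" and sub: "f ` S \<subseteq> T"
  shows "C_k_on k S f \<Longrightarrow> C_k_on k T g \<Longrightarrow> C_k_on k S (\<lambda>x. g (f x))"
proof (induction k arbitrary: g)
  case 0
  then show ?case using sub continuous_on_compose2 by auto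
next
  case (Suc k)
  let ?Df = "\<lambda>x. frechet_derivative f (at x)"
  let ?Dg = "\<lambda>x. frechet_derivative g (at x)"
  have D: "((\<lambda>x. g (f x)) has_derivative (\<lambda>v. \<Sum>b\<in>Basis. (?Df x v \<bullet> b) *\<^sub>R ?Dg (f x) b)) (at x)"
    if "x \<in> S" for x
  proof -
    have g: "(g has_derivative ?Dg (f x)) (at (f x))"
      using that sub by (auto intro!: C_k_on_SucD(1)[OF Suc.prems(2)])
    have "((\<lambda>x. g (f x)) has_derivative (\<lambda>v. ?Dg (f x) (?Df x v))) (at x)"
      by (rule has_derivative_compose[OF C_k_on_SucD(1)[OF Suc.prems(1) that] g])
    moreover have "?Dg (f x) (?Df x v) = (\<Sum>b\<in>Basis. (?Df x v \<bullet> b) *\<^sub>R ?Dg (f x) b)" for v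
    proof -
      have "?Dg (f x) (?Df x v) = ?Dg (f x) (\<Sum>b\<in>Basis. (?Df x v \<bullet> b) *\<^sub>R b)"
        by (simp add: euclidean_representation)
      also have "\<dots> = (\<Sum>b\<in>Basis. (?Df x v \<bullet> b) *\<^sub>R ?Dg (f x) b)"
        using has_derivative_linear[OF g] by (simp add: linear_sum linear_cmul)
      finally show ?thesis .
    qed
    ultimately show ?thesis by (rule has_derivative_eq_rhs[OF _ ext])
  qed
  have "C_k_on k S (\<lambda>x. ?Df x v \<bullet> b)" for v b
    using C_k_on_bounded_linear[OF S bounded_linear_inner_left] C_k_on_SucD(2)[OF Suc.prems(1)] by blast
  moreover have "C_k_on k S (\<lambda>x. ?Dg (f x) b)" for b
    by (rule Suc.IH[OF C_k_on_Suc_imp[OF Suc.prems(1)] C_k_on_SucD(2)[OF Suc.prems(2)]])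
  ultimately show ?case
    by (intro C_k_on_SucI[OF S D] C_k_on_sum[OF S] C_k_on_scaleR[OF S])
qed

lemma C_k_on_linear:
  assumes "open S" and "bounded_linear h"
  shows "C_k_on k S h"
proof -
  have "C_k_on k S (\<lambda>x::'a. x)"
  proof (cases k)
    case (Suc m)
    show ?thesis
      unfolding Suc by (rule C_k_on_SucI[OF assms(1) has_derivative_ident C_k_on_const[OF assms(1)]])
  qed simp
  then show ?thesis using C_k_on_bounded_linear[OF assms] by blast
qed

lemma smooth_on_has_derivative:
  "smooth_on S f \<Longrightarrow> x \<in> S \<Longrightarrow> (f has_derivative frechet_derivative f (at x)) (at x)"
  unfolding smooth_on_def using C_k_on_SucD(1) by blast

lemma smooth_on_derivative: "smooth_on S f \<Longrightarrow> smooth_on S (\<lambda>x. frechet_derivative f (at x) v)"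
  unfolding smooth_on_def using C_k_on_SucD(2) by blast

lemma smooth_on_cong: "open S \<Longrightarrow> smooth_on S f \<Longrightarrow> (\<And>x. x \<in> S \<Longrightarrow> f x = g x) \<Longrightarrow> smooth_on S g"
  by (auto simp: smooth_on_def intro: C_k_on_cong_imp)

lemma smooth_on_const: "open S \<Longrightarrow> smooth_on S (\<lambda>x. a)"
  by (auto simp: smooth_on_def intro: C_k_on_const)

lemma smooth_on_sum: "open S \<Longrightarrow> (\<And>i. i \<in> I \<Longrightarrow> smooth_on S (f i)) \<Longrightarrow> smooth_on S (\<lambda>x. \<Sum>i\<in>I. f i x)"
  by (auto simp: smooth_on_def intro: C_k_on_sum)

lemma smooth_on_scaleR:
  fixes f :: "'b::euclidean_space \<Rightarrow> real"
  shows "open S \<Longrightarrow> smooth_on S f \<Longrightarrow> smooth_on S g \<Longrightarrow> smooth_on S (\<lambda>x. f x *\<^sub>R g x)"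
  by (auto simp: smooth_on_def intro: C_k_on_scaleR)

lemma smooth_on_inner_const: "open S \<Longrightarrow> smooth_on S f \<Longrightarrow> smooth_on S (\<lambda>x. f x \<bullet> b)"
  by (auto simp: smooth_on_def intro: C_k_on_bounded_linear[OF _ bounded_linear_inner_left])

lemma smooth_on_compose:
  "open S \<Longrightarrow> open T \<Longrightarrow> f ` S \<subseteq> T \<Longrightarrow> smooth_on S f \<Longrightarrow> smooth_on T g \<Longrightarrow> smooth_on S (\<lambda>x. g (f x))"
  by (auto simp: smooth_on_def intro: C_k_on_compose)

lemma smooth_on_subset: "smooth_on S f \<Longrightarrow> T \<subseteq> S \<Longrightarrow> smooth_on T f"
  by (auto simp: smooth_on_def intro: C_k_on_subset)

lemma smooth_on_local: "(\<And>x. x \<in> S \<Longrightarrow> \<exists>T. open T \<and> x \<in> T \<and> smooth_on T f) \<Longrightarrow> smooth_on S f"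
  unfolding smooth_on_def by (meson C_k_on_local)

lemma smooth_on_continuous: "smooth_on S f \<Longrightarrow> continuous_on S f"
  unfolding smooth_on_def by (metis C_k_on.simps(1))

text \<open>
  The functions \<open>exp(-1/x) / x^n\<close>, extended by \<open>0\<close>, are closed under differentiation up to linear
  combinations. Treating all exponents \<open>n\<close> at once makes the smoothness of \<open>exp(-1/x)\<close> a plain induction.
\<close>

definition flat_exp :: "nat \<Rightarrow> real \<Rightarrow> real" where
  "flat_exp n x = (if x \<le> 0 then 0 else exp (- (1 / x)) / x ^ n)"

lemma flat_exp_tendsto: "(flat_exp n \<longlongrightarrow> 0) (at_right 0)"
proof -
  have "((\<lambda>y::real. y ^ n / exp y) \<longlongrightarrow> 0) at_top"
    by (rule tendsto_power_div_exp_0)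
  then have "((\<lambda>x::real. inverse x ^ n / exp (inverse x)) \<longlongrightarrow> 0) (at_right 0)"
    by (rule filterlim_compose[OF _ filterlim_inverse_at_top_right])
  then show ?thesis
    by (rule Lim_transform_eventually)
      (auto simp: eventually_at_filter flat_exp_def exp_minus field_simps)
qed

lemma flat_exp_has_derivative:
  "(flat_exp n has_real_derivative (- real n * flat_exp (Suc n) x + flat_exp (Suc (Suc n)) x)) (at x)"
proof (rule linorder_cases[of x 0])
  assume x: "x < 0"
  have "((\<lambda>x. 0) has_real_derivative 0) (at x)" by simp
  then have "(flat_exp n has_real_derivative 0) (at x)"
    by (rule has_field_derivative_transform_within_open[where S="{..<0}"])
      (use x in \<open>auto simp: flat_exp_def\<close>)
  then show ?thesis using x by (simp add: flat_exp_def)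
next
  assume x: "x > 0"
  have "((\<lambda>x. exp (- (1 / x)) / x ^ n) has_real_derivative
     (exp (- (1 / x)) * (1 / x\<^sup>2) * x ^ n - exp (- (1 / x)) * (real n * x ^ (n - 1))) / (x ^ n * x ^ n)) (at x)"
    using x by (auto intro!: derivative_eq_intros simp: power2_eq_square)
  moreover have "(exp (- (1 / x)) * (1 / x\<^sup>2) * x ^ n - exp (- (1 / x)) * (real n * x ^ (n - 1))) / (x ^ n * x ^ n)
     = - real n * flat_exp (Suc n) x + flat_exp (Suc (Suc n)) x"
  proof -
    define E where "E = exp (- (1 / x))"
    define P where "P = x ^ n"
    have P: "P \<noteq> 0" using x by (simp add: P_def)
    have "real n * x ^ (n - 1) = real n * P / x"
      using x by (cases n) (simp_all add: P_def)
    then have "(E * (1 / x\<^sup>2) * P - E * (real n * x ^ (n - 1))) / (P * P)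
      = - real n * (E / (x * P)) + E / (x * (x * P))"
      using x P by (auto simp: field_simps power2_eq_square)
    then show ?thesis
      using x by (simp add: flat_exp_def E_def P_def)
  qed
  ultimately have "((\<lambda>x. exp (- (1 / x)) / x ^ n) has_real_derivative
     - real n * flat_exp (Suc n) x + flat_exp (Suc (Suc n)) x) (at x)"
    by simp
  then show ?thesis
    by (rule has_field_derivative_transform_within_open[where S="{0<..}"])
      (use x in \<open>auto simp: flat_exp_def\<close>)
next
  assume x: "x = 0"
  have "((\<lambda>y. (flat_exp n y - flat_exp n 0) / (y - 0)) \<longlongrightarrow> 0) (at 0)"
  proof (rule filterlim_split_at)
    show "((\<lambda>y. (flat_exp n y - flat_exp n 0) / (y - 0)) \<longlongrightarrow> 0) (at_left 0)"
      by (rule Lim_transform_eventually[OF tendsto_const])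
        (auto simp: eventually_at_filter flat_exp_def)
    show "((\<lambda>y. (flat_exp n y - flat_exp n 0) / (y - 0)) \<longlongrightarrow> 0) (at_right 0)"
      by (rule Lim_transform_eventually[OF flat_exp_tendsto[of "Suc n"]])
        (auto simp: eventually_at_filter flat_exp_def)
  qed
  then show ?thesis
    using x by (simp add: has_field_derivative_iff flat_exp_def)
qed

lemma C_k_on_flat_exp: "C_k_on k UNIV (flat_exp n)"
proof (induction k arbitrary: n)
  case 0
  then show ?case
    by (auto intro!: continuous_at_imp_continuous_on DERIV_isCont[OF flat_exp_has_derivative])
next
  case (Suc k)
  have D: "(flat_exp n has_derivative (\<lambda>v. (- real n * flat_exp (Suc n) x + flat_exp (Suc (Suc n)) x) * v)) (at x)" for x
    using flat_exp_has_derivative[of n x] by (simp add: has_field_derivative_def)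
  show ?case
    by (rule C_k_on_SucI[OF open_UNIV D])
      (intro C_k_on_mult C_k_on_add C_k_on_const Suc open_UNIV)
qed

lemma flat_exp_mono: "x \<le> y \<Longrightarrow> flat_exp 0 x \<le> flat_exp 0 y"
  by (auto simp: flat_exp_def field_simps)

text \<open>
  With \<open>h = flat_exp 0\<close> and \<open>y(x) = |x - x0|^2 - r^2\<close>, the function \<open>h(c - h(y(x)))\<close> is the positive
  constant \<open>h(c)\<close> where \<open>y \<le> 0\<close> and vanishes where \<open>h(y) \<ge> c\<close>. The choice \<open>c = h(3 r^2)\<close> makes the
  latter region the complement of the open ball of radius \<open>2 r\<close>. In contrast to the usual quotient construction,
  only division by a constant occurs.
\<close>

lemma exists_smooth_bump:
  fixes x0 :: "'b::euclidean_space"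
  assumes "0 < r"
  shows "\<exists>f :: 'b \<Rightarrow> real. smooth_on UNIV f \<and> (\<forall>x\<in>ball x0 r. f x = 1) \<and> (\<forall>x. x \<notin> cball x0 (2 * r) \<longrightarrow> f x = 0)"
proof -
  define c where "c = flat_exp 0 (3 * r\<^sup>2)"
  define y where "y = (\<lambda>x::'b. (x - x0) \<bullet> (x - x0) - r\<^sup>2)"
  define f where "f = (\<lambda>x. flat_exp 0 (c - flat_exp 0 (y x)) / flat_exp 0 c)"
  have c: "c > 0" "flat_exp 0 c > 0"
    using assms by (auto simp: c_def flat_exp_def)
  have y_eq: "y x = (norm (x - x0))\<^sup>2 - r\<^sup>2" for x
    by (simp add: y_def power2_norm_eq_inner)
  have "smooth_on UNIV f"
    unfolding smooth_on_def
  proof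
    fix k
    have id: "C_k_on k UNIV (\<lambda>x::'b. x - x0)"
      using C_k_on_add[OF open_UNIV C_k_on_linear[OF open_UNIV bounded_linear_ident] C_k_on_const[of _ _ "- x0"]]
      by simp
    have "C_k_on k UNIV (\<lambda>x. \<Sum>b\<in>Basis. ((x - x0) \<bullet> b) * ((x - x0) \<bullet> b))"
      by (intro C_k_on_sum C_k_on_mult C_k_on_bounded_linear[OF open_UNIV bounded_linear_inner_left id] open_UNIV)
    moreover have "y = (\<lambda>x. (\<Sum>b\<in>Basis. ((x - x0) \<bullet> b) * ((x - x0) \<bullet> b)) + - r\<^sup>2)"
      unfolding y_def by (subst euclidean_inner) simp
    ultimately have y: "C_k_on k UNIV y"
      by (simp only:) (rule C_k_on_add[OF open_UNIV _ C_k_on_const[OF open_UNIV]])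
    have "C_k_on k UNIV (\<lambda>x. c + (- 1) * flat_exp 0 (y x))"
      by (intro C_k_on_add C_k_on_mult C_k_on_const open_UNIV
          C_k_on_compose[OF open_UNIV open_UNIV subset_UNIV y C_k_on_flat_exp])
    then have "C_k_on k UNIV (\<lambda>x. inverse (flat_exp 0 c) * flat_exp 0 (c + (- 1) * flat_exp 0 (y x)))"
      by (intro C_k_on_mult C_k_on_const open_UNIV
          C_k_on_compose[OF open_UNIV open_UNIV subset_UNIV _ C_k_on_flat_exp])
    then show "C_k_on k UNIV f" by (simp add: f_def field_simps)
  qed
  moreover have "f x = 1" if "x \<in> ball x0 r" for x
  proof -
    have "norm (x - x0) < r" using that by (simp add: dist_norm norm_minus_commute)
    then have "y x \<le> 0" unfolding y_eq by (simp add: power_mono)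
    then show ?thesis using c by (simp add: f_def flat_exp_def)
  qed
  moreover have "f x = 0" if "x \<notin> cball x0 (2 * r)" for x
  proof -
    have "norm (x - x0) \<ge> 2 * r" using that by (simp add: dist_norm norm_minus_commute)
    then have "(norm (x - x0))\<^sup>2 \<ge> (2 * r)\<^sup>2" using assms by (intro power_mono) auto
    then have "y x \<ge> 3 * r\<^sup>2" unfolding y_eq by (simp add: power_mult_distrib)
    then have "flat_exp 0 (y x) \<ge> c" unfolding c_def by (rule flat_exp_mono)
    then show ?thesis by (simp add: f_def flat_exp_def)
  qed
  ultimately show ?thesis by blast
qed

section \<open>Ordinary differential equations and strict differentiability\<close>

lemma vector_derivative_norm_bound:
  fixes u :: "real \<Rightarrow> 'e::real_normed_vector"
  assumes "is_interval I" "\<And>r. r \<in> I \<Longrightarrow> (u has_vector_derivative u' r) (at r within I)"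
    and "\<And>r. r \<in> I \<Longrightarrow> norm (u' r) \<le> B" and "s \<in> I" "t \<in> I"
  shows "norm (u t - u s) \<le> B * \<bar>t - s\<bar>"
proof -
  have "onorm (\<lambda>h. h *\<^sub>R u' r) \<le> B" if "r \<in> I" for r
    by (rule onorm_le) (use assms(3)[OF that] in \<open>simp add: mult_left_mono mult.commute[of B]\<close>)
  from differentiable_bound[OF is_interval_convex[OF assms(1)]
      assms(2)[unfolded has_vector_derivative_def] this assms(5,4)]
  show ?thesis by simp
qed

text \<open>
  The function \<open>exp(- 2 L r) |u(r)|^2\<close> is nonincreasing, since \<open>u \<bullet> u' \<le> L |u|^2\<close>.
\<close>

lemma gronwall_forward:
  fixes u :: "real \<Rightarrow> 'e::real_inner"
  assumes "s \<le> t" and D: "\<And>r. r \<in> {s..t} \<Longrightarrow> (u has_vector_derivative u' r) (at r within {s..t})"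
    and L: "\<And>r. r \<in> {s..t} \<Longrightarrow> norm (u' r) \<le> L * norm (u r)"
  shows "norm (u t) \<le> exp (L * (t - s)) * norm (u s)"
proof -
  define \<phi> where "\<phi> = (\<lambda>r. exp (- (2 * L * r)) * (u r \<bullet> u r))"
  have cont: "continuous_on {s..t} u"
    using D has_vector_derivative_continuous continuous_on_eq_continuous_within by blast
  have "\<phi> t \<le> \<phi> s"
  proof (rule DERIV_nonpos_imp_decreasing_open[OF assms(1)])
    show "continuous_on {s..t} \<phi>"
      unfolding \<phi>_def by (intro continuous_intros cont)
  next
    fix r assume r: "s < r" "r < t"
    have "at r within {s..t} = at r"
      using r by (simp add: at_within_Icc_at)
    then have u: "(u has_vector_derivative u' r) (at r)"
      using D[of r] r by simp
    then have ui: "((\<lambda>r. u r \<bullet> u r) has_real_derivative 2 * (u r \<bullet> u' r)) (at r)"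
      unfolding has_vector_derivative_def has_field_derivative_def
      by (auto intro!: derivative_eq_intros ext simp: inner_commute)
    have "(\<phi> has_real_derivative exp (- (2 * L * r)) * (2 * (u r \<bullet> u' r)) + exp (- (2 * L * r)) * (- (2 * L)) * (u r \<bullet> u r)) (at r)"
      unfolding \<phi>_def by (auto intro!: derivative_eq_intros ui)
    moreover have "u r \<bullet> u' r \<le> L * (u r \<bullet> u r)"
    proof -
      have "u r \<bullet> u' r \<le> norm (u r) * norm (u' r)" by (rule norm_cauchy_schwarz)
      also have "\<dots> \<le> norm (u r) * (L * norm (u r))"
        using L[of r] r by (intro mult_left_mono) auto
      finally show ?thesis by (simp add: dot_square_norm power2_eq_square mult_ac)
    qed
    then have "exp (- (2 * L * r)) * (2 * (u r \<bullet> u' r)) + exp (- (2 * L * r)) * (- (2 * L)) * (u r \<bullet> u r) \<le> 0"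
      using mult_left_mono[of "u r \<bullet> u' r" "L * (u r \<bullet> u r)" "2 * exp (- (2 * L * r))"] by (simp add: mult_ac)
    ultimately show "\<exists>y. (\<phi> has_real_derivative y) (at r) \<and> y \<le> 0" by blast
  qed
  then have "(norm (u t))\<^sup>2 \<le> exp (2 * L * t) * exp (- (2 * L * s)) * (norm (u s))\<^sup>2"
    unfolding \<phi>_def dot_square_norm exp_minus by (simp add: field_simps)
  also have "\<dots> = (exp (L * (t - s)) * norm (u s))\<^sup>2"
    by (simp add: power_mult_distrib exp_add[symmetric] exp_double[symmetric] algebra_simps)
  finally show ?thesis
    by (rule power2_le_imp_le) simp
qed

text \<open>
  The two-sided form, by reversal of time; with \<open>u(s) = 0\<close> it is the uniqueness statement behind
  integral curves and parallel fields.
\<close>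

lemma gronwall:
  fixes u :: "real \<Rightarrow> 'e::real_inner"
  assumes "is_interval I" and D: "\<And>r. r \<in> I \<Longrightarrow> (u has_vector_derivative u' r) (at r within I)"
    and L: "\<And>r. r \<in> I \<Longrightarrow> norm (u' r) \<le> L * norm (u r)" and st: "s \<in> I" "t \<in> I"
  shows "norm (u t) \<le> exp (L * \<bar>t - s\<bar>) * norm (u s)"
proof (cases "s \<le> t")
  case True
  have sub: "{s..t} \<subseteq> I"
    using assms(1) st by (meson atLeastAtMost_iff is_interval_1 subsetI)
  have "norm (u t) \<le> exp (L * (t - s)) * norm (u s)"
    by (rule gronwall_forward[OF True has_vector_derivative_within_subset[OF D sub] L]) (use sub in auto)
  then show ?thesis using True by simp
next
  case False
  have sub: "{t..s} \<subseteq> I"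
    using assms(1) st by (meson atLeastAtMost_iff is_interval_1 subsetI)
  have "norm ((u \<circ> uminus) (- t)) \<le> exp (L * (- t - - s)) * norm ((u \<circ> uminus) (- s))"
  proof (rule gronwall_forward)
    fix r assume r: "r \<in> {- s..- t}"
    have "((\<lambda>r. - r) has_vector_derivative - 1) (at r within {- s..- t})"
      by (auto intro!: derivative_eq_intros)
    moreover have "(u has_vector_derivative u' (- r)) (at (- r) within uminus ` {- s..- t})"
      by (rule has_vector_derivative_within_subset[OF D]) (use r sub in auto)
    ultimately show "(u \<circ> uminus has_vector_derivative (- 1) *\<^sub>R u' (- r)) (at r within {- s..- t})"
      by (rule vector_diff_chain_within)
    show "norm ((- 1) *\<^sub>R u' (- r)) \<le> L * norm ((u \<circ> uminus) r)"
      using L[of "- r"] r sub by (auto simp: subset_iff)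
  qed (use False in auto)
  then show ?thesis using False by simp
qed

text \<open>
  By continuity of the partial derivatives, \<open>f - Df(x0)\<close> has a small derivative on a small ball around
  \<open>x0\<close>, and the mean value inequality applies. This serves both as a local Lipschitz bound and as the
  linearization in the study of the flow.
\<close>

lemma C1_strict_differentiable:
  fixes f :: "'b::euclidean_space \<Rightarrow> 'c::euclidean_space"
  assumes "open S" "x0 \<in> S" and f: "C_k_on (Suc 0) S f" and "0 < e"
  shows "\<exists>R>0. cball x0 R \<subseteq> S \<and> (\<forall>a\<in>cball x0 R. \<forall>b\<in>cball x0 R.
     norm (f a - f b - frechet_derivative f (at x0) (a - b)) \<le> e * norm (a - b))"
proof -
  let ?D = "\<lambda>x. frechet_derivative f (at x)"
  define e' where "e' = e / DIM('b)"
  have e': "e' > 0" using assms by (simp add: e'_def)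
  have "\<forall>\<^sub>F x in nhds x0. x \<in> S \<and> (\<forall>b\<in>Basis. norm (?D x b - ?D x0 b) < e')"
  proof (intro eventually_conj eventually_ball_finite ballI)
    show "\<forall>\<^sub>F x in nhds x0. x \<in> S" using assms eventually_nhds by blast
  next
    fix b :: 'b
    have "continuous_on S (\<lambda>x. ?D x b)" using C_k_on_SucD(2)[OF f] by simp
    then have "isCont (\<lambda>x. ?D x b) x0" using assms continuous_on_eq_continuous_at by blast
    then have "((\<lambda>x. ?D x b) \<longlongrightarrow> ?D x0 b) (nhds x0)"
      using tendsto_at_iff_tendsto_nhds[of "\<lambda>x. ?D x b" x0] by (simp add: isCont_def)
    then show "\<forall>\<^sub>F x in nhds x0. norm (?D x b - ?D x0 b) < e'"
      using e' by (simp add: tendsto_iff dist_norm)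
  qed auto
  then obtain d where d: "d > 0" and near: "\<And>x. dist x x0 < d \<Longrightarrow> x \<in> S \<and> (\<forall>b\<in>Basis. norm (?D x b - ?D x0 b) < e')"
    unfolding eventually_nhds_metric by blast
  define R where "R = d / 2"
  have R: "R > 0" "\<And>x. x \<in> cball x0 R \<Longrightarrow> dist x x0 < d"
    using d by (auto simp: R_def dist_commute)
  have lin0: "linear (?D x0)"
    using C_k_on_SucD(1)[OF f assms(2)] has_derivative_linear by blast
  have "norm (f a - ?D x0 a - (f b - ?D x0 b)) \<le> e * norm (a - b)" if "a \<in> cball x0 R" "b \<in> cball x0 R" for a b
  proof (rule differentiable_bound[where S="cball x0 R" and f="\<lambda>x. f x - ?D x0 x" and f'="\<lambda>x v. ?D x v - ?D x0 v"])
    fix x assume x: "x \<in> cball x0 R"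
    then have xS: "x \<in> S" using near R by blast
    note Dx = C_k_on_SucD(1)[OF f xS]
    show "((\<lambda>x. f x - ?D x0 x) has_derivative (\<lambda>v. ?D x v - ?D x0 v)) (at x within cball x0 R)"
      by (intro has_derivative_diff has_derivative_at_withinI[OF Dx] linear_imp_has_derivative lin0)
    show "onorm (\<lambda>v. ?D x v - ?D x0 v) \<le> e"
    proof (rule onorm_le)
      fix v
      have lin: "linear (\<lambda>v. ?D x v - ?D x0 v)"
        by (intro linear_compose_sub has_derivative_linear[OF Dx] lin0)
      have "?D x v - ?D x0 v = (\<lambda>v. ?D x v - ?D x0 v) (\<Sum>b\<in>Basis. (v \<bullet> b) *\<^sub>R b)"
        by (simp add: euclidean_representation)
      also have "\<dots> = (\<Sum>b\<in>Basis. (v \<bullet> b) *\<^sub>R (?D x b - ?D x0 b))"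
        by (simp only: linear_sum[OF lin] linear_cmul[OF lin])
      also have "norm \<dots> \<le> (\<Sum>b\<in>(Basis::'b set). norm v * e')"
        using near[OF R(2)[OF x]] e'
        by (intro sum_norm_le) (auto intro!: mult_mono less_imp_le[of "norm _"] Basis_le_norm)
      also have "\<dots> = e * norm v" by (simp add: e'_def)
      finally show "norm (?D x v - ?D x0 v) \<le> e * norm v" .
    qed
  qed (use that in auto)
  then have "\<forall>a\<in>cball x0 R. \<forall>b\<in>cball x0 R. norm (f a - f b - ?D x0 (a - b)) \<le> e * norm (a - b)"
    by (simp add: linear_diff[OF lin0] algebra_simps)
  moreover have "cball x0 R \<subseteq> S" using near R by blast
  ultimately show ?thesis using R by blast
qed

text \<open>
  The integral operator is a contraction on the bounded continuous functions on the whole real line;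
  arguments are clamped to \<open>[\<alpha>, \<beta>]\<close> so that this complete space can be used. The right-hand side is
  required to be Lipschitz globally in the space variable: linear equations satisfy this, and vector
  fields do after being cut off. The initial time may lie anywhere in the interval, because
  parallel fields will be prescribed at either end.
\<close>

lemma picard_lindelof:
  fixes F :: "real \<Rightarrow> 'e::euclidean_space \<Rightarrow> 'e"
  assumes t0: "t0 \<in> {\<alpha>..\<beta>}" and F: "continuous_on ({\<alpha>..\<beta>} \<times> UNIV) (\<lambda>(t, x). F t x)"
    and L: "\<And>t x y. t \<in> {\<alpha>..\<beta>} \<Longrightarrow> norm (F t x - F t y) \<le> L * norm (x - y)"
    and "0 \<le> L" and small: "L * (\<beta> - \<alpha>) < 1"
  shows "\<exists>y. y t0 = x0 \<and> (\<forall>t\<in>{\<alpha>..\<beta>}. (y has_vector_derivative F t (y t)) (at t within {\<alpha>..\<beta>}))"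
proof -
  let ?I = "{\<alpha>..\<beta>}"
  define cl where "cl = (\<lambda>t. max \<alpha> (min \<beta> t))"
  have cl: "cl t \<in> ?I" "t \<in> ?I \<Longrightarrow> cl t = t" for t
    using t0 by (auto simp: cl_def)
  have cont_cl: "continuous_on UNIV cl" unfolding cl_def by (intro continuous_intros)
  have contF: "continuous_on ?I (\<lambda>s. F s (apply_bcontfun y s))" for y
  proof -
    have "continuous_on ?I (\<lambda>s. (\<lambda>(t, x). F t x) (s, apply_bcontfun y s))"
      by (rule continuous_on_compose2[OF F]) (auto intro!: continuous_intros)
    then show ?thesis by simp
  qed
  define P where "P = (\<lambda>y t. x0 + integral {\<alpha>..t} (\<lambda>s. F s (apply_bcontfun y s))
     - integral {\<alpha>..t0} (\<lambda>s. F s (apply_bcontfun y s)))"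
  have P_deriv: "(P y has_vector_derivative F t (apply_bcontfun y t)) (at t within ?I)" if "t \<in> ?I" for y t
    unfolding P_def
    by (auto intro!: derivative_eq_intros integral_has_vector_derivative[OF contF that])
  have P_cont: "continuous_on ?I (P y)" for y
    using P_deriv has_vector_derivative_continuous continuous_on_eq_continuous_within by blast
  have P_bcont: "(\<lambda>t. P y (cl t)) \<in> bcontfun" for y
  proof -
    have "bounded (P y ` ?I)"
      using compact_continuous_image[OF P_cont] compact_imp_bounded by blast
    then have "bounded (range (\<lambda>t. P y (cl t)))"
      by (rule bounded_subset) (use cl in auto)
    moreover have "continuous_on UNIV (\<lambda>t. P y (cl t))"
      by (rule continuous_on_compose2[OF P_cont cont_cl]) (use cl in auto)
    ultimately show ?thesis by (simp add: bcontfun_def)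
  qed
  define \<Phi> where "\<Phi> = (\<lambda>y. Bcontfun (\<lambda>t. P y (cl t)))"
  have \<Phi>: "apply_bcontfun (\<Phi> y) t = P y (cl t)" for y t
    unfolding \<Phi>_def using Bcontfun_inverse[OF P_bcont] by metis
  have "dist (\<Phi> y) (\<Phi> z) \<le> (L * (\<beta> - \<alpha>)) * dist y z" for y z
  proof (rule dist_bound)
    fix t
    have "norm ((P y (cl t) - P z (cl t)) - (P y t0 - P z t0)) \<le> (L * dist y z) * \<bar>cl t - t0\<bar>"
    proof (rule vector_derivative_norm_bound[where I="?I" and u'="\<lambda>r. F r (apply_bcontfun y r) - F r (apply_bcontfun z r)"])
      fix r assume r: "r \<in> ?I"
      show "((\<lambda>t. P y t - P z t) has_vector_derivative F r (apply_bcontfun y r) - F r (apply_bcontfun z r)) (at r within ?I)"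
        by (intro has_vector_derivative_diff P_deriv r)
      have "norm (F r (apply_bcontfun y r) - F r (apply_bcontfun z r)) \<le> L * dist (apply_bcontfun y r) (apply_bcontfun z r)"
        using L[OF r] by (simp add: dist_norm)
      also have "\<dots> \<le> L * dist y z"
        using \<open>0 \<le> L\<close> dist_bounded by (intro mult_left_mono)
      finally show "norm (F r (apply_bcontfun y r) - F r (apply_bcontfun z r)) \<le> L * dist y z" .
    qed (use t0 cl in \<open>auto simp: is_interval_cc\<close>)
    also have "\<dots> \<le> (L * dist y z) * (\<beta> - \<alpha>)"
      using \<open>0 \<le> L\<close> cl[of t] t0 by (intro mult_left_mono) auto
    finally show "dist (apply_bcontfun (\<Phi> y) t) (apply_bcontfun (\<Phi> z) t) \<le> L * (\<beta> - \<alpha>) * dist y z"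
      by (simp add: \<Phi> dist_norm P_def mult_ac)
  qed
  then have "\<exists>!y. \<Phi> y = y"
    using small t0 \<open>0 \<le> L\<close> by (intro banach_fix_type) auto
  then obtain y where y: "\<Phi> y = y" by blast
  have yP: "apply_bcontfun y t = P y t" if "t \<in> ?I" for t
    using \<Phi>[of y t] cl(2)[OF that] y by simp
  have "P y t0 = x0" by (simp add: P_def)
  moreover have "(P y has_vector_derivative F t (P y t)) (at t within ?I)" if "t \<in> ?I" for t
    using P_deriv[OF that, of y] yP[OF that] by simp
  ultimately show ?thesis by blast
qed

section \<open>Charts, tangent vectors and tangent maps\<close>

locale smooth_mfd =
  fixes M :: "('a, 'e::euclidean_space) manifold"
  assumes smooth_manifold: "smooth_manifold M"
begin

abbreviation trans_map :: "('a, 'e) chart \<Rightarrow> ('a, 'e) chart \<Rightarrow> 'e \<Rightarrow> 'e" where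
  "trans_map c d \<equiv> \<lambda>x. snd d (chart_inv c x)"

abbreviation D_trans :: "('a, 'e) chart \<Rightarrow> ('a, 'e) chart \<Rightarrow> 'a \<Rightarrow> 'e \<Rightarrow> 'e" where
  "D_trans c d p \<equiv> frechet_derivative (trans_map c d) (at (snd c p))"

lemma charts_at_iff: "c \<in> charts_at M p \<longleftrightarrow> c \<in> atlas M \<and> p \<in> fst c"
  by (auto simp: charts_at_def)

lemma Hausdorff: "Hausdorff_space (mtop M)"
  using smooth_manifold by (simp add: smooth_manifold_def)

lemma charts_at_exists: "p \<in> topspace (mtop M) \<Longrightarrow> \<exists>c. c \<in> charts_at M p"
  using smooth_manifold by (auto simp: smooth_manifold_def charts_at_iff)

lemma charts_at_topspace: "c \<in> charts_at M p \<Longrightarrow> p \<in> topspace (mtop M)"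
  using smooth_manifold by (auto simp: smooth_manifold_def charts_at_iff)

context
  fixes c :: "('a, 'e) chart"
  assumes c: "c \<in> atlas M"
begin

lemma openin_chart: "openin (mtop M) (fst c)"
  and open_chart_image: "open (snd c ` fst c)"
  and homeomorphic_chart: "homeomorphic_map (subtopology (mtop M) (fst c))
          (subtopology euclidean (snd c ` fst c)) (snd c)"
  using smooth_manifold c by (auto simp: smooth_manifold_def)

lemma topspace_chart: "topspace (subtopology (mtop M) (fst c)) = fst c"
  using openin_chart openin_subset topspace_subtopology_subset by metis

lemma inj_on_chart: "inj_on (snd c) (fst c)"
  using homeomorphic_imp_injective_map[OF homeomorphic_chart] topspace_chart by simp

lemma chart_inv_left [simp]: "p \<in> fst c \<Longrightarrow> chart_inv c (snd c p) = p"
  unfolding chart_inv_def using inj_on_chart by (rule inv_into_f_f)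

lemma chart_inv_right [simp]: "x \<in> snd c ` fst c \<Longrightarrow> snd c (chart_inv c x) = x"
  unfolding chart_inv_def by (rule f_inv_into_f)

lemma chart_inv_mem: "x \<in> snd c ` fst c \<Longrightarrow> chart_inv c x \<in> fst c"
  unfolding chart_inv_def by (rule inv_into_into)

lemma continuous_map_chart: "continuous_map (subtopology (mtop M) (fst c)) euclidean (snd c)"
  using homeomorphic_imp_continuous_map[OF homeomorphic_chart] continuous_map_in_subtopology by blast

lemma open_chart_image_of: "openin (mtop M) U \<Longrightarrow> U \<subseteq> fst c \<Longrightarrow> open (snd c ` U)"
  using homeomorphic_imp_open_map[OF homeomorphic_chart] open_chart_image openin_chart
  by (metis image_mono inf.orderE open_map_def openin_open_eq openin_subtopology)

lemma openin_chart_preimage: "open V \<Longrightarrow> openin (mtop M) {p \<in> fst c. snd c p \<in> V}"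
  using openin_continuous_map_preimage[OF continuous_map_chart, of V]
  unfolding topspace_chart by (auto intro: openin_trans_full[OF _ openin_chart])

lemma continuous_map_chart_inv:
  "continuous_map (subtopology euclidean (snd c ` fst c)) (mtop M) (chart_inv c)"
proof -
  obtain g where g: "homeomorphic_maps (subtopology (mtop M) (fst c)) (subtopology euclidean (snd c ` fst c)) (snd c) g"
    using homeomorphic_chart homeomorphic_map_maps by blast
  then have "continuous_map (subtopology euclidean (snd c ` fst c)) (mtop M) g"
    by (auto simp: homeomorphic_maps_def continuous_map_in_subtopology)
  moreover have "g x = chart_inv c x" if "x \<in> snd c ` fst c" for x
    using g that unfolding homeomorphic_maps_def topspace_chart by auto
  ultimately show ?thesis
    by (rule continuous_map_eq) simp
qed

end

lemma charts_atD:
  assumes "c \<in> charts_at M p"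
  shows "c \<in> atlas M" "p \<in> fst c" "openin (mtop M) (fst c)"
  using assms openin_chart charts_at_iff by blast+

lemma continuous_on_chart_curve:
  assumes "continuous_map (subtopology euclideanreal J) (mtop M) \<gamma>" "c \<in> atlas M" "\<gamma> ` J \<subseteq> fst c"
  shows "continuous_on J (\<lambda>s. snd c (\<gamma> s))"
proof -
  have "continuous_map (subtopology euclideanreal J) (subtopology (mtop M) (fst c)) \<gamma>"
    using assms by (auto simp: continuous_map_in_subtopology)
  from continuous_map_compose[OF this continuous_map_chart[OF assms(2)]]
  show ?thesis by (simp add: o_def)
qed

lemma curve_preimage_open:
  assumes "continuous_map (subtopology euclideanreal J) (mtop M) \<gamma>" "openin (mtop M) U"
    and "s \<in> J" "\<gamma> s \<in> U"
  shows "\<exists>d>0. \<forall>t\<in>J. \<bar>t - s\<bar> < d \<longrightarrow> \<gamma> t \<in> U"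
proof -
  have "openin (subtopology euclideanreal J) {t \<in> J. \<gamma> t \<in> U}"
    using openin_continuous_map_preimage[OF assms(1,2)] by simp
  then obtain T where T: "open T" "{t \<in> J. \<gamma> t \<in> U} = J \<inter> T"
    by (metis openin_open)
  then have "s \<in> T" using assms by auto
  then obtain d where "d > 0" "\<And>t. dist t s < d \<Longrightarrow> t \<in> T"
    using T(1) open_dist by metis
  then show ?thesis using T(2) by (auto simp: dist_real_def)
qed

lemma open_trans_dom:
  assumes "c \<in> atlas M" "d \<in> atlas M"
  shows "open (snd c ` (fst c \<inter> fst d))"
  using assms by (intro open_chart_image_of openin_Int openin_chart) auto

lemma trans_map_smooth:
  assumes "c \<in> atlas M" "d \<in> atlas M"
  shows "smooth_on (snd c ` (fst c \<inter> fst d)) (trans_map c d)"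
  using smooth_manifold assms by (simp add: smooth_manifold_def)

lemma trans_map_has_derivative:
  assumes "c \<in> charts_at M p" "d \<in> charts_at M p"
  shows "(trans_map c d has_derivative D_trans c d p) (at (snd c p))"
  using assms by (intro smooth_on_has_derivative[OF trans_map_smooth[of c d]]) (auto simp: charts_at_iff)

lemma linear_D_trans: "c \<in> charts_at M p \<Longrightarrow> d \<in> charts_at M p \<Longrightarrow> linear (D_trans c d p)"
  using trans_map_has_derivative has_derivative_linear by blast

lemma chart_has_derivative_cong:
  assumes "openin (mtop M) W" "p \<in> W" "\<And>q. q \<in> W \<Longrightarrow> f q = g q" "c \<in> charts_at M p"
    and "((\<lambda>x. f (chart_inv c x)) has_derivative D) (at (snd c p))"
  shows "((\<lambda>x. g (chart_inv c x)) has_derivative D) (at (snd c p))"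
proof (rule has_derivative_transform_within_open[OF assms(5)])
  have c: "c \<in> atlas M" using assms charts_at_iff by auto
  show "open (snd c ` (fst c \<inter> W))"
    using assms c by (intro open_chart_image_of openin_Int openin_chart) auto
  show "snd c p \<in> snd c ` (fst c \<inter> W)" using assms charts_at_iff by auto
qed (use assms in \<open>auto simp: charts_at_iff\<close>)

lemma change_chart:
  assumes c: "c \<in> charts_at M p" and d: "d \<in> charts_at M p"
    and f: "((\<lambda>y. f (chart_inv d y)) has_derivative D) (at (snd d p))"
  shows "((\<lambda>x. f (chart_inv c x)) has_derivative (\<lambda>v. D (D_trans c d p v))) (at (snd c p))"
proof (rule chart_has_derivative_cong[where W="fst d" and f="\<lambda>q. f (chart_inv d (snd d q))", OF _ _ _ c])
  have "trans_map c d (snd c p) = snd d p" using c charts_at_iff by auto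
  then show "((\<lambda>x. f (chart_inv d (trans_map c d x))) has_derivative (\<lambda>v. D (D_trans c d p v))) (at (snd c p))"
    using has_derivative_compose[OF trans_map_has_derivative[OF c d]] f by simp
qed (use d openin_chart in \<open>auto simp: charts_at_iff\<close>)

lemma D_trans_compose:
  assumes "c \<in> charts_at M p" "d \<in> charts_at M p" "e \<in> charts_at M p"
  shows "D_trans d e p (D_trans c d p v) = D_trans c e p v"
  using frechet_derivative_at[OF change_chart[OF assms(1,2) trans_map_has_derivative[OF assms(2,3)]]] by metis

lemma D_trans_same:
  assumes "c \<in> charts_at M p"
  shows "D_trans c c p v = v"
proof -
  have "((\<lambda>x. x) has_derivative (\<lambda>v. v)) (at (snd c p))" by simp
  then have "(trans_map c c has_derivative (\<lambda>v. v)) (at (snd c p))"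
    by (rule has_derivative_transform_within_open[OF _ open_chart_image])
      (use assms charts_at_iff in auto)
  then show ?thesis using frechet_derivative_at by metis
qed

lemma tangent_law:
  "v \<in> tangent_space M p \<Longrightarrow> c \<in> charts_at M p \<Longrightarrow> d \<in> charts_at M p \<Longrightarrow> v d = D_trans c d p (v c)"
  unfolding tangent_space_def by blast

lemma tangent_zero_off: "v \<in> tangent_space M p \<Longrightarrow> c \<notin> charts_at M p \<Longrightarrow> v c = 0"
  unfolding tangent_space_def by blast

lemma tangent_spaceI:
  assumes "\<And>c. c \<notin> charts_at M p \<Longrightarrow> v c = 0"
    and "\<And>c d. c \<in> charts_at M p \<Longrightarrow> d \<in> charts_at M p \<Longrightarrow> v d = D_trans c d p (v c)"
  shows "v \<in> tangent_space M p"
  unfolding tangent_space_def using assms by blast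

lemma tangent_eqI:
  assumes "v \<in> tangent_space M p" "w \<in> tangent_space M p" "c \<in> charts_at M p" "v c = w c"
  shows "v = w"
proof
  fix d show "v d = w d"
    using tangent_law[OF assms(1,3), of d] tangent_law[OF assms(2,3), of d]
      tangent_zero_off[OF assms(1), of d] tangent_zero_off[OF assms(2), of d] assms(4) by fastforce
qed

definition tangent_vec :: "('a, 'e) chart \<Rightarrow> 'a \<Rightarrow> 'e \<Rightarrow> ('a, 'e) tangent" where
  "tangent_vec c p u = (\<lambda>d. if d \<in> charts_at M p then D_trans c d p u else 0)"

lemma tangent_vec_in: "c \<in> charts_at M p \<Longrightarrow> tangent_vec c p u \<in> tangent_space M p"
  by (rule tangent_spaceI) (simp_all add: tangent_vec_def D_trans_compose)

lemma tangent_vec_same: "c \<in> charts_at M p \<Longrightarrow> tangent_vec c p u c = u"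
  by (simp add: tangent_vec_def D_trans_same)

lemma tangent_zero: "(\<lambda>c. 0) \<in> tangent_space M p"
  by (rule tangent_spaceI) (simp_all add: linear_0[OF linear_D_trans])

lemma tangent_add:
  assumes v: "v \<in> tangent_space M p" and w: "w \<in> tangent_space M p"
  shows "(\<lambda>c. v c + w c) \<in> tangent_space M p"
proof (rule tangent_spaceI)
  fix c assume "c \<notin> charts_at M p"
  then show "v c + w c = 0" by (simp add: tangent_zero_off[OF v] tangent_zero_off[OF w])
next
  fix c d assume c: "c \<in> charts_at M p" and d: "d \<in> charts_at M p"
  show "v d + w d = D_trans c d p (v c + w c)"
    unfolding tangent_law[OF v c d] tangent_law[OF w c d] by (rule linear_add[OF linear_D_trans[OF c d], symmetric])
qed

lemma tangent_scaleR:
  assumes v: "v \<in> tangent_space M p"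
  shows "(\<lambda>c. a *\<^sub>R v c) \<in> tangent_space M p"
proof (rule tangent_spaceI)
  fix c assume "c \<notin> charts_at M p"
  then show "a *\<^sub>R v c = 0" by (simp add: tangent_zero_off[OF v])
next
  fix c d assume c: "c \<in> charts_at M p" and d: "d \<in> charts_at M p"
  show "a *\<^sub>R v d = D_trans c d p (a *\<^sub>R v c)"
    unfolding tangent_law[OF v c d] by (rule linear_cmul[OF linear_D_trans[OF c d], symmetric])
qed

lemma tangent_sum: "(\<And>i. i \<in> I \<Longrightarrow> v i \<in> tangent_space M p) \<Longrightarrow> (\<lambda>c. \<Sum>i\<in>I. v i c) \<in> tangent_space M p"
  by (induction I rule: infinite_finite_induct) (auto intro: tangent_zero tangent_add)

definition smooth_at :: "('a \<Rightarrow> 'a) \<Rightarrow> 'a \<Rightarrow> bool" where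
  "smooth_at F p \<longleftrightarrow> (\<exists>W. openin (mtop M) W \<and> p \<in> W \<and> smooth_map_on M W F)"

lemma smooth_at_preimage:
  assumes "smooth_at F p" "openin (mtop M) V" "F p \<in> V"
  shows "\<exists>W. openin (mtop M) W \<and> p \<in> W \<and> (\<forall>q\<in>W. F q \<in> V)"
proof -
  obtain W where W: "openin (mtop M) W" "p \<in> W" "smooth_map_on M W F"
    using assms(1) smooth_at_def by auto
  have "openin (subtopology (mtop M) W) {x \<in> topspace (subtopology (mtop M) W). F x \<in> V}"
    using W(3) assms(2) by (intro openin_continuous_map_preimage) (auto simp: smooth_map_on_def)
  then have "openin (mtop M) {x \<in> W. F x \<in> V}"
    unfolding topspace_subtopology_subset[OF openin_subset[OF W(1)]]
    by (rule openin_trans_full[OF _ W(1)])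
  then show ?thesis using W(2) assms(3) by blast
qed

lemma smooth_at_topspace:
  assumes "smooth_at F p"
  shows "p \<in> topspace (mtop M)" "F p \<in> topspace (mtop M)"
proof -
  obtain W where W: "openin (mtop M) W" "p \<in> W" "smooth_map_on M W F"
    using assms(1) smooth_at_def by auto
  then show p: "p \<in> topspace (mtop M)" using openin_subset by auto
  show "F p \<in> topspace (mtop M)"
    using W p unfolding smooth_map_on_def continuous_map_def by (auto simp: Pi_iff)
qed

lemma smooth_at_has_derivative:
  assumes "smooth_at F p" and c: "c \<in> charts_at M p" and d: "d \<in> charts_at M (F p)"
  shows "((\<lambda>x. snd d (F (chart_inv c x))) has_derivative
      frechet_derivative (\<lambda>x. snd d (F (chart_inv c x))) (at (snd c p))) (at (snd c p))"
proof -
  obtain W where W: "openin (mtop M) W" "p \<in> W" "smooth_map_on M W F"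
    using assms(1) smooth_at_def by auto
  have "smooth_on (snd c ` {p \<in> W \<inter> fst c. F p \<in> fst d}) (\<lambda>x. snd d (F (chart_inv c x)))"
    using W c d by (auto simp: smooth_map_on_def charts_at_iff)
  then show ?thesis
    by (rule smooth_on_has_derivative) (use W c d charts_at_iff in auto)
qed

text \<open>
  The coordinates of the image vector do not depend on the chart which the definition of the tangent
  map happens to choose.
\<close>

lemma tangent_map_eq:
  assumes F: "smooth_at F p" and v: "v \<in> tangent_space M p"
    and c: "c \<in> charts_at M p" and d: "d \<in> charts_at M (F p)"
  shows "tangent_map M F p v d = frechet_derivative (\<lambda>x. snd d (F (chart_inv c x))) (at (snd c p)) (v c)"
proof -
  define c0 where "c0 = (SOME c. c \<in> charts_at M p)"
  have c0: "c0 \<in> charts_at M p" unfolding c0_def using c by (rule someI)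
  have "tangent_map M F p v d = frechet_derivative (\<lambda>x. snd d (F (chart_inv c0 x))) (at (snd c0 p)) (v c0)"
    using d by (simp add: tangent_map_def Let_def c0_def)
  also have "v c0 = D_trans c c0 p (v c)" by (rule tangent_law[OF v c c0])
  finally show ?thesis
    using frechet_derivative_at[OF change_chart[OF c c0, where f="\<lambda>q. snd d (F q)", OF smooth_at_has_derivative[OF F c0 d]]]
    by metis
qed

lemma tangent_map_off: "d \<notin> charts_at M (F p) \<Longrightarrow> tangent_map M F p v d = 0"
  by (simp add: tangent_map_def Let_def)

lemma tangent_map_in:
  assumes F: "smooth_at F p" and v: "v \<in> tangent_space M p"
  shows "tangent_map M F p v \<in> tangent_space M (F p)"
proof -
  obtain c where c: "c \<in> charts_at M p" using charts_at_exists smooth_at_topspace(1)[OF F] by blast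
  have "tangent_map M F p v e = D_trans d e (F p) (tangent_map M F p v d)"
    if d: "d \<in> charts_at M (F p)" and e: "e \<in> charts_at M (F p)" for d e
  proof -
    have "openin (mtop M) (fst d)" "F p \<in> fst d" by (rule charts_atD[OF d])+
    from smooth_at_preimage[OF F this]
    obtain W where W: "openin (mtop M) W" "p \<in> W" "\<And>q. q \<in> W \<Longrightarrow> F q \<in> fst d" by blast
    have eq: "snd d (F (chart_inv c (snd c p))) = snd d (F p)" using charts_atD[OF c] by simp
    have "((\<lambda>x. trans_map d e (snd d (F (chart_inv c x)))) has_derivative
        (\<lambda>v. D_trans d e (F p) (frechet_derivative (\<lambda>x. snd d (F (chart_inv c x))) (at (snd c p)) v))) (at (snd c p))"
      by (rule has_derivative_compose[OF smooth_at_has_derivative[OF F c d]])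
        (simp only: eq trans_map_has_derivative[OF d e])
    then have "((\<lambda>x. snd e (F (chart_inv c x))) has_derivative
        (\<lambda>v. D_trans d e (F p) (frechet_derivative (\<lambda>x. snd d (F (chart_inv c x))) (at (snd c p)) v))) (at (snd c p))"
      by (rule chart_has_derivative_cong[where f="\<lambda>q. trans_map d e (snd d (F q))", OF W(1,2) _ c, rotated])
        (use W charts_atD[OF d] in auto)
    from frechet_derivative_at[OF this] show ?thesis
      unfolding tangent_map_eq[OF F v c d] tangent_map_eq[OF F v c e] by metis
  qed
  then show ?thesis
    by (intro tangent_spaceI tangent_map_off)
qed

text \<open>
  The chain rule. The composite \<open>H\<close> needs to agree with \<open>G \<circ> F\<close> only near \<open>p\<close>, since the flow maps
  are meaningful, and satisfy the group law, only on open subsets.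
\<close>

lemma tangent_map_compose:
  assumes F: "smooth_at F p" and G: "smooth_at G (F p)" and v: "v \<in> tangent_space M p"
    and W: "openin (mtop M) W" "p \<in> W" and H: "\<And>q. q \<in> W \<Longrightarrow> H q = G (F q)"
  shows "tangent_map M H p v = tangent_map M G (F p) (tangent_map M F p v)"
proof
  fix e
  define c where "c = (SOME c. c \<in> charts_at M p)"
  have c: "c \<in> charts_at M p"
    unfolding c_def using charts_at_exists[OF smooth_at_topspace(1)[OF F]] by (rule someI_ex)
  obtain d where d: "d \<in> charts_at M (F p)" using charts_at_exists smooth_at_topspace(2)[OF F] by blast
  have Hp: "H p = G (F p)" using W H by simp
  show "tangent_map M H p v e = tangent_map M G (F p) (tangent_map M F p v) e"
  proof (cases "e \<in> charts_at M (G (F p))")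
    case False
    then show ?thesis using tangent_map_off Hp by metis
  next
    case e: True
    let ?DF = "frechet_derivative (\<lambda>x. snd d (F (chart_inv c x))) (at (snd c p))"
    let ?DG = "frechet_derivative (\<lambda>x. snd e (G (chart_inv d x))) (at (snd d (F p)))"
    have "openin (mtop M) (fst d)" "F p \<in> fst d" by (rule charts_atD[OF d])+
    from smooth_at_preimage[OF F this]
    obtain W' where W': "openin (mtop M) W'" "p \<in> W'" "\<And>q. q \<in> W' \<Longrightarrow> F q \<in> fst d" by blast
    have eq: "snd d (F (chart_inv c (snd c p))) = snd d (F p)" using charts_atD[OF c] by simp
    have "((\<lambda>x. snd e (G (chart_inv d (snd d (F (chart_inv c x)))))) has_derivative (\<lambda>v. ?DG (?DF v))) (at (snd c p))"
      by (rule has_derivative_compose[OF smooth_at_has_derivative[OF F c d]])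
        (simp only: eq smooth_at_has_derivative[OF G d e])
    then have "((\<lambda>x. snd e (H (chart_inv c x))) has_derivative (\<lambda>v. ?DG (?DF v))) (at (snd c p))"
      by (rule chart_has_derivative_cong[where f="\<lambda>q. snd e (G (chart_inv d (snd d (F q))))" and W="W \<inter> W'", OF _ _ _ c, rotated -1])
        (use W W' H charts_atD[OF d] in auto)
    from frechet_derivative_at[OF this]
    have "tangent_map M H p v e = ?DG (?DF (v c))"
      using e Hp unfolding tangent_map_def Let_def c_def[symmetric] by metis
    also have "?DF (v c) = tangent_map M F p v d"
      using tangent_map_eq[OF F v c d] by simp
    also have "?DG \<dots> = tangent_map M G (F p) (tangent_map M F p v) e"
      using tangent_map_eq[OF G tangent_map_in[OF F v] d e] by simp
    finally show ?thesis .
  qed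
qed

lemma tangent_map_id:
  assumes v: "v \<in> tangent_space M p" and W: "openin (mtop M) W" "p \<in> W" and H: "\<And>q. q \<in> W \<Longrightarrow> H q = q"
  shows "tangent_map M H p v = v"
proof
  fix e
  define c where "c = (SOME c. c \<in> charts_at M p)"
  have "p \<in> topspace (mtop M)" using W openin_subset by blast
  then have c: "c \<in> charts_at M p"
    unfolding c_def using charts_at_exists by (metis someI_ex)
  show "tangent_map M H p v e = v e"
  proof (cases "e \<in> charts_at M p")
    case False
    then show ?thesis using tangent_map_off tangent_zero_off v H W by metis
  next
    case e: True
    have "((\<lambda>x. snd e (H (chart_inv c x))) has_derivative D_trans c e p) (at (snd c p))"
      by (rule chart_has_derivative_cong[where f="\<lambda>q. snd e q", OF W _ c trans_map_has_derivative[OF c e]])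
        (simp add: H)
    from frechet_derivative_at[OF this] show ?thesis
      using e tangent_law[OF v c e] H[OF W(2)] unfolding tangent_map_def Let_def c_def[symmetric] by metis
  qed
qed

end

section \<open>Bump functions on the manifold, local frames and Christoffel maps\<close>

context smooth_mfd
begin

lemma vector_fieldD:
  assumes "X \<in> vector_fields M"
  shows "X p \<in> tangent_space M p"
    and "c \<in> atlas M \<Longrightarrow> smooth_on (snd c ` fst c) (\<lambda>x. X (chart_inv c x) c)"
  using assms unfolding vector_fields_def by blast+

lemma vector_fieldI:
  assumes "\<And>p. X p \<in> tangent_space M p"
    and "\<And>c. c \<in> atlas M \<Longrightarrow> smooth_on (snd c ` fst c) (\<lambda>x. X (chart_inv c x) c)"
  shows "X \<in> vector_fields M"
  using assms unfolding vector_fields_def by blast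

lemma vector_field_zero: "(\<lambda>p c. 0) \<in> vector_fields M"
  by (intro vector_fieldI tangent_zero smooth_on_const open_chart_image)

lemma vector_field_sum:
  assumes "\<And>i. i \<in> I \<Longrightarrow> X i \<in> vector_fields M"
  shows "(\<lambda>p c. \<Sum>i\<in>I. X i p c) \<in> vector_fields M"
proof (rule vector_fieldI)
  show "(\<lambda>c. \<Sum>i\<in>I. X i p c) \<in> tangent_space M p" for p
    by (rule tangent_sum) (rule vector_fieldD(1)[OF assms])
  show "smooth_on (snd c ` fst c) (\<lambda>x. \<Sum>i\<in>I. X i (chart_inv c x) c)" if "c \<in> atlas M" for c
    by (rule smooth_on_sum[OF open_chart_image[OF that]]) (rule vector_fieldD(2)[OF assms that])
qed

lemma vector_field_scaleR:
  assumes f: "smooth_fun M f" and X: "X \<in> vector_fields M"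
  shows "(\<lambda>p c. f p *\<^sub>R X p c) \<in> vector_fields M"
proof (rule vector_fieldI)
  show "(\<lambda>c. f p *\<^sub>R X p c) \<in> tangent_space M p" for p
    by (rule tangent_scaleR[OF vector_fieldD(1)[OF X]])
  show "smooth_on (snd c ` fst c) (\<lambda>x. f (chart_inv c x) *\<^sub>R X (chart_inv c x) c)" if "c \<in> atlas M" for c
    by (rule smooth_on_scaleR[OF open_chart_image[OF that] _ vector_fieldD(2)[OF X that]])
      (use f that in \<open>simp add: smooth_fun_def\<close>)
qed

lemma vector_field_has_derivative:
  assumes "X \<in> vector_fields M" "c \<in> charts_at M p"
  shows "((\<lambda>x. X (chart_inv c x) c) has_derivative
      frechet_derivative (\<lambda>x. X (chart_inv c x) c) (at (snd c p))) (at (snd c p))"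
  using charts_atD[OF assms(2)]
  by (intro smooth_on_has_derivative[OF vector_fieldD(2)[OF assms(1)]]) auto

lemma smooth_on_other_chart:
  assumes c: "c \<in> atlas M" and d: "d \<in> atlas M" and g: "smooth_on (snd c ` fst c) (\<lambda>x. g (chart_inv c x))"
  shows "smooth_on (snd d ` (fst d \<inter> fst c)) (\<lambda>y. g (chart_inv d y))"
proof (rule smooth_on_cong[OF open_trans_dom[OF d c]])
  show "smooth_on (snd d ` (fst d \<inter> fst c)) (\<lambda>y. g (chart_inv c (trans_map d c y)))"
    by (rule smooth_on_compose[OF open_trans_dom[OF d c] open_chart_image[OF c] _ trans_map_smooth[OF d c] g])
      (use d in auto)
qed (use c d in auto)

text \<open>
  The support lies in a closed set \<open>K\<close> inside the domain of \<open>c\<close>, so the complement of \<open>K\<close> and the domain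
  of \<open>c\<close> form an open cover on whose members the function is smooth.
\<close>

lemma smooth_on_extend_zero:
  assumes d: "d \<in> atlas M" and c: "c \<in> atlas M" and K: "closedin (mtop M) K" "K \<subseteq> fst c"
    and g: "smooth_on (snd d ` (fst d \<inter> fst c)) (\<lambda>y. g (chart_inv d y))"
    and zero: "\<And>q. q \<notin> K \<Longrightarrow> g q = 0"
  shows "smooth_on (snd d ` fst d) (\<lambda>y. g (chart_inv d y))"
proof (rule smooth_on_local)
  fix y assume "y \<in> snd d ` fst d"
  then obtain q where q: "q \<in> fst d" "y = snd d q" by blast
  show "\<exists>T. open T \<and> y \<in> T \<and> smooth_on T (\<lambda>y. g (chart_inv d y))"
  proof (cases "q \<in> fst c")
    case True
    then show ?thesis using q g open_trans_dom[OF d c] by blast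
  next
    case False
    have op: "openin (mtop M) (fst d - K)"
      using openin_chart[OF d] K(1) by (rule openin_diff)
    have T: "open (snd d ` (fst d - K))"
      by (rule open_chart_image_of[OF d op]) auto
    have "smooth_on (snd d ` (fst d - K)) (\<lambda>y. g (chart_inv d y))"
      by (rule smooth_on_cong[OF T smooth_on_const[OF T, of 0]]) (use d zero in auto)
    then show ?thesis using T q False K(2) by blast
  qed
qed

definition extend_field :: "('a, 'e) chart \<Rightarrow> ('a \<Rightarrow> 'e) \<Rightarrow> ('a, 'e) vfield" where
  "extend_field c h = (\<lambda>q d. if q \<in> fst c then tangent_vec c q (h q) d else 0)"

lemma extend_field_coord: "c \<in> charts_at M q \<Longrightarrow> extend_field c h q c = h q"
  using charts_atD(2) by (simp add: extend_field_def tangent_vec_same)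

lemma extend_field_vector_field:
  assumes c: "c \<in> atlas M" and K: "closedin (mtop M) K" "K \<subseteq> fst c"
    and h: "smooth_on (snd c ` fst c) (\<lambda>x. h (chart_inv c x))"
    and zero: "\<And>q. q \<notin> K \<Longrightarrow> h q = 0"
  shows "extend_field c h \<in> vector_fields M"
proof (rule vector_fieldI)
  fix p
  show "extend_field c h p \<in> tangent_space M p"
  proof (cases "p \<in> fst c")
    case True
    then have "c \<in> charts_at M p" using c charts_at_iff by blast
    moreover have "extend_field c h p = tangent_vec c p (h p)" using True by (simp add: extend_field_def)
    ultimately show ?thesis using tangent_vec_in by simp
  next
    case False
    then show ?thesis using tangent_zero by (simp add: extend_field_def)
  qed
next
  fix d assume d: "d \<in> atlas M"
  show "smooth_on (snd d ` fst d) (\<lambda>x. extend_field c h (chart_inv d x) d)"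
  proof (rule smooth_on_extend_zero[OF d c K])
    note op = open_trans_dom[OF d c]
    have 1: "smooth_on (snd d ` (fst d \<inter> fst c)) (\<lambda>x. h (chart_inv d x) \<bullet> b)" for b
      by (rule smooth_on_inner_const[OF op smooth_on_other_chart[OF c d h]])
    have 2: "smooth_on (snd d ` (fst d \<inter> fst c)) (\<lambda>x. frechet_derivative (trans_map c d) (at (trans_map d c x)) b)" for b
      by (rule smooth_on_compose[OF op open_trans_dom[OF c d] _ trans_map_smooth[OF d c]
            smooth_on_derivative[OF trans_map_smooth[OF c d]]]) (use d in auto)
    show "smooth_on (snd d ` (fst d \<inter> fst c)) (\<lambda>x. extend_field c h (chart_inv d x) d)"
    proof (rule smooth_on_cong[OF op smooth_on_sum[OF op smooth_on_scaleR[OF op 1 2]]])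
      fix x assume "x \<in> snd d ` (fst d \<inter> fst c)"
      then obtain q where q: "q \<in> fst d" "q \<in> fst c" "x = snd d q" by blast
      then have "c \<in> charts_at M q" "d \<in> charts_at M q" using c d charts_at_iff by blast+
      note lin = linear_D_trans[OF this]
      have "(\<Sum>b\<in>Basis. (h q \<bullet> b) *\<^sub>R D_trans c d q b) = D_trans c d q (\<Sum>b\<in>Basis. (h q \<bullet> b) *\<^sub>R b)"
        by (simp only: linear_sum[OF lin] linear_cmul[OF lin])
      then show "(\<Sum>b\<in>Basis. (h (chart_inv d x) \<bullet> b) *\<^sub>R frechet_derivative (trans_map c d) (at (trans_map d c x)) b)
        = extend_field c h (chart_inv d x) d"
        using q c d by (simp add: extend_field_def tangent_vec_def charts_at_iff euclidean_representation)
    qed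
    show "extend_field c h q d = 0" if "q \<notin> K" for q
      using zero[OF that] c d linear_0[OF linear_D_trans[of c q d]]
      by (auto simp: extend_field_def tangent_vec_def charts_at_iff)
  qed
qed

text \<open>
  The support is the image of a closed coordinate ball. It is compact, hence closed, as the manifold
  is Hausdorff.
\<close>

lemma exists_bump:
  assumes cp: "c \<in> charts_at M p" and U: "openin (mtop M) U" "p \<in> U" "U \<subseteq> fst c"
  obtains N K and f :: "'a \<Rightarrow> real" where "openin (mtop M) N" "p \<in> N" "N \<subseteq> U"
    "closedin (mtop M) K" "K \<subseteq> U" "smooth_on (snd c ` fst c) (\<lambda>x. f (chart_inv c x))"
    "\<And>q. q \<in> N \<Longrightarrow> f q = 1" "\<And>q. q \<notin> K \<Longrightarrow> f q = 0"
proof -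
  note c = charts_atD[OF cp]
  have "open (snd c ` U)" "snd c p \<in> snd c ` U" using open_chart_image_of[OF c(1) U(1,3)] U(2) by auto
  then obtain e where e: "e > 0" "cball (snd c p) e \<subseteq> snd c ` U"
    using open_contains_cball by blast
  define r where "r = e / 2"
  have r: "r > 0" "cball (snd c p) (2 * r) \<subseteq> snd c ` U" using e by (auto simp: r_def)
  obtain \<phi> :: "'e \<Rightarrow> real" where \<phi>: "smooth_on UNIV \<phi>" "\<And>x. x \<in> ball (snd c p) r \<Longrightarrow> \<phi> x = 1"
      "\<And>x. x \<notin> cball (snd c p) (2 * r) \<Longrightarrow> \<phi> x = 0"
    using exists_smooth_bump[OF r(1)] by blast
  define f where "f = (\<lambda>q. if q \<in> fst c then \<phi> (snd c q) else 0)"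
  define N where "N = U \<inter> {q \<in> fst c. snd c q \<in> ball (snd c p) r}"
  define K where "K = chart_inv c ` cball (snd c p) (2 * r)"
  show ?thesis
  proof (rule that[of N K f])
    show "openin (mtop M) N"
      unfolding N_def by (intro openin_Int U(1) openin_chart_preimage c(1) open_ball)
    show "p \<in> N" "N \<subseteq> U" using U c r by (auto simp: N_def)
    have "compactin (mtop M) K"
      unfolding K_def
      by (rule image_compactin[OF _ continuous_map_chart_inv[OF c(1)]])
        (use order_trans[OF r(2) image_mono[OF U(3), of "snd c"]] in \<open>auto simp: compactin_subtopology\<close>)
    then show "closedin (mtop M) K" by (rule compactin_imp_closedin[OF Hausdorff])
    show "K \<subseteq> U"
    proof
      fix q assume "q \<in> K"
      then obtain q' where "q' \<in> U" "q = chart_inv c (snd c q')" using r(2) unfolding K_def by blast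
      then show "q \<in> U" using chart_inv_left[OF c(1)] U(3) by auto
    qed
    show "smooth_on (snd c ` fst c) (\<lambda>x. f (chart_inv c x))"
      by (rule smooth_on_cong[OF open_chart_image[OF c(1)] smooth_on_subset[OF \<phi>(1)]])
        (use c in \<open>auto simp: f_def\<close>)
    show "f q = 1" if "q \<in> N" for q
      using that \<phi>(2) by (auto simp: N_def f_def)
    show "f q = 0" if "q \<notin> K" for q
    proof -
      have "snd c q \<notin> cball (snd c p) (2 * r)" if "q \<in> fst c"
        using \<open>q \<notin> K\<close> that chart_inv_left[OF c(1) that] unfolding K_def by (metis image_eqI)
      then show ?thesis using \<phi>(3) by (auto simp: f_def)
    qed
  qed
qed

text \<open>
  \<open>E u\<close> is a global vector field with constant coordinates \<open>u\<close> on \<open>U\<close>; for basis vectors \<open>u\<close> these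
  are the coordinate fields on \<open>U\<close>. All \<open>u\<close> are allowed, so that every tangent vector at a point
  of \<open>U\<close> is the value of some \<open>E u\<close>.
\<close>

definition is_frame :: "('a, 'e) chart \<Rightarrow> 'a set \<Rightarrow> ('e \<Rightarrow> ('a, 'e) vfield) \<Rightarrow> bool" where
  "is_frame c U E \<longleftrightarrow> c \<in> atlas M \<and> openin (mtop M) U \<and> U \<subseteq> fst c \<and>
     (\<forall>u. E u \<in> vector_fields M) \<and> (\<forall>u. \<forall>q\<in>U. E u q c = u)"

lemma is_frameD:
  assumes "is_frame c U E"
  shows "c \<in> atlas M" "openin (mtop M) U" "U \<subseteq> fst c" "E u \<in> vector_fields M"
    and "q \<in> U \<Longrightarrow> E u q c = u" "q \<in> U \<Longrightarrow> c \<in> charts_at M q"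
  using assms unfolding is_frame_def charts_at_iff by blast+

lemma frame_exists:
  assumes cp: "c \<in> charts_at M p"
  obtains U E where "p \<in> U" "is_frame c U E"
proof -
  note c = charts_atD[OF cp]
  obtain N K f where N: "openin (mtop M) N" "p \<in> N" "N \<subseteq> fst c" and K: "closedin (mtop M) K" "K \<subseteq> fst c"
    and f: "smooth_on (snd c ` fst c) (\<lambda>x. f (chart_inv c x))"
      "\<And>q. q \<in> N \<Longrightarrow> f q = (1::real)" "\<And>q. q \<notin> K \<Longrightarrow> f q = 0"
    by (rule exists_bump[OF cp c(3,2) subset_refl], rule that) blast+
  define E where "E = (\<lambda>u. extend_field c (\<lambda>q. f q *\<^sub>R u))"
  note op = open_chart_image[OF c(1)]
  have "E u \<in> vector_fields M" for u
    unfolding E_def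
    by (rule extend_field_vector_field[OF c(1) K smooth_on_scaleR[OF op f(1) smooth_on_const[OF op]]]) (simp add: f(3))
  moreover have "E u q c = u" if "q \<in> N" for u q
  proof -
    have "c \<in> charts_at M q" using c(1) N(3) that charts_at_iff by blast
    then show ?thesis by (simp add: E_def extend_field_coord f(2)[OF that])
  qed
  ultimately have "is_frame c N E" using N c(1) by (simp add: is_frame_def)
  then show ?thesis using that N(2) by blast
qed

lemma frame_field_derivative:
  assumes E: "is_frame c U E" and q: "q \<in> U"
  shows "frechet_derivative (\<lambda>x. E u (chart_inv c x) c) (at (snd c q)) v = 0"
proof -
  have "((\<lambda>x. u) has_derivative (\<lambda>v. 0)) (at (snd c q))" by simp
  then have "((\<lambda>x. E u (chart_inv c x) c) has_derivative (\<lambda>v. 0)) (at (snd c q))"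
    by (rule chart_has_derivative_cong[OF is_frameD(2)[OF E] q _ is_frameD(6)[OF E q], where f="\<lambda>x. u", rotated])
      (simp add: is_frameD(5)[OF E])
  from frechet_derivative_at[OF this] show ?thesis by metis
qed

end

locale conn_mfd = smooth_mfd M for M :: "('a, 'e::euclidean_space) manifold" +
  fixes nabla :: "('a, 'e) conn"
  assumes affine_connection: "affine_connection M nabla"
begin

lemma nabla_vector_field: "X \<in> vector_fields M \<Longrightarrow> Y \<in> vector_fields M \<Longrightarrow> nabla X Y \<in> vector_fields M"
  using affine_connection unfolding affine_connection_def by blast

lemma nabla_add_left:
  "X \<in> vector_fields M \<Longrightarrow> X' \<in> vector_fields M \<Longrightarrow> Y \<in> vector_fields M \<Longrightarrow>
    nabla (\<lambda>p c. X p c + X' p c) Y = (\<lambda>p c. nabla X Y p c + nabla X' Y p c)"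
  using affine_connection unfolding affine_connection_def by blast

lemma nabla_scaleR_left:
  "smooth_fun M f \<Longrightarrow> X \<in> vector_fields M \<Longrightarrow> Y \<in> vector_fields M \<Longrightarrow>
    nabla (\<lambda>p c. f p *\<^sub>R X p c) Y = (\<lambda>p c. f p *\<^sub>R nabla X Y p c)"
  using affine_connection unfolding affine_connection_def by blast

lemma nabla_add_right:
  "X \<in> vector_fields M \<Longrightarrow> Y \<in> vector_fields M \<Longrightarrow> Y' \<in> vector_fields M \<Longrightarrow>
    nabla X (\<lambda>p c. Y p c + Y' p c) = (\<lambda>p c. nabla X Y p c + nabla X Y' p c)"
  using affine_connection unfolding affine_connection_def by blast

lemma nabla_leibniz:
  "smooth_fun M f \<Longrightarrow> X \<in> vector_fields M \<Longrightarrow> Y \<in> vector_fields M \<Longrightarrow> c \<in> charts_at M p \<Longrightarrow>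
    nabla X (\<lambda>p c. f p *\<^sub>R Y p c) p c =
      frechet_derivative (\<lambda>x. f (chart_inv c x)) (at (snd c p)) (X p c) *\<^sub>R Y p c + f p *\<^sub>R nabla X Y p c"
  using affine_connection unfolding affine_connection_def by blast

lemma nabla_zero_left:
  assumes Y: "Y \<in> vector_fields M"
  shows "nabla (\<lambda>p c. 0) Y p c = 0"
  using fun_cong[OF fun_cong[OF nabla_add_left[OF vector_field_zero vector_field_zero Y]], of p c] by simp

lemma nabla_zero_right:
  assumes X: "X \<in> vector_fields M"
  shows "nabla X (\<lambda>p c. 0) p c = 0"
  using fun_cong[OF fun_cong[OF nabla_add_right[OF X vector_field_zero vector_field_zero]], of p c] by simp

lemma nabla_sum_left:
  assumes Y: "Y \<in> vector_fields M" and "finite I" and "\<And>i. i \<in> I \<Longrightarrow> V i \<in> vector_fields M"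
  shows "nabla (\<lambda>p c. \<Sum>i\<in>I. V i p c) Y p c = (\<Sum>i\<in>I. nabla (V i) Y p c)"
  using assms(2,3)
proof (induction I)
  case (insert i I)
  have "nabla (\<lambda>p c. \<Sum>i\<in>insert i I. V i p c) Y = nabla (\<lambda>p c. V i p c + (\<Sum>i\<in>I. V i p c)) Y"
    using insert by simp
  also have "\<dots> = (\<lambda>p c. nabla (V i) Y p c + nabla (\<lambda>p c. \<Sum>i\<in>I. V i p c) Y p c)"
    by (rule nabla_add_left) (use insert Y in \<open>auto intro!: vector_field_sum\<close>)
  finally show ?case using insert by simp
qed (simp add: nabla_zero_left[OF Y])

lemma nabla_sum_right:
  assumes X: "X \<in> vector_fields M" and "finite I" and "\<And>i. i \<in> I \<Longrightarrow> V i \<in> vector_fields M"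
  shows "nabla X (\<lambda>p c. \<Sum>i\<in>I. V i p c) p c = (\<Sum>i\<in>I. nabla X (V i) p c)"
  using assms(2,3)
proof (induction I)
  case (insert i I)
  have "nabla X (\<lambda>p c. \<Sum>i\<in>insert i I. V i p c) = nabla X (\<lambda>p c. V i p c + (\<Sum>i\<in>I. V i p c))"
    using insert by simp
  also have "\<dots> = (\<lambda>p c. nabla X (V i) p c + nabla X (\<lambda>p c. \<Sum>i\<in>I. V i p c) p c)"
    by (rule nabla_add_right) (use insert X in \<open>auto intro: vector_field_sum\<close>)
  finally show ?case using insert by simp
qed (simp add: nabla_zero_right[OF X])

text \<open>
  Choose a bump function \<open>f\<close> at \<open>q\<close> supported in \<open>U\<close>. Then \<open>f Z = (\<Sum>j. (f Z\<^sup>j) E j)\<close> holds globally, with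
  smooth functions as coefficients, and \<open>nabla Y Z = nabla Y (f Z)\<close> at \<open>q\<close> by the Leibniz rule as
  \<open>Df = 0\<close> there. Expanding the right-hand side, and \<open>f Y\<close> likewise in the first argument, expresses
  the connection at \<open>q\<close> by the fields \<open>nabla (E i) (E j)\<close>.
\<close>

lemma nabla_frame:
  assumes E: "is_frame c U E" and q: "q \<in> U" and Y: "Y \<in> vector_fields M" and Z: "Z \<in> vector_fields M"
  shows "nabla Y Z q c =
       frechet_derivative (\<lambda>x. Z (chart_inv c x) c) (at (snd c q)) (Y q c)
       + (\<Sum>i\<in>Basis. \<Sum>j\<in>Basis. ((Y q c \<bullet> i) * (Z q c \<bullet> j)) *\<^sub>R nabla (E i) (E j) q c)"
proof -
  note frame = is_frameD[OF E]
  have cq: "c \<in> charts_at M q" by (rule frame(6)[OF q])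
  note c = charts_atD[OF cq]
  let ?O = "snd c ` fst c"
  note opO = open_chart_image[OF c(1)]
  obtain N K f where N: "openin (mtop M) N" "q \<in> N" "N \<subseteq> U" and K: "closedin (mtop M) K" "K \<subseteq> U"
    and f: "smooth_on ?O (\<lambda>x. f (chart_inv c x))"
      "\<And>q. q \<in> N \<Longrightarrow> f q = (1::real)" "\<And>q. q \<notin> K \<Longrightarrow> f q = 0"
    by (rule exists_bump[OF cq frame(2) q frame(3)], rule that) blast+
  have Kc: "K \<subseteq> fst c" using K(2) frame(3) by blast
  have smooth_funI: "smooth_fun M g"
    if "smooth_on ?O (\<lambda>x. g (chart_inv c x))" "\<And>q. q \<notin> K \<Longrightarrow> g q = 0" for g
    unfolding smooth_fun_def
    by (auto intro!: smooth_on_extend_zero[OF _ c(1) K(1) Kc] smooth_on_other_chart[OF c(1)] that)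
  have f_smooth: "smooth_fun M f" by (rule smooth_funI[OF f(1,3)])
  define g where "g = (\<lambda>(V::('a, 'e) vfield) j q. f q *\<^sub>R (V q c \<bullet> j))"
  have g: "smooth_fun M (g V j)" if "V \<in> vector_fields M" for V j
    unfolding g_def
    by (rule smooth_funI, rule smooth_on_scaleR[OF opO f(1)
          smooth_on_inner_const[OF opO vector_fieldD(2)[OF that c(1)]]]) (simp add: f(3))
  have expand: "(\<lambda>q d. f q *\<^sub>R V q d) = (\<lambda>q d. \<Sum>j\<in>Basis. g V j q *\<^sub>R E j q d)" if V: "V \<in> vector_fields M" for V
  proof (intro ext)
    fix q d
    show "f q *\<^sub>R V q d = (\<Sum>j\<in>Basis. g V j q *\<^sub>R E j q d)"
    proof (cases "q \<in> U")
      case True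
      have "(\<lambda>d. f q *\<^sub>R V q d) = (\<lambda>d. \<Sum>j\<in>Basis. g V j q *\<^sub>R E j q d)"
      proof (rule tangent_eqI[OF tangent_scaleR tangent_sum[OF tangent_scaleR] frame(6)[OF True]])
        have "(\<Sum>j\<in>Basis. g V j q *\<^sub>R E j q c) = f q *\<^sub>R (\<Sum>j\<in>Basis. (V q c \<bullet> j) *\<^sub>R j)"
          by (simp add: g_def frame(5)[OF True] scaleR_sum_right)
        then show "f q *\<^sub>R V q c = (\<Sum>j\<in>Basis. g V j q *\<^sub>R E j q c)"
          by (simp add: euclidean_representation)
      qed (use V frame(4) in \<open>auto intro: vector_fieldD\<close>)
      then show ?thesis by metis
    next
      case False
      then have "f q = 0" using K(2) f(3) by blast
      then show ?thesis by (simp add: g_def)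
    qed
  qed
  have fq: "f q = 1" by (rule f(2)[OF N(2)])
  have gq: "g V j q = V q c \<bullet> j" for V j by (simp add: g_def fq)
  let ?DZ = "frechet_derivative (\<lambda>x. Z (chart_inv c x) c) (at (snd c q))"
  have "((\<lambda>x. 1) has_derivative (\<lambda>v. 0)) (at (snd c q))" by simp
  then have "((\<lambda>x. f (chart_inv c x)) has_derivative (\<lambda>v. 0)) (at (snd c q))"
    by (rule chart_has_derivative_cong[OF N(1,2) _ cq, where f="\<lambda>x. 1", rotated]) (simp add: f(2))
  from frechet_derivative_at[OF this]
  have Df: "frechet_derivative (\<lambda>x. f (chart_inv c x)) (at (snd c q)) v = 0" for v by metis
  have Dg: "frechet_derivative (\<lambda>x. g Z j (chart_inv c x)) (at (snd c q)) v = ?DZ v \<bullet> j" for j v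
  proof -
    have "((\<lambda>x. Z (chart_inv c x) c \<bullet> j) has_derivative (\<lambda>v. ?DZ v \<bullet> j)) (at (snd c q))"
      by (rule has_derivative_inner_left[OF vector_field_has_derivative[OF Z cq]])
    then have "((\<lambda>x. g Z j (chart_inv c x)) has_derivative (\<lambda>v. ?DZ v \<bullet> j)) (at (snd c q))"
      by (rule chart_has_derivative_cong[OF N(1,2) _ cq, where f="\<lambda>x. Z x c \<bullet> j", rotated]) (simp add: g_def f(2))
    from frechet_derivative_at[OF this] show ?thesis by metis
  qed
  have "nabla Y Z q c = nabla Y (\<lambda>q d. f q *\<^sub>R Z q d) q c"
    using nabla_leibniz[OF f_smooth Y Z cq] Df fq by simp
  also have "\<dots> = (\<Sum>j\<in>Basis. nabla Y (\<lambda>q d. g Z j q *\<^sub>R E j q d) q c)"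
    unfolding expand[OF Z] by (rule nabla_sum_right[OF Y]) (auto intro: vector_field_scaleR g Z frame(4))
  also have "\<dots> = (\<Sum>j\<in>Basis. (?DZ (Y q c) \<bullet> j) *\<^sub>R j) + (\<Sum>j\<in>Basis. (Z q c \<bullet> j) *\<^sub>R nabla Y (E j) q c)"
    by (simp add: nabla_leibniz[OF g[OF Z] Y frame(4) cq] Dg gq frame(5)[OF q] sum.distrib)
  also have "(\<Sum>j\<in>Basis. (Z q c \<bullet> j) *\<^sub>R nabla Y (E j) q c)
     = (\<Sum>j\<in>Basis. \<Sum>i\<in>Basis. ((Y q c \<bullet> i) * (Z q c \<bullet> j)) *\<^sub>R nabla (E i) (E j) q c)"
  proof (rule sum.cong[OF refl])
    fix j :: 'e
    have "nabla Y (E j) q c = nabla (\<lambda>q d. f q *\<^sub>R Y q d) (E j) q c"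
      by (simp add: nabla_scaleR_left[OF f_smooth Y frame(4)] fq)
    also have "\<dots> = (\<Sum>i\<in>Basis. nabla (\<lambda>q d. g Y i q *\<^sub>R E i q d) (E j) q c)"
      unfolding expand[OF Y] by (rule nabla_sum_left[OF frame(4)]) (auto intro: vector_field_scaleR g Y frame(4))
    also have "\<dots> = (\<Sum>i\<in>Basis. (Y q c \<bullet> i) *\<^sub>R nabla (E i) (E j) q c)"
      by (simp add: nabla_scaleR_left[OF g[OF Y] frame(4) frame(4)] gq)
    finally show "(Z q c \<bullet> j) *\<^sub>R nabla Y (E j) q c
        = (\<Sum>i\<in>Basis. ((Y q c \<bullet> i) * (Z q c \<bullet> j)) *\<^sub>R nabla (E i) (E j) q c)"
      by (simp add: scaleR_sum_right mult_ac)
  qed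
  also have "\<dots> = (\<Sum>i\<in>Basis. \<Sum>j\<in>Basis. ((Y q c \<bullet> i) * (Z q c \<bullet> j)) *\<^sub>R nabla (E i) (E j) q c)"
    by (rule sum.swap)
  finally show ?thesis by (simp add: euclidean_representation)
qed

text \<open>
  The right-hand side has the property that characterizes the Christoffel map, and the fields \<open>E u\<close>,
  \<open>E v\<close> show that it is the only such value.
\<close>

lemma christoffel_frame:
  assumes E: "is_frame c U E" and q: "q \<in> U"
  shows "christoffel M nabla c q u v =
       (\<Sum>i\<in>Basis. \<Sum>j\<in>Basis. ((u \<bullet> i) * (v \<bullet> j)) *\<^sub>R nabla (E i) (E j) q c)"
  unfolding christoffel_def
proof (rule the_equality)
  note frame = is_frameD[OF E]
  fix w assume "\<forall>Y\<in>vector_fields M. \<forall>Z\<in>vector_fields M. Y q c = u \<and> Z q c = v \<longrightarrow>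
      nabla Y Z q c = frechet_derivative (\<lambda>x. Z (chart_inv c x) c) (at (snd c q)) u + w"
  then have "nabla (E u) (E v) q c = frechet_derivative (\<lambda>x. E v (chart_inv c x) c) (at (snd c q)) u + w"
    using frame(4) frame(5)[OF q] by blast
  then show "w = (\<Sum>i\<in>Basis. \<Sum>j\<in>Basis. ((u \<bullet> i) * (v \<bullet> j)) *\<^sub>R nabla (E i) (E j) q c)"
    using nabla_frame[OF E q frame(4) frame(4), of u v] frame(5)[OF q] by simp
qed (use nabla_frame[OF E q] in blast)

lemma nabla_christoffel:
  assumes "c \<in> charts_at M p" "Y \<in> vector_fields M" "Z \<in> vector_fields M"
  shows "nabla Y Z p c = frechet_derivative (\<lambda>x. Z (chart_inv c x) c) (at (snd c p)) (Y p c)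
       + christoffel M nabla c p (Y p c) (Z p c)"
proof -
  obtain U E where "p \<in> U" "is_frame c U E" by (rule frame_exists[OF assms(1)])
  then show ?thesis using nabla_frame[of c U E p] christoffel_frame[of c U E p] assms(2,3) by simp
qed

lemma linear_christoffel:
  assumes "c \<in> charts_at M p"
  shows "linear (christoffel M nabla c p u)"
proof -
  obtain U E where p: "p \<in> U" and E: "is_frame c U E" by (rule frame_exists[OF assms])
  show ?thesis
    by (rule linearI)
      (simp_all add: christoffel_frame[OF E p] inner_add_left algebra_simps sum.distrib scaleR_sum_right)
qed

end

section \<open>Integral curves and the local flow\<close>

lemma has_derivative_norm_le:
  fixes h :: "'b::real_normed_vector \<Rightarrow> 'c::real_normed_vector"
  assumes h: "(h has_derivative D) (at x)"
    and bound: "eventually (\<lambda>y. norm (h y - h x) \<le> C * norm (y - x)) (nhds x)"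
  shows "norm (D v) \<le> C * norm v"
proof (cases "v = 0")
  case True
  then show ?thesis using has_derivative_linear[OF h] linear_0 by fastforce
next
  case v: False
  interpret D: linear D by (rule has_derivative_linear[OF h])
  obtain d1 where d1: "d1 > 0" "\<And>y. dist y x < d1 \<Longrightarrow> norm (h y - h x) \<le> C * norm (y - x)"
    using bound unfolding eventually_nhds_metric by blast
  show ?thesis
  proof (rule field_le_epsilon)
    fix e :: real assume e: "e > 0"
    define e' where "e' = e / norm v"
    have e': "e' > 0" using e v by (simp add: e'_def)
    obtain d2 where d2: "d2 > 0" "\<And>y. norm (y - x) < d2 \<Longrightarrow> norm (h y - h x - D (y - x)) \<le> e' * norm (y - x)"
      using h e' unfolding has_derivative_at_alt by blast
    define s where "s = min d1 d2 / (2 * norm v)"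
    have s: "s > 0" using d1 d2 v by (simp add: s_def)
    have sv: "norm (s *\<^sub>R v) < d1" "norm (s *\<^sub>R v) < d2"
      using d1 d2 v by (auto simp: s_def min_def)
    have "s * norm (D v) = norm (D (s *\<^sub>R v))"
      using s by (simp add: D.scaleR)
    also have "\<dots> \<le> norm (h (x + s *\<^sub>R v) - h x) + norm (h (x + s *\<^sub>R v) - h x - D (s *\<^sub>R v))"
      by (metis add.commute add_diff_cancel_left' diff_add_cancel norm_minus_commute norm_triangle_sub)
    also have "\<dots> \<le> C * norm (s *\<^sub>R v) + e' * norm (s *\<^sub>R v)"
      using d1(2)[of "x + s *\<^sub>R v"] d2(2)[of "x + s *\<^sub>R v"] sv by (simp add: dist_norm)
    also have "\<dots> = s * (C * norm v + e)"
      using s v by (simp add: e'_def field_simps)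
    finally show "norm (D v) \<le> C * norm v + e"
      using s by simp
  qed
qed

locale field_mfd = smooth_mfd M for M :: "('a, 'e::euclidean_space) manifold" +
  fixes X :: "('a, 'e) vfield"
  assumes X: "X \<in> vector_fields M"
begin

abbreviation coord_field :: "('a, 'e) chart \<Rightarrow> 'e \<Rightarrow> 'e" where
  "coord_field c \<equiv> \<lambda>x. X (chart_inv c x) c"

abbreviation D_field :: "('a, 'e) chart \<Rightarrow> 'a \<Rightarrow> 'e \<Rightarrow> 'e" where
  "D_field c p \<equiv> frechet_derivative (coord_field c) (at (snd c p))"

lemma linear_D_field: "c \<in> charts_at M p \<Longrightarrow> linear (D_field c p)"
  using vector_field_has_derivative[OF X] has_derivative_linear by blast

lemma coord_field_strict:
  assumes c: "c \<in> charts_at M p" and "0 < e"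
  shows "\<exists>R>0. cball (snd c p) R \<subseteq> snd c ` fst c \<and>
    (\<forall>a\<in>cball (snd c p) R. \<forall>b\<in>cball (snd c p) R.
       norm (coord_field c a - coord_field c b - D_field c p (a - b)) \<le> e * norm (a - b))"
proof (rule C1_strict_differentiable[OF _ _ _ assms(2)])
  show "C_k_on (Suc 0) (snd c ` fst c) (coord_field c)"
    using vector_fieldD(2)[OF X charts_atD(1)[OF c]] unfolding smooth_on_def by blast
qed (use charts_atD[OF c] open_chart_image in auto)

lemma coord_field_bounds:
  assumes c: "c \<in> charts_at M p"
  shows "\<exists>R L B. R > 0 \<and> L > 0 \<and> B > 0 \<and> cball (snd c p) R \<subseteq> snd c ` fst c \<and>
    (\<forall>a\<in>cball (snd c p) R. \<forall>b\<in>cball (snd c p) R. norm (coord_field c a - coord_field c b) \<le> L * norm (a - b)) \<and>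
    (\<forall>a\<in>cball (snd c p) R. norm (coord_field c a) \<le> B)"
proof -
  obtain R where R: "R > 0" "cball (snd c p) R \<subseteq> snd c ` fst c"
    and strict: "\<And>a b. a \<in> cball (snd c p) R \<Longrightarrow> b \<in> cball (snd c p) R \<Longrightarrow>
       norm (coord_field c a - coord_field c b - D_field c p (a - b)) \<le> 1 * norm (a - b)"
    using coord_field_strict[OF c zero_less_one] by blast
  obtain K where K: "K > 0" "\<And>v. norm (D_field c p v) \<le> K * norm v"
    using linear_bounded_pos[OF linear_D_field[OF c]] by blast
  have L: "norm (coord_field c a - coord_field c b) \<le> (K + 1) * norm (a - b)"
    if "a \<in> cball (snd c p) R" "b \<in> cball (snd c p) R" for a b
  proof -
    have "norm (coord_field c a - coord_field c b)
      \<le> norm (coord_field c a - coord_field c b - D_field c p (a - b)) + norm (D_field c p (a - b))"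
      by (metis diff_add_cancel norm_triangle_ineq)
    also have "\<dots> \<le> 1 * norm (a - b) + K * norm (a - b)"
      using strict[OF that] K(2) by (rule add_mono)
    finally show ?thesis by (simp add: algebra_simps)
  qed
  have B: "norm (coord_field c a) \<le> norm (coord_field c (snd c p)) + (K + 1) * R + 1" if a: "a \<in> cball (snd c p) R" for a
  proof -
    have "norm (coord_field c a) \<le> norm (coord_field c (snd c p)) + norm (coord_field c a - coord_field c (snd c p))"
      using norm_triangle_sub by blast
    also have "norm (coord_field c a - coord_field c (snd c p)) \<le> (K + 1) * norm (a - snd c p)"
      using L[OF a] R by simp
    also have "\<dots> \<le> (K + 1) * R"
      using a K by (intro mult_left_mono) (auto simp: dist_norm norm_minus_commute)
    finally show ?thesis by simp
  qed
  have pos: "norm (coord_field c (snd c p)) + (K + 1) * R + 1 > 0"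
    using K R by (intro add_nonneg_pos add_nonneg_nonneg) auto
  show ?thesis
    by (rule exI[of _ R], rule exI[of _ "K + 1"], rule exI[of _ "norm (coord_field c (snd c p)) + (K + 1) * R + 1"])
      (use R K L B pos in auto)
qed

lemma integral_curveD:
  assumes "integral_curve M X J \<gamma>"
  shows "open J" "is_interval J" "continuous_map (subtopology euclideanreal J) (mtop M) \<gamma>"
    and "t \<in> J \<Longrightarrow> c \<in> charts_at M (\<gamma> t) \<Longrightarrow> ((\<lambda>s. snd c (\<gamma> s)) has_vector_derivative X (\<gamma> t) c) (at t)"
    and "t \<in> J \<Longrightarrow> \<gamma> t \<in> topspace (mtop M)"
  using assms unfolding integral_curve_def continuous_map_def by (auto simp: Pi_iff)

lemma integral_curve_coord:
  assumes "integral_curve M X J \<gamma>" "t \<in> J" "c \<in> atlas M" "\<gamma> t \<in> fst c"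
  shows "((\<lambda>s. snd c (\<gamma> s)) has_vector_derivative coord_field c (snd c (\<gamma> t))) (at t within I)"
  using integral_curveD(4)[OF assms(1,2), of c] assms(3,4)
  by (auto simp: charts_at_iff intro: has_vector_derivative_at_within)

lemma is_interval_near: "is_interval J \<Longrightarrow> is_interval (J \<inter> {s - d<..<s + d::real})"
  by (simp add: is_interval_Int is_interval_oo)

text \<open>
  The set of times at which the curves agree is open by Gronwall's inequality in a chart, and its
  complement is open by the Hausdorff property.
\<close>

lemma integral_curve_unique:
  assumes 1: "integral_curve M X J1 \<gamma>1" and 2: "integral_curve M X J2 \<gamma>2"
    and s0: "s0 \<in> J1" "s0 \<in> J2" "\<gamma>1 s0 = \<gamma>2 s0" and s: "s \<in> J1" "s \<in> J2"
  shows "\<gamma>1 s = \<gamma>2 s"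
proof -
  note D1 = integral_curveD[OF 1] and D2 = integral_curveD[OF 2]
  define J where "J = J1 \<inter> J2"
  have J: "is_interval J" unfolding J_def using D1(2) D2(2) by (rule is_interval_Int)
  have "\<forall>\<^sub>F b in at a within J. (\<gamma>1 a = \<gamma>2 a) = (\<gamma>1 b = \<gamma>2 b)" if a: "a \<in> J" for a
  proof (cases "\<gamma>1 a = \<gamma>2 a")
    case False
    have a12: "a \<in> J1" "a \<in> J2" using a by (auto simp: J_def)
    have "\<gamma>1 a \<in> topspace (mtop M)" "\<gamma>2 a \<in> topspace (mtop M)"
      using D1(5)[OF a12(1)] D2(5)[OF a12(2)] by auto
    then obtain U V where UV: "openin (mtop M) U" "openin (mtop M) V" "\<gamma>1 a \<in> U" "\<gamma>2 a \<in> V" "disjnt U V"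
      using Hausdorff False unfolding Hausdorff_space_def by metis
    obtain d1 where d1: "d1 > 0" "\<And>t. t \<in> J1 \<Longrightarrow> \<bar>t - a\<bar> < d1 \<Longrightarrow> \<gamma>1 t \<in> U"
      using curve_preimage_open[OF D1(3) UV(1) a12(1) UV(3)] by blast
    obtain d2 where d2: "d2 > 0" "\<And>t. t \<in> J2 \<Longrightarrow> \<bar>t - a\<bar> < d2 \<Longrightarrow> \<gamma>2 t \<in> V"
      using curve_preimage_open[OF D2(3) UV(2) a12(2) UV(4)] by blast
    have "\<gamma>1 b \<noteq> \<gamma>2 b" if "b \<in> J" "dist b a < min d1 d2" for b
    proof -
      have "\<gamma>1 b \<in> U" "\<gamma>2 b \<in> V" using d1(2)[of b] d2(2)[of b] that by (auto simp: J_def dist_real_def)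
      then show ?thesis using UV(5) disjnt_iff by metis
    qed
    then show ?thesis
      unfolding eventually_at using False d1(1) d2(1) by (intro exI[of _ "min d1 d2"]) auto
  next
    case True
    have a12: "a \<in> J1" "a \<in> J2" using a by (auto simp: J_def)
    obtain c where cp: "c \<in> charts_at M (\<gamma>1 a)" using charts_at_exists[OF D1(5)[OF a12(1)]] by blast
    note c = charts_atD[OF cp]
    obtain R L B where R: "R > 0" "cball (snd c (\<gamma>1 a)) R \<subseteq> snd c ` fst c"
      and L: "\<And>x y. x \<in> cball (snd c (\<gamma>1 a)) R \<Longrightarrow> y \<in> cball (snd c (\<gamma>1 a)) R \<Longrightarrow>
         norm (coord_field c x - coord_field c y) \<le> L * norm (x - y)"
      using coord_field_bounds[OF cp] by blast
    define G where "G = {q \<in> fst c. snd c q \<in> ball (snd c (\<gamma>1 a)) R}"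
    have G: "openin (mtop M) G" unfolding G_def using c(1) by (rule openin_chart_preimage) simp
    have aG: "\<gamma>1 a \<in> G" "\<gamma>2 a \<in> G" using c R True by (auto simp: G_def)
    obtain d1 where d1: "d1 > 0" "\<And>t. t \<in> J1 \<Longrightarrow> \<bar>t - a\<bar> < d1 \<Longrightarrow> \<gamma>1 t \<in> G"
      using curve_preimage_open[OF D1(3) G a12(1) aG(1)] by blast
    obtain d2 where d2: "d2 > 0" "\<And>t. t \<in> J2 \<Longrightarrow> \<bar>t - a\<bar> < d2 \<Longrightarrow> \<gamma>2 t \<in> G"
      using curve_preimage_open[OF D2(3) G a12(2) aG(2)] by blast
    define d where "d = min d1 d2"
    define I where "I = J \<inter> {a - d<..<a + d}"
    have d: "d > 0" using d1 d2 by (simp add: d_def)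
    have I: "is_interval I" "a \<in> I" unfolding I_def using is_interval_near[OF J] a d by auto
    have inI: "r \<in> J1 \<and> r \<in> J2 \<and> \<gamma>1 r \<in> G \<and> \<gamma>2 r \<in> G" if "r \<in> I" for r
    proof -
      have "\<bar>r - a\<bar> < d1" "\<bar>r - a\<bar> < d2" using that by (auto simp: I_def d_def)
      then show ?thesis using that d1(2)[of r] d2(2)[of r] by (simp add: I_def J_def)
    qed
    have "\<gamma>1 b = \<gamma>2 b" if b: "b \<in> I" for b
    proof -
      have "norm (snd c (\<gamma>1 b) - snd c (\<gamma>2 b)) \<le> exp (L * \<bar>b - a\<bar>) * norm (snd c (\<gamma>1 a) - snd c (\<gamma>2 a))"
      proof (rule gronwall[OF I(1) _ _ I(2) b])
        fix r assume r: "r \<in> I"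
        note rr = inI[OF r]
        show "((\<lambda>r. snd c (\<gamma>1 r) - snd c (\<gamma>2 r)) has_vector_derivative
            (coord_field c (snd c (\<gamma>1 r)) - coord_field c (snd c (\<gamma>2 r)))) (at r within I)"
          by (intro has_vector_derivative_diff integral_curve_coord[OF 1] integral_curve_coord[OF 2])
            (use rr c in \<open>auto simp: G_def\<close>)
        show "norm (coord_field c (snd c (\<gamma>1 r)) - coord_field c (snd c (\<gamma>2 r))) \<le> L * norm (snd c (\<gamma>1 r) - snd c (\<gamma>2 r))"
          by (rule L) (use rr in \<open>auto simp: G_def\<close>)
      qed
      then have "snd c (\<gamma>1 b) = snd c (\<gamma>2 b)" using True by simp
      then show ?thesis
        using inI[OF b] inj_on_chart[OF c(1)] unfolding G_def inj_on_def by blast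
    qed
    then have "\<And>b. b \<in> J \<Longrightarrow> dist b a < d \<Longrightarrow> \<gamma>1 b = \<gamma>2 b"
      unfolding I_def by (auto simp: dist_real_def abs_less_iff)
    then show ?thesis
      unfolding eventually_at using True d by (intro exI[of _ d]) auto
  qed
  then have "(\<gamma>1 s0 = \<gamma>2 s0) = (\<gamma>1 s = \<gamma>2 s)"
    by (intro connected_local_const[where A=J and f="\<lambda>s. \<gamma>1 s = \<gamma>2 s"])
      (use J s s0 is_interval_connected in \<open>auto simp: J_def\<close>)
  then show ?thesis using s0 by simp
qed

lemma flow_eq:
  assumes "integral_curve M X J \<gamma>" "0 \<in> J" "t \<in> J"
  shows "flow M X t (\<gamma> 0) = \<gamma> t" "\<gamma> 0 \<in> flow_dom M X t"
proof -
  show "flow M X t (\<gamma> 0) = \<gamma> t"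
    unfolding flow_def
  proof (rule the_equality)
    fix p assume "\<exists>J' \<gamma>'. integral_curve M X J' \<gamma>' \<and> 0 \<in> J' \<and> t \<in> J' \<and> \<gamma>' 0 = \<gamma> 0 \<and> \<gamma>' t = p"
    then show "p = \<gamma> t" using integral_curve_unique[OF _ assms(1)] assms(2,3) by metis
  qed (use assms in blast)
  show "\<gamma> 0 \<in> flow_dom M X t" unfolding flow_dom_def using assms by blast
qed

lemma flow_domE:
  assumes "m \<in> flow_dom M X t"
  obtains J \<gamma> where "integral_curve M X J \<gamma>" "0 \<in> J" "t \<in> J" "\<gamma> 0 = m"
  using assms unfolding flow_dom_def by blast

lemma integral_curve_shift:
  assumes "integral_curve M X J \<gamma>"
  shows "integral_curve M X {r. r + s \<in> J} (\<lambda>r. \<gamma> (r + s))"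
  unfolding integral_curve_def
proof (intro conjI ballI)
  note D = integral_curveD[OF assms]
  have "open ((\<lambda>r. r + s) -` J)" by (rule open_vimage[OF D(1)]) (intro continuous_intros)
  then show "open {r. r + s \<in> J}" by (simp add: vimage_def)
  show "is_interval {r. r + s \<in> J}"
    unfolding is_interval_1
  proof (intro ballI allI impI)
    fix a b x assume "a \<in> {r. r + s \<in> J}" "b \<in> {r. r + s \<in> J}" "a \<le> x \<and> x \<le> b"
    then have "a + s \<in> J" "b + s \<in> J" "a + s \<le> x + s" "x + s \<le> b + s" by auto
    then show "x \<in> {r. r + s \<in> J}" using D(2) unfolding is_interval_1 by blast
  qed
  have "continuous_map (subtopology euclideanreal {r. r + s \<in> J}) (subtopology euclideanreal J) (\<lambda>r. r + s)"
    by (auto simp: continuous_map_in_subtopology intro!: continuous_intros)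
  from continuous_map_compose[OF this D(3)]
  show "continuous_map (subtopology euclideanreal {r. r + s \<in> J}) (mtop M) (\<lambda>r. \<gamma> (r + s))"
    by (simp add: o_def)
  fix r c assume r: "r \<in> {r. r + s \<in> J}" and c: "c \<in> charts_at M (\<gamma> (r + s))"
  have "((\<lambda>r. r + s) has_vector_derivative 1) (at r)" by (auto intro!: derivative_eq_intros)
  from vector_diff_chain_at[OF this D(4)[OF _ c]] r
  show "((\<lambda>r. snd c (\<gamma> (r + s))) has_vector_derivative X (\<gamma> (r + s)) c) (at r)"
    by (simp add: o_def)
qed

lemma flow_along:
  assumes "integral_curve M X J \<gamma>" "s \<in> J" "t \<in> J"
  shows "flow M X (t - s) (\<gamma> s) = \<gamma> t" "\<gamma> s \<in> flow_dom M X (t - s)"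
  using flow_eq[OF integral_curve_shift[OF assms(1), of s], of "t - s"] assms by auto

text \<open>
  A curve that starts in the half ball and moves at coordinate speed at most \<open>B\<close> needs more than the
  available time to leave the ball. At the first time \<open>r\<close> outside the open ball the curve would still be in
  the closed coordinate ball, which is closed in the manifold; so it has not left the chart domain
  at time \<open>r\<close>, and the speed bound applies up to that time.
\<close>

lemma flow_confined:
  assumes cA: "c \<in> atlas M" and R: "0 < R" "cball x0 R \<subseteq> snd c ` fst c"
    and B: "\<And>x. x \<in> cball x0 R \<Longrightarrow> norm (coord_field c x) \<le> B"
    and \<gamma>: "integral_curve M X J \<gamma>" and J: "0 \<in> J" "s \<in> J"
    and start: "\<gamma> 0 \<in> fst c" "snd c (\<gamma> 0) \<in> ball x0 (R / 2)" and small: "B * \<bar>s\<bar> < R / 2"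
  shows "\<gamma> s \<in> fst c \<and> snd c (\<gamma> s) \<in> ball x0 R"
proof (rule ccontr)
  assume not: "\<not> ?thesis"
  note D = integral_curveD[OF \<gamma>]
  define G where "G = {q \<in> fst c. snd c q \<in> ball x0 R}"
  define K where "K = chart_inv c ` cball x0 R"
  have G: "openin (mtop M) G" unfolding G_def using cA by (rule openin_chart_preimage) simp
  have K: "closedin (mtop M) K"
  proof (rule compactin_imp_closedin[OF Hausdorff])
    show "compactin (mtop M) K"
      unfolding K_def
      by (rule image_compactin[OF _ continuous_map_chart_inv[OF cA]])
        (use R in \<open>simp add: compactin_subtopology\<close>)
  qed
  have KI: "q \<in> K \<longleftrightarrow> q \<in> fst c \<and> snd c q \<in> cball x0 R" for q
  proof
    assume "q \<in> K"
    then obtain x where x: "x \<in> cball x0 R" "q = chart_inv c x" unfolding K_def by blast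
    have "x \<in> snd c ` fst c" using x(1) R(2) by blast
    then show "q \<in> fst c \<and> snd c q \<in> cball x0 R"
      using x chart_inv_mem[OF cA] chart_inv_right[OF cA] by simp
  next
    assume "q \<in> fst c \<and> snd c q \<in> cball x0 R"
    then show "q \<in> K" unfolding K_def using chart_inv_left[OF cA, of q] by (metis imageI)
  qed
  have seg: "closed_segment 0 t \<subseteq> J" if "t \<in> J" for t
    using D(2) J(1) that by (simp add: closed_segment_subset is_interval_convex)
  \<comment> \<open>Minimizing \<open>|r|\<close> over \<open>T\<close> gives the first exit time for both signs of \<open>s\<close>.\<close>
  define T where "T = {r \<in> closed_segment 0 s. \<gamma> r \<notin> G}"
  have sT: "s \<in> T" using not by (auto simp: T_def G_def)
  have "compact T"
  proof -
    have "\<exists>e>0. \<forall>t\<in>closed_segment 0 s. \<bar>t - r\<bar> < e \<longrightarrow> \<gamma> t \<in> G" if "r \<in> closed_segment 0 s" "\<gamma> r \<in> G" for r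
      using curve_preimage_open[OF D(3) G, of r] that seg[OF J(2)] by (meson subsetD)
    then have "openin (top_of_set (closed_segment 0 s)) {r \<in> closed_segment 0 s. \<gamma> r \<in> G}"
      unfolding openin_euclidean_subtopology_iff by (auto simp: dist_real_def)
    then have "closedin (top_of_set (closed_segment 0 s)) (closed_segment 0 s - {r \<in> closed_segment 0 s. \<gamma> r \<in> G})"
      by (simp add: openin_closedin_eq)
    moreover have "closed_segment 0 s - {r \<in> closed_segment 0 s. \<gamma> r \<in> G} = T" by (auto simp: T_def)
    ultimately show ?thesis using closedin_compact compact_segment by metis
  qed
  then obtain r where rT: "r \<in> T" and rmin: "\<And>t. t \<in> T \<Longrightarrow> \<bar>r\<bar> \<le> \<bar>t\<bar>"
    using continuous_attains_inf[of T abs] sT continuous_on_rabs[OF continuous_on_id] by blast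
  have rJ: "r \<in> J" and rs: "\<bar>r\<bar> \<le> \<bar>s\<bar>" using rT seg[OF J(2)] rmin[OF sT] by (auto simp: T_def)
  have "0 \<notin> T" using start R by (auto simp: T_def G_def)
  then have r0: "r \<noteq> 0" using rT by metis
  have segr: "closed_segment 0 r \<subseteq> closed_segment 0 s"
    using rT by (simp add: T_def subset_closed_segment)
  have before: "\<gamma> t \<in> G" if "t \<in> closed_segment 0 r" "t \<noteq> r" for t
  proof (rule ccontr)
    assume "\<gamma> t \<notin> G"
    then have "t \<in> T" using that segr by (auto simp: T_def)
    then have "\<bar>r\<bar> \<le> \<bar>t\<bar>" by (rule rmin)
    then show False using that by (auto simp: closed_segment_eq_real_ivl split: if_splits)
  qed
  have GK: "G \<subseteq> K"
  proof
    fix q assume "q \<in> G"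
    then show "q \<in> K" unfolding KI G_def by auto
  qed
  have rK: "\<gamma> r \<in> K"
  proof (rule ccontr)
    assume "\<gamma> r \<notin> K"
    then have "\<gamma> r \<in> topspace (mtop M) - K" using D(5)[OF rJ] by blast
    then obtain e where e: "e > 0" "\<And>t. t \<in> J \<Longrightarrow> \<bar>t - r\<bar> < e \<Longrightarrow> \<gamma> t \<in> topspace (mtop M) - K"
      using curve_preimage_open[OF D(3) openin_diff[OF openin_topspace K] rJ] by blast
    \<comment> \<open>A time shortly before \<open>r\<close>, at which the curve is still in \<open>G\<close>.\<close>
    define u where "u = min (1 / 2) (e / (2 * \<bar>r\<bar>))"
    have u: "0 < u" "u < 1" "u * \<bar>r\<bar> < e"
      using e(1) r0 by (auto simp: u_def min_def field_simps)
    define t where "t = (1 - u) * r"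
    have "t \<in> closed_segment 0 r" "t \<noteq> r" "\<bar>t - r\<bar> < e"
      using u r0 by (auto simp: t_def closed_segment_def algebra_simps abs_mult intro!: exI[of _ "1 - u"])
    then have "\<gamma> t \<in> K" "\<gamma> t \<notin> K" using before[of t] e(2)[of t] seg[OF rJ] GK by auto
    then show False by blast
  qed
  have inK: "\<gamma> t \<in> K" if "t \<in> closed_segment 0 r" for t
    using before[OF that] GK rK by (cases "t = r") auto
  have "norm (snd c (\<gamma> r) - snd c (\<gamma> 0)) \<le> B * \<bar>r - 0\<bar>"
  proof (rule vector_derivative_norm_bound[where I="closed_segment 0 r" and u'="\<lambda>t. coord_field c (snd c (\<gamma> t))"])
    fix t assume t: "t \<in> closed_segment 0 r"
    show "((\<lambda>t. snd c (\<gamma> t)) has_vector_derivative coord_field c (snd c (\<gamma> t))) (at t within closed_segment 0 r)"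
      by (rule integral_curve_coord[OF \<gamma> _ cA]) (use t seg[OF rJ] inK[OF t, unfolded KI] in auto)
    show "norm (coord_field c (snd c (\<gamma> t))) \<le> B" using B inK[OF t, unfolded KI] by blast
  qed (auto simp: is_interval_convex_1)
  also have "\<dots> \<le> B * \<bar>s\<bar>"
  proof -
    have "x0 \<in> cball x0 R" using R by simp
    then have "B \<ge> 0" using B norm_ge_zero order_trans by blast
    then show ?thesis using rs by (simp add: mult_left_mono)
  qed
  finally have "dist (snd c (\<gamma> 0)) (snd c (\<gamma> r)) < R / 2" using small by (simp add: dist_norm norm_minus_commute)
  then have "snd c (\<gamma> r) \<in> ball x0 R"
    using start(2) dist_triangle_half_r[of "snd c (\<gamma> 0)" x0 R "snd c (\<gamma> r)"] by (simp add: dist_commute)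
  then show False using rT rK[unfolded KI] by (simp add: T_def G_def)
qed

text \<open>
  In a chart, precomposition with the nearest-point projection onto a ball makes the field globally
  Lipschitz, and for a short time the solution stays in the ball, where nothing was changed.
\<close>

lemma integral_curve_exists:
  assumes p: "p \<in> topspace (mtop M)"
  shows "\<exists>a \<gamma>. a > 0 \<and> integral_curve M X {- a<..<a} \<gamma> \<and> \<gamma> 0 = p"
proof -
  obtain c where cp: "c \<in> charts_at M p" using charts_at_exists[OF p] by blast
  note c = charts_atD[OF cp]
  define x0 where "x0 = snd c p"
  obtain R L B where R: "R > 0" "L > 0" "B > 0" "cball x0 R \<subseteq> snd c ` fst c"
    and L: "\<And>x y. x \<in> cball x0 R \<Longrightarrow> y \<in> cball x0 R \<Longrightarrow> norm (coord_field c x - coord_field c y) \<le> L * norm (x - y)"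
    and B: "\<And>x. x \<in> cball x0 R \<Longrightarrow> norm (coord_field c x) \<le> B"
    using coord_field_bounds[OF cp] unfolding x0_def by blast
  define cut where "cut = closest_point (cball x0 R)"
  have cut: "cut x \<in> cball x0 R" for x
    unfolding cut_def using R by (intro closest_point_in_set) auto
  have cut_lip: "norm (cut x - cut y) \<le> norm (x - y)" for x y
    unfolding cut_def using closest_point_lipschitz[of "cball x0 R" x y] R by (simp add: dist_norm)
  have F_lip: "norm (coord_field c (cut x) - coord_field c (cut y)) \<le> L * norm (x - y)" for x y
    using L[OF cut cut, of x y] cut_lip[of x y] R(2) by (meson less_imp_le mult_left_mono order_trans)
  define a where "a = min (1 / (4 * L)) (R / (2 * B))"
  have a: "a > 0" "L * (a - - a) < 1" "B * a < R"
    using R by (auto simp: a_def min_def field_simps)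
  have "continuous_on UNIV (\<lambda>x. coord_field c (cut x))"
  proof (rule lipschitz_on_continuous_on)
    show "L-lipschitz_on UNIV (\<lambda>x. coord_field c (cut x))"
      using F_lip R(2) by (auto intro!: lipschitz_onI simp: dist_norm)
  qed
  then have "continuous_on ({- a..a} \<times> UNIV) (\<lambda>(t::real, x). coord_field c (cut x))"
    unfolding case_prod_unfold by (rule continuous_on_compose2) (auto intro: continuous_intros)
  then obtain y where y0: "y 0 = x0"
    and y: "\<And>t. t \<in> {- a..a} \<Longrightarrow> (y has_vector_derivative coord_field c (cut (y t))) (at t within {- a..a})"
    using picard_lindelof[of 0 "- a" a "\<lambda>t x. coord_field c (cut x)" L x0] a R(2) F_lip by auto
  have y_ball: "y t \<in> cball x0 R" if "t \<in> {- a..a}" for t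
  proof -
    have "norm (y t - y 0) \<le> B * \<bar>t - 0\<bar>"
      by (rule vector_derivative_norm_bound[OF _ y]) (use that a B cut in \<open>auto simp: is_interval_cc\<close>)
    also have "\<dots> \<le> B * a" using that R(3) by (intro mult_left_mono) auto
    finally show ?thesis using a(3) y0 by (simp add: dist_norm norm_minus_commute)
  qed
  have yd: "(y has_vector_derivative coord_field c (y t)) (at t)" if t: "t \<in> {- a<..<a}" for t
  proof -
    have "cut (y t) = y t" unfolding cut_def using y_ball[of t] t by (intro closest_point_self) auto
    moreover have "at t within {- a..a} = at t" using t by (intro at_within_Icc_at) auto
    ultimately show ?thesis using y[of t] t by simp
  qed
  define \<gamma> where "\<gamma> = (\<lambda>t. chart_inv c (y t))"
  have y_im: "y t \<in> snd c ` fst c" if "t \<in> {- a<..<a}" for t using y_ball[of t] that R(4) by auto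
  have "integral_curve M X {- a<..<a} \<gamma>"
    unfolding integral_curve_def
  proof (intro conjI ballI)
    have "continuous_on {- a<..<a} y"
      using yd has_vector_derivative_continuous continuous_at_imp_continuous_on by blast
    then have "continuous_map (top_of_set {- a<..<a}) (top_of_set (snd c ` fst c)) y"
      using y_im by (auto simp: continuous_map_in_subtopology)
    from continuous_map_compose[OF this continuous_map_chart_inv[OF c(1)]]
    show "continuous_map (top_of_set {- a<..<a}) (mtop M) \<gamma>" by (simp add: \<gamma>_def o_def)
    fix t d assume t: "t \<in> {- a<..<a}" and d: "d \<in> charts_at M (\<gamma> t)"
    have ct: "c \<in> charts_at M (\<gamma> t)" using c chart_inv_mem[OF c(1) y_im[OF t]] by (simp add: \<gamma>_def charts_at_iff)
    have yt: "snd c (\<gamma> t) = y t" using chart_inv_right[OF c(1) y_im[OF t]] by (simp add: \<gamma>_def)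
    have "((\<lambda>s. trans_map c d (y s)) has_derivative (\<lambda>h. D_trans c d (\<gamma> t) (h *\<^sub>R coord_field c (y t)))) (at t)"
      using has_derivative_compose[OF yd[OF t, unfolded has_vector_derivative_def], of "trans_map c d"]
        trans_map_has_derivative[OF ct d] yt by simp
    moreover have "D_trans c d (\<gamma> t) (h *\<^sub>R coord_field c (y t)) = h *\<^sub>R X (\<gamma> t) d" for h
      using tangent_law[OF vector_fieldD(1)[OF X] ct d] linear_cmul[OF linear_D_trans[OF ct d]]
      by (simp add: \<gamma>_def)
    ultimately show "((\<lambda>s. snd d (\<gamma> s)) has_vector_derivative X (\<gamma> t) d) (at t)"
      unfolding has_vector_derivative_def by (simp add: \<gamma>_def)
  qed (auto simp: is_interval_oo)
  moreover have "\<gamma> 0 = p" using c y0 by (simp add: \<gamma>_def x0_def)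
  ultimately show ?thesis using a(1) by blast
qed

end

section \<open>The differential of the flow\<close>

text \<open>
  Affine fields satisfy this by definition: each map of the flow, taken for itself, is smooth on an
  open domain.
\<close>

locale smooth_flow_mfd = field_mfd M X for M :: "('a, 'e::euclidean_space) manifold" and X +
  assumes openin_flow_dom: "openin (mtop M) (flow_dom M X t)"
    and smooth_flow: "smooth_map_on M (flow_dom M X t) (flow M X t)"
begin

lemma smooth_at_flow: "q \<in> flow_dom M X t \<Longrightarrow> smooth_at (flow M X t) q"
  unfolding smooth_at_def using openin_flow_dom smooth_flow by blast

text \<open>
  In coordinates, \<open>\<Psi>\<^sub>r\<close> equals the identity plus \<open>r DX\<close> up to a map with Lipschitz constant
  \<open>e |r|\<close> at the base point. Indeed let \<open>u(s)\<close> be the difference of the trajectories of \<open>q\<close> and of the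
  base point. By Gronwall's inequality \<open>u(s)\<close> remains comparable to, and close to, \<open>u(0)\<close>; together with
  strict differentiability of the field this bounds \<open>u' - DX(u(0))\<close> by \<open>e |u(0)|\<close>, and one integrates.
  The neighbourhood \<open>W\<close> may depend on \<open>r\<close>, but the time bound \<open>d\<close> is independent of \<open>q\<close>.
\<close>

lemma flow_coord_estimate:
  assumes \<gamma>: "integral_curve M X J \<gamma>" and J: "0 \<in> J" and cp: "c \<in> charts_at M (\<gamma> 0)" and e: "0 < e"
  shows "\<exists>d>0. \<forall>r. \<bar>r\<bar> < d \<longrightarrow> r \<in> J \<and> \<gamma> r \<in> fst c \<and>
    (\<exists>W. openin (mtop M) W \<and> \<gamma> 0 \<in> W \<and> W \<subseteq> fst c \<and> (\<forall>q\<in>W. 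
       norm (snd c (flow M X r q) - snd c (flow M X r (\<gamma> 0)) - (snd c q - snd c (\<gamma> 0))
         - r *\<^sub>R D_field c (\<gamma> 0) (snd c q - snd c (\<gamma> 0))) \<le> e * \<bar>r\<bar> * norm (snd c q - snd c (\<gamma> 0))))"
proof -
  note c = charts_atD[OF cp]
  define x0 where "x0 = snd c (\<gamma> 0)"
  define A where "A = D_field c (\<gamma> 0)"
  \<comment> \<open>Distances may double, so \<open>e / 4\<close> leaves a relative error of \<open>e / 2\<close> for the linearization.\<close>
  define e' where "e' = min 1 (e / 4)"
  have e': "0 < e'" "e' \<le> 1" "4 * e' \<le> e" using e by (auto simp: e'_def)
  interpret A: linear A unfolding A_def by (rule linear_D_field[OF cp])
  obtain R where R: "R > 0" "cball x0 R \<subseteq> snd c ` fst c"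
    and strict: "\<And>a b. a \<in> cball x0 R \<Longrightarrow> b \<in> cball x0 R \<Longrightarrow>
       norm (coord_field c a - coord_field c b - A (a - b)) \<le> e' * norm (a - b)"
    using coord_field_strict[OF cp e'(1)] unfolding x0_def A_def by blast
  obtain K where K: "K > 0" "\<And>v. norm (A v) \<le> K * norm v"
    using linear_bounded_pos[OF A.linear_axioms] by blast
  define L where "L = K + 1"
  have L0: "L > 0" using K by (simp add: L_def)
  have L: "norm (coord_field c a - coord_field c b) \<le> L * norm (a - b)"
    if "a \<in> cball x0 R" "b \<in> cball x0 R" for a b
  proof -
    have "norm (coord_field c a - coord_field c b)
      \<le> norm (coord_field c a - coord_field c b - A (a - b)) + norm (A (a - b))"
      by (metis diff_add_cancel norm_triangle_ineq)
    also have "\<dots> \<le> e' * norm (a - b) + K * norm (a - b)"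
      using strict[OF that] K(2) by (rule add_mono)
    also have "\<dots> \<le> 1 * norm (a - b) + K * norm (a - b)"
      using e'(2) by (intro add_right_mono mult_right_mono) auto
    finally show ?thesis by (simp add: L_def algebra_simps)
  qed
  define B where "B = norm (coord_field c x0) + L * R"
  have B0: "B > 0" using L0 R by (simp add: B_def add_nonneg_pos)
  have B: "norm (coord_field c a) \<le> B" if a: "a \<in> cball x0 R" for a
  proof -
    have "norm (coord_field c a) \<le> norm (coord_field c x0) + norm (coord_field c a - coord_field c x0)"
      using norm_triangle_sub by blast
    also have "norm (coord_field c a - coord_field c x0) \<le> L * norm (a - x0)"
      using L[OF a] R by simp
    also have "\<dots> \<le> L * R"
      using a L0 by (intro mult_left_mono) (auto simp: dist_norm norm_minus_commute)
    finally show ?thesis by (simp add: B_def)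
  qed
  obtain d0 where d0: "d0 > 0" "ball 0 d0 \<subseteq> J"
    using integral_curveD(1)[OF \<gamma>] J open_contains_ball by blast
  \<comment> \<open>The four bounds on time: the base trajectory exists, no trajectory leaves the ball of radius \<open>R\<close>,
    distances at most double, and they drift by at most \<open>e / (2 K)\<close> in relative terms.\<close>
  define d where "d = min d0 (min (R / (2 * B)) (min (ln 2 / L) (e / (4 * K * L))))"
  have d: "d > 0" using d0 R B0 L0 K e by (simp add: d_def)
  have d_le: "d \<le> d0" "B * d \<le> R / 2" "L * d \<le> ln 2" "K * (L * 2 * d) \<le> e / 2"
  proof -
    have 1: "d \<le> R / (2 * B)" "d \<le> ln 2 / L" "d \<le> e / (4 * K * L)" by (simp_all add: d_def)
    show "d \<le> d0" by (simp add: d_def)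
    show "B * d \<le> R / 2" using 1(1) B0 by (simp add: field_simps)
    show "L * d \<le> ln 2" using 1(2) L0 by (simp add: field_simps)
    show "K * (L * 2 * d) \<le> e / 2" using 1(3) L0 K by (simp add: field_simps)
  qed
  have main: "r \<in> J \<and> \<gamma> r \<in> fst c \<and>
    (\<exists>W. openin (mtop M) W \<and> \<gamma> 0 \<in> W \<and> W \<subseteq> fst c \<and> (\<forall>q\<in>W. 
       norm (snd c (flow M X r q) - snd c (flow M X r (\<gamma> 0)) - (snd c q - snd c (\<gamma> 0))
         - r *\<^sub>R A (snd c q - snd c (\<gamma> 0))) \<le> e * \<bar>r\<bar> * norm (snd c q - snd c (\<gamma> 0))))"
    if r: "\<bar>r\<bar> < d" for r
  proof -
    have rJ: "r \<in> J" using d0(2) d_le(1) r by (auto simp: dist_real_def)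
    have small: "B * \<bar>s\<bar> < R / 2" if "\<bar>s\<bar> \<le> \<bar>r\<bar>" for s
    proof -
      have "B * \<bar>s\<bar> < B * d" using that r B0 by (intro mult_strict_left_mono) auto
      then show ?thesis using d_le(2) by simp
    qed
    define I where "I = closed_segment 0 r"
    have I: "is_interval I" "0 \<in> I" "r \<in> I" by (auto simp: I_def is_interval_convex_1)
    have I_abs: "\<bar>s\<bar> \<le> \<bar>r\<bar>" if "s \<in> I" for s
      using that by (auto simp: I_def closed_segment_eq_real_ivl split: if_splits)
    have conf: "s \<in> J' \<and> \<beta> s \<in> fst c \<and> snd c (\<beta> s) \<in> cball x0 R"
      if \<beta>: "integral_curve M X J' \<beta>" "0 \<in> J'" "r \<in> J'" "\<beta> 0 \<in> fst c" "snd c (\<beta> 0) \<in> ball x0 (R / 2)" and s: "s \<in> I" for J' \<beta> s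
    proof -
      have "closed_segment 0 r \<subseteq> J'"
        using integral_curveD(2)[OF \<beta>(1)] \<beta>(2,3) by (simp add: closed_segment_subset is_interval_convex)
      then have sJ: "s \<in> J'" using s by (auto simp: I_def)
      then show ?thesis
        using flow_confined[OF c(1) R B \<beta>(1,2) sJ \<beta>(4,5) small[OF I_abs[OF s]]] by auto
    qed
    have start: "snd c (\<gamma> 0) \<in> ball x0 (R / 2)" using R by (simp add: x0_def)
    note conf\<gamma> = conf[OF \<gamma> J rJ c(2) start]
    define W where "W = flow_dom M X r \<inter> {q \<in> fst c. snd c q \<in> ball x0 (R / 2)}"
    have "openin (mtop M) W"
      unfolding W_def by (intro openin_Int openin_flow_dom openin_chart_preimage c(1) open_ball)
    moreover have "\<gamma> 0 \<in> W" using flow_eq(2)[OF \<gamma> J rJ] c start by (simp add: W_def)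
    moreover have "W \<subseteq> fst c" by (auto simp: W_def)
    moreover have "norm (snd c (flow M X r q) - snd c (flow M X r (\<gamma> 0)) - (snd c q - snd c (\<gamma> 0))
         - r *\<^sub>R A (snd c q - snd c (\<gamma> 0))) \<le> e * \<bar>r\<bar> * norm (snd c q - snd c (\<gamma> 0))" if q: "q \<in> W" for q
    proof -
      obtain J' \<beta> where \<beta>: "integral_curve M X J' \<beta>" "0 \<in> J'" "r \<in> J'" "\<beta> 0 = q"
        using q flow_domE unfolding W_def by blast
      have q': "\<beta> 0 \<in> fst c" "snd c (\<beta> 0) \<in> ball x0 (R / 2)" using q \<beta>(4) by (auto simp: W_def)
      note conf\<beta> = conf[OF \<beta>(1-3) q']
      define u where "u = (\<lambda>s. snd c (\<beta> s) - snd c (\<gamma> s))"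
      define u' where "u' = (\<lambda>s. coord_field c (snd c (\<beta> s)) - coord_field c (snd c (\<gamma> s)))"
      have u: "(u has_vector_derivative u' s) (at s within I)" if s: "s \<in> I" for s
        unfolding u_def u'_def
        by (intro has_vector_derivative_diff integral_curve_coord[OF \<gamma>] integral_curve_coord[OF \<beta>(1)] c(1))
          (use conf\<beta>[OF s] conf\<gamma>[OF s] in auto)
      have u'_L: "norm (u' s) \<le> L * norm (u s)" if s: "s \<in> I" for s
        unfolding u_def u'_def by (rule L) (use conf\<beta>[OF s] conf\<gamma>[OF s] in auto)
      have growth: "norm (u s) \<le> 2 * norm (u 0)" if s: "s \<in> I" for s
      proof -
        have "norm (u s) \<le> exp (L * \<bar>s - 0\<bar>) * norm (u 0)"
          by (rule gronwall[OF I(1) u u'_L I(2) s])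
        also have "exp (L * \<bar>s - 0\<bar>) \<le> 2"
        proof -
          have "L * \<bar>s - 0\<bar> \<le> L * d" using I_abs[OF s] r L0 by (intro mult_left_mono) auto
          then have "L * \<bar>s - 0\<bar> \<le> ln 2" using d_le(3) by linarith
          then show ?thesis by (metis exp_le_cancel_iff exp_ln zero_less_numeral)
        qed
        finally show ?thesis by (simp add: mult_right_mono)
      qed
      have drift: "norm (u s - u 0) \<le> (L * 2 * d) * norm (u 0)" if s: "s \<in> I" for s
      proof -
        have "norm (u s - u 0) \<le> (L * (2 * norm (u 0))) * \<bar>s - 0\<bar>"
        proof (rule vector_derivative_norm_bound[OF I(1) u _ I(2) s])
          fix t assume t: "t \<in> I"
          have "norm (u' t) \<le> L * norm (u t)" by (rule u'_L[OF t])
          also have "\<dots> \<le> L * (2 * norm (u 0))" using growth[OF t] L0 by (intro mult_left_mono) auto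
          finally show "norm (u' t) \<le> L * (2 * norm (u 0))" .
        qed
        also have "\<dots> \<le> (L * (2 * norm (u 0))) * d"
          using I_abs[OF s] r L0 by (intro mult_left_mono) auto
        finally show ?thesis by (simp add: mult_ac)
      qed
      have "norm ((u r - r *\<^sub>R A (u 0)) - (u 0 - 0 *\<^sub>R A (u 0))) \<le> (e * norm (u 0)) * \<bar>r - 0\<bar>"
      proof (rule vector_derivative_norm_bound[where u'="\<lambda>s. u' s - A (u 0)", OF I(1) _ _ I(2,3)])
        fix s assume s: "s \<in> I"
        show "((\<lambda>s. u s - s *\<^sub>R A (u 0)) has_vector_derivative u' s - A (u 0)) (at s within I)"
          by (auto intro!: derivative_eq_intros u[OF s])
        have "u' s - A (u 0) = (u' s - A (u s)) + A (u s - u 0)" by (simp add: A.diff)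
        then have "norm (u' s - A (u 0)) \<le> norm (u' s - A (u s)) + norm (A (u s - u 0))"
          using norm_triangle_ineq by metis
        also have "norm (u' s - A (u s)) \<le> e' * norm (u s)"
          unfolding u_def u'_def by (rule strict) (use conf\<beta>[OF s] conf\<gamma>[OF s] in auto)
        also have "e' * norm (u s) \<le> e' * (2 * norm (u 0))" using growth[OF s] e' by (intro mult_left_mono) auto
        also have "e' * (2 * norm (u 0)) = (2 * e') * norm (u 0)" by simp
        also have "\<dots> \<le> (e / 2) * norm (u 0)" using e' by (intro mult_right_mono) auto
        also have "norm (A (u s - u 0)) \<le> K * norm (u s - u 0)" by (rule K(2))
        also have "\<dots> \<le> K * ((L * 2 * d) * norm (u 0))" using drift[OF s] K by (intro mult_left_mono) auto
        also have "\<dots> = (K * (L * 2 * d)) * norm (u 0)" by simp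
        also have "\<dots> \<le> (e / 2) * norm (u 0)" using d_le(4) by (rule mult_right_mono) simp
        finally show "norm (u' s - A (u 0)) \<le> e * norm (u 0)" by (simp add: field_simps)
      qed
      moreover have "flow M X r q = \<beta> r" using flow_eq(1)[OF \<beta>(1-3)] \<beta>(4) by simp
      moreover have "flow M X r (\<gamma> 0) = \<gamma> r" by (rule flow_eq(1)[OF \<gamma> J rJ])
      ultimately show ?thesis using \<beta>(4) by (simp add: u_def algebra_simps)
    qed
    ultimately show ?thesis using rJ conf\<gamma>[OF I(3)] by blast
  qed
  show ?thesis
    by (rule exI[of _ d]) (use d main in \<open>simp add: A_def\<close>)
qed

text \<open>
  The finite difference estimate passes to the differential of \<open>\<Psi>\<^sub>r\<close> in the space variable, which
  exists because \<open>\<Psi>\<^sub>r\<close> is smooth.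
\<close>

lemma flow_differential_at_0:
  assumes \<gamma>: "integral_curve M X J \<gamma>" and J: "0 \<in> J" and cp: "c \<in> charts_at M (\<gamma> 0)"
    and v: "v \<in> tangent_space M (\<gamma> 0)"
  shows "((\<lambda>r. tangent_map M (flow M X r) (\<gamma> 0) v c) has_vector_derivative D_field c (\<gamma> 0) (v c)) (at 0)"
proof -
  note c = charts_atD[OF cp]
  define A where "A = D_field c (\<gamma> 0)"
  define T where "T = (\<lambda>r. tangent_map M (flow M X r) (\<gamma> 0) v c)"
  interpret A: linear A unfolding A_def by (rule linear_D_field[OF cp])
  have est: "\<exists>d>0. \<forall>r. \<bar>r\<bar> < d \<longrightarrow> norm (T r - v c - r *\<^sub>R A (v c)) \<le> e * \<bar>r\<bar> * norm (v c)" if "e > 0" for e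
  proof -
    obtain d where d: "d > 0" and H: "\<And>r. \<bar>r\<bar> < d \<Longrightarrow> r \<in> J \<and> \<gamma> r \<in> fst c \<and>
    (\<exists>W. openin (mtop M) W \<and> \<gamma> 0 \<in> W \<and> W \<subseteq> fst c \<and> (\<forall>q\<in>W. 
       norm (snd c (flow M X r q) - snd c (flow M X r (\<gamma> 0)) - (snd c q - snd c (\<gamma> 0))
         - r *\<^sub>R A (snd c q - snd c (\<gamma> 0))) \<le> e * \<bar>r\<bar> * norm (snd c q - snd c (\<gamma> 0))))"
      using flow_coord_estimate[OF \<gamma> J cp \<open>e > 0\<close>] unfolding A_def by blast
    have "norm (T r - v c - r *\<^sub>R A (v c)) \<le> e * \<bar>r\<bar> * norm (v c)" if r: "\<bar>r\<bar> < d" for r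
    proof -
      have rJ: "r \<in> J" and rc: "\<gamma> r \<in> fst c" using H[OF r] by blast+
      obtain W where W: "openin (mtop M) W" "\<gamma> 0 \<in> W" "W \<subseteq> fst c" and
        est: "\<And>q. q \<in> W \<Longrightarrow> norm (snd c (flow M X r q) - snd c (flow M X r (\<gamma> 0)) - (snd c q - snd c (\<gamma> 0))
         - r *\<^sub>R A (snd c q - snd c (\<gamma> 0))) \<le> e * \<bar>r\<bar> * norm (snd c q - snd c (\<gamma> 0))"
        using H[OF r] by blast
      let ?x0 = "snd c (\<gamma> 0)"
      define F where "F = (\<lambda>x. snd c (flow M X r (chart_inv c x)))"
      have sm: "smooth_at (flow M X r) (\<gamma> 0)" by (rule smooth_at_flow[OF flow_eq(2)[OF \<gamma> J rJ]])
      have cr: "c \<in> charts_at M (flow M X r (\<gamma> 0))"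
        using flow_eq(1)[OF \<gamma> J rJ] rc c(1) by (simp add: charts_at_iff)
      define DF where "DF = frechet_derivative F (at ?x0)"
      have DF: "(F has_derivative DF) (at ?x0)"
        unfolding F_def DF_def by (rule smooth_at_has_derivative[OF sm cp cr])
      have TD: "T r = DF (v c)"
        unfolding T_def DF_def F_def by (rule tangent_map_eq[OF sm v cp cr])
      define h where "h = (\<lambda>x. F x - x - r *\<^sub>R A (x - ?x0))"
      have A_deriv: "((\<lambda>x. r *\<^sub>R A (x - ?x0)) has_derivative (\<lambda>v. r *\<^sub>R A v)) (at ?x0)"
        by (rule has_derivative_scaleR_right)
          (rule has_derivative_eq_rhs[OF has_derivative_compose[OF has_derivative_diff[OF has_derivative_ident has_derivative_const]
                linear_imp_has_derivative[OF A.linear_axioms]]], simp)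
      have "(h has_derivative (\<lambda>v. DF v - v - r *\<^sub>R A v)) (at ?x0)"
        unfolding h_def by (intro has_derivative_diff DF has_derivative_ident A_deriv)
      moreover have "\<forall>\<^sub>F x in nhds ?x0. norm (h x - h ?x0) \<le> (e * \<bar>r\<bar>) * norm (x - ?x0)"
        unfolding eventually_nhds
      proof (intro exI conjI ballI)
        show "open (snd c ` W)" by (rule open_chart_image_of[OF c(1) W(1,3)])
        show "?x0 \<in> snd c ` W" using W(2) by blast
        fix x assume "x \<in> snd c ` W"
        then obtain q where q: "q \<in> W" "x = snd c q" by blast
        then have "chart_inv c x = q" "chart_inv c ?x0 = \<gamma> 0" using W(3) c by auto
        then show "norm (h x - h ?x0) \<le> e * \<bar>r\<bar> * norm (x - ?x0)"
          using est[OF q(1)] q(2) by (simp add: h_def F_def A.diff A.zero algebra_simps)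
      qed
      ultimately have "norm (DF (v c) - v c - r *\<^sub>R A (v c)) \<le> (e * \<bar>r\<bar>) * norm (v c)"
        by (rule has_derivative_norm_le)
      then show ?thesis using TD by simp
    qed
    then show ?thesis using d by blast
  qed
  have T0: "T 0 = v c"
  proof -
    obtain d where "d > 0" "\<And>r. \<bar>r\<bar> < d \<Longrightarrow> norm (T r - v c - r *\<^sub>R A (v c)) \<le> 1 * \<bar>r\<bar> * norm (v c)"
      using est[OF zero_less_one] by blast
    from this(2)[of 0] this(1) show ?thesis by simp
  qed
  show ?thesis
    unfolding has_vector_derivative_def has_derivative_at_alt A_def[symmetric] T_def[symmetric]
  proof (intro conjI allI impI)
    show "bounded_linear (\<lambda>h. h *\<^sub>R A (v c))" by (rule bounded_linear_scaleR_left)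
    fix e :: real assume e: "e > 0"
    define e' where "e' = e / (norm (v c) + 1)"
    have n: "norm (v c) + 1 > 0" by (rule add_nonneg_pos) auto
    have "e' * norm (v c) + e' = e"
      using n by (simp add: e'_def add_divide_distrib[symmetric] distrib_left[symmetric] field_simps)
    moreover have "e' > 0" using e n by (simp add: e'_def)
    ultimately have e': "e' > 0" "e' * norm (v c) \<le> e" by linarith+
    obtain d where d: "d > 0" "\<And>r. \<bar>r\<bar> < d \<Longrightarrow> norm (T r - v c - r *\<^sub>R A (v c)) \<le> e' * \<bar>r\<bar> * norm (v c)"
      using est[OF e'(1)] by blast
    have "norm (T r - T 0 - (r - 0) *\<^sub>R A (v c)) \<le> e * norm (r - 0)" if "norm (r - 0) < d" for r
    proof -
      have "norm (T r - v c - r *\<^sub>R A (v c)) \<le> e' * \<bar>r\<bar> * norm (v c)" using d(2) that by simp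
      also have "\<dots> = (e' * norm (v c)) * \<bar>r\<bar>" by simp
      also have "\<dots> \<le> e * \<bar>r\<bar>" using e'(2) by (rule mult_right_mono) simp
      finally show ?thesis by (simp add: T0)
    qed
    then show "\<exists>d>0. \<forall>r. norm (r - 0) < d \<longrightarrow> norm (T r - T 0 - (r - 0) *\<^sub>R A (v c)) \<le> e * norm (r - 0)"
      using d(1) by blast
  qed
qed

text \<open>
  The condition on signs ensures that one of the two given integral curves contains all times involved,
  so that no curves have to be glued.
\<close>

lemma flow_compose:
  assumes q: "q \<in> flow_dom M X a" "q \<in> flow_dom M X (a + b)"
    and sign: "0 \<le> a \<and> 0 \<le> a + b \<or> a \<le> 0 \<and> a + b \<le> 0"
  shows "flow M X (a + b) q = flow M X b (flow M X a q)"
proof -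
  have "\<exists>J \<gamma>. integral_curve M X J \<gamma> \<and> 0 \<in> J \<and> a \<in> J \<and> a + b \<in> J \<and> \<gamma> 0 = q"
  proof (cases "\<bar>a\<bar> \<le> \<bar>a + b\<bar>")
    case True
    obtain J \<gamma> where \<gamma>: "integral_curve M X J \<gamma>" "0 \<in> J" "a + b \<in> J" "\<gamma> 0 = q"
      using q(2) by (rule flow_domE)
    have "a \<in> closed_segment 0 (a + b)" using True sign by (auto simp: closed_segment_eq_real_ivl)
    moreover have "closed_segment 0 (a + b) \<subseteq> J"
      using integral_curveD(2)[OF \<gamma>(1)] \<gamma>(2,3) by (simp add: closed_segment_subset is_interval_convex)
    ultimately show ?thesis using \<gamma> by blast
  next
    case False
    obtain J \<gamma> where \<gamma>: "integral_curve M X J \<gamma>" "0 \<in> J" "a \<in> J" "\<gamma> 0 = q"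
      using q(1) by (rule flow_domE)
    have "a + b \<in> closed_segment 0 a" using False sign by (auto simp: closed_segment_eq_real_ivl)
    moreover have "closed_segment 0 a \<subseteq> J"
      using integral_curveD(2)[OF \<gamma>(1)] \<gamma>(2,3) by (simp add: closed_segment_subset is_interval_convex)
    ultimately show ?thesis using \<gamma> by blast
  qed
  then obtain J \<gamma> where \<gamma>: "integral_curve M X J \<gamma>" "0 \<in> J" "a \<in> J" "a + b \<in> J" "\<gamma> 0 = q" by blast
  then show ?thesis
    using flow_along(1)[OF \<gamma>(1,3,4)] flow_eq(1)[OF \<gamma>(1,2,3)] flow_eq(1)[OF \<gamma>(1,2,4)] by simp
qed

lemma tangent_map_flow_compose:
  assumes \<gamma>: "integral_curve M X J \<gamma>" and J: "t \<in> J" "s \<in> J" "r \<in> J" and w: "w \<in> tangent_space M (\<gamma> t)"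
    and sign: "t \<le> s \<and> t \<le> r \<or> s \<le> t \<and> r \<le> t"
  shows "tangent_map M (flow M X (r - s)) (\<gamma> s) (tangent_map M (flow M X (s - t)) (\<gamma> t) w)
    = tangent_map M (flow M X (r - t)) (\<gamma> t) w"
proof -
  note f = flow_along[OF \<gamma>]
  have "tangent_map M (flow M X (r - t)) (\<gamma> t) w
    = tangent_map M (flow M X (r - s)) (flow M X (s - t) (\<gamma> t)) (tangent_map M (flow M X (s - t)) (\<gamma> t) w)"
  proof (rule tangent_map_compose[where W="flow_dom M X (s - t) \<inter> flow_dom M X (r - t)"])
    show "smooth_at (flow M X (s - t)) (\<gamma> t)" by (rule smooth_at_flow[OF f(2)[OF J(1,2)]])
    show "smooth_at (flow M X (r - s)) (flow M X (s - t) (\<gamma> t))"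
      unfolding f(1)[OF J(1,2)] by (rule smooth_at_flow[OF f(2)[OF J(2,3)]])
    show "openin (mtop M) (flow_dom M X (s - t) \<inter> flow_dom M X (r - t))"
      by (intro openin_Int openin_flow_dom)
    show "\<gamma> t \<in> flow_dom M X (s - t) \<inter> flow_dom M X (r - t)" using f(2)[OF J(1,2)] f(2)[OF J(1,3)] by blast
    fix q assume "q \<in> flow_dom M X (s - t) \<inter> flow_dom M X (r - t)"
    then show "flow M X (r - t) q = flow M X (r - s) (flow M X (s - t) q)"
      using flow_compose[of q "s - t" "r - s"] sign by auto
  qed (rule w)
  then show ?thesis by (simp add: f(1)[OF J(1,2)])
qed

lemma tangent_map_flow_0:
  assumes "p \<in> topspace (mtop M)" "v \<in> tangent_space M p"
  shows "tangent_map M (flow M X 0) p v = v"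
proof (rule tangent_map_id[OF assms(2) openin_topspace assms(1)])
  fix q assume "q \<in> topspace (mtop M)"
  then obtain a \<gamma> where "a > 0" "integral_curve M X {- a<..<a} \<gamma>" "\<gamma> 0 = q"
    using integral_curve_exists by blast
  then show "flow M X 0 q = q" using flow_eq(1)[of "{- a<..<a}" \<gamma> 0] by auto
qed

lemma pushforward_tangent:
  assumes "integral_curve M X J \<gamma>" "t \<in> J" "s \<in> J" "w \<in> tangent_space M (\<gamma> t)"
  shows "tangent_map M (flow M X (s - t)) (\<gamma> t) w \<in> tangent_space M (\<gamma> s)"
  using tangent_map_in[OF smooth_at_flow[OF flow_along(2)[OF assms(1-3)]] assms(4)]
    flow_along(1)[OF assms(1-3)] by simp

text \<open>
  The variational equation of the flow. Near \<open>s\<close> the push-forward is the image of its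
  value at time \<open>s\<close> under \<open>T\<Psi>\<^sub>r\<^sub>-\<^sub>s\<close>, so the derivative at time \<open>0\<close> suffices.
\<close>

lemma pushforward_has_derivative:
  assumes \<gamma>: "integral_curve M X J \<gamma>" and J: "t \<in> J" "s \<in> J" and w: "w \<in> tangent_space M (\<gamma> t)"
    and c: "c \<in> charts_at M (\<gamma> s)"
  shows "((\<lambda>r. tangent_map M (flow M X (r - t)) (\<gamma> t) w c) has_vector_derivative
    D_field c (\<gamma> s) (tangent_map M (flow M X (s - t)) (\<gamma> t) w c)) (at s)"
proof -
  define V where "V = tangent_map M (flow M X (s - t)) (\<gamma> t) w"
  have V: "V \<in> tangent_space M (\<gamma> s)" unfolding V_def by (rule pushforward_tangent[OF \<gamma> J w])
  have shift: "((\<lambda>r. r - s) has_vector_derivative 1) (at s)" by (auto intro!: derivative_eq_intros)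
  have "((\<lambda>r. tangent_map M (flow M X r) (\<gamma> s) V c) has_vector_derivative D_field c (\<gamma> s) (V c)) (at (s - s))"
    using flow_differential_at_0[OF integral_curve_shift[OF \<gamma>, of s], of c V] J(2) c V by simp
  from vector_diff_chain_at[OF shift this]
  have D: "((\<lambda>r. tangent_map M (flow M X (r - s)) (\<gamma> s) V c) has_vector_derivative D_field c (\<gamma> s) (V c)) (at s)"
    by (simp add: o_def)
  \<comment> \<open>If \<open>s \<noteq> t\<close>, then for \<open>r\<close> in \<open>N\<close> the times \<open>r - t\<close> and \<open>s - t\<close> have the same sign, as \<open>flow_compose\<close> requires.\<close>
  define N where "N = J \<inter> (if s = t then UNIV else if t < s then {t<..} else {..<t})"
  have N: "open N" "s \<in> N" using integral_curveD(1)[OF \<gamma>] J by (auto simp: N_def)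
  show ?thesis
    unfolding V_def[symmetric]
  proof (rule has_vector_derivative_transform_within_open[OF D N])
    fix r assume r: "r \<in> N"
    show "tangent_map M (flow M X (r - s)) (\<gamma> s) V c = tangent_map M (flow M X (r - t)) (\<gamma> t) w c"
    proof (cases "s = t")
      case True
      then have "V = w" unfolding V_def using tangent_map_flow_0[OF integral_curveD(5)[OF \<gamma> J(1)] w] by simp
      then show ?thesis using True by simp
    next
      case False
      have "tangent_map M (flow M X (r - s)) (\<gamma> s) V = tangent_map M (flow M X (r - t)) (\<gamma> t) w"
        unfolding V_def by (rule tangent_map_flow_compose[OF \<gamma> J _ w]) (use r False in \<open>auto simp: N_def split: if_splits\<close>)
      then show ?thesis by simp
    qed
  qed
qed

end

section \<open>Parallel fields along integral curves\<close>

locale conn_field_mfd = conn_mfd M nabla + field_mfd M X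
  for M :: "('a, 'e::euclidean_space) manifold" and nabla and X
begin

lemma continuous_field_along:
  assumes \<gamma>: "integral_curve M X J \<gamma>" and Z: "Z \<in> vector_fields M" and c: "c \<in> atlas M"
    and I: "I \<subseteq> J" "\<gamma> ` I \<subseteq> fst c"
  shows "continuous_on I (\<lambda>s. Z (\<gamma> s) c)"
proof -
  have "continuous_map (top_of_set I) (mtop M) \<gamma>"
    using integral_curveD(3)[OF \<gamma>] I(1) continuous_map_from_subtopology_mono by blast
  then have cont: "continuous_on I (\<lambda>s. snd c (\<gamma> s))" by (rule continuous_on_chart_curve[OF _ c I(2)])
  have "continuous_on I (\<lambda>s. (\<lambda>x. Z (chart_inv c x) c) (snd c (\<gamma> s)))"
    by (rule continuous_on_compose2[OF smooth_on_continuous[OF vector_fieldD(2)[OF Z c]] cont]) (use I(2) in auto)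
  then show ?thesis
    by (rule continuous_on_eq) (use I(2) c in auto)
qed

text \<open>
  Along the curve, the parallel transport equation is linear with continuous coefficients \<open>w\<close>, and hence
  Lipschitz with a uniform constant on a compact interval.
\<close>

lemma christoffel_along:
  assumes \<gamma>: "integral_curve M X J \<gamma>" and s0: "s0 \<in> J" and cp: "c \<in> charts_at M (\<gamma> s0)"
  obtains d U E w L where "0 < d" "0 < L" "{s0 - d..s0 + d} \<subseteq> J" "is_frame c U E"
    "\<forall>s\<in>{s0 - d..s0 + d}. \<gamma> s \<in> U" "\<forall>j. continuous_on {s0 - d..s0 + d} (w j)"
    "\<forall>s\<in>{s0 - d..s0 + d}. \<forall>v. christoffel M nabla c (\<gamma> s) (X (\<gamma> s) c) v = (\<Sum>j\<in>Basis. (v \<bullet> j) *\<^sub>R w j s)"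
    "\<forall>s\<in>{s0 - d..s0 + d}. \<forall>v. norm (christoffel M nabla c (\<gamma> s) (X (\<gamma> s) c) v) \<le> L * norm v"
proof -
  note c = charts_atD[OF cp]
  obtain U E where U0: "\<gamma> s0 \<in> U" and E: "is_frame c U E" by (rule frame_exists[OF cp])
  note frame = is_frameD[OF E]
  obtain d1 where d1: "d1 > 0" "\<And>t. t \<in> J \<Longrightarrow> \<bar>t - s0\<bar> < d1 \<Longrightarrow> \<gamma> t \<in> U"
    using curve_preimage_open[OF integral_curveD(3)[OF \<gamma>] frame(2) s0 U0] by blast
  obtain d2 where d2: "d2 > 0" "cball s0 d2 \<subseteq> J"
    using integral_curveD(1)[OF \<gamma>] s0 open_contains_cball by blast
  define d where "d = min (d1 / 2) d2"
  define I where "I = {s0 - d..s0 + d}"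
  have d: "d > 0" using d1 d2 by (simp add: d_def)
  have I: "s \<in> J" "\<gamma> s \<in> U" if "s \<in> I" for s
  proof -
    have "\<bar>s - s0\<bar> \<le> d" using that by (auto simp: I_def)
    then have "\<bar>s - s0\<bar> < d1" "\<bar>s - s0\<bar> \<le> d2" using d1(1) by (auto simp: d_def min_def split: if_splits)
    then show "s \<in> J" using d2(2) by (auto simp: dist_real_def abs_minus_commute)
    then show "\<gamma> s \<in> U" using d1(2) \<open>\<bar>s - s0\<bar> < d1\<close> by blast
  qed
  then have IJ: "I \<subseteq> J" and IU: "\<gamma> ` I \<subseteq> fst c" using frame(3) by auto
  define w where "w = (\<lambda>j s. \<Sum>i\<in>Basis. (X (\<gamma> s) c \<bullet> i) *\<^sub>R nabla (E i) (E j) (\<gamma> s) c)"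
  have w_cont: "continuous_on I (w j)" for j
    unfolding w_def
    by (intro continuous_intros continuous_field_along[OF \<gamma> _ c(1) IJ IU] X nabla_vector_field frame(4))
  have w: "christoffel M nabla c (\<gamma> s) (X (\<gamma> s) c) v = (\<Sum>j\<in>Basis. (v \<bullet> j) *\<^sub>R w j s)" if "s \<in> I" for s v
    unfolding christoffel_frame[OF E I(2)[OF that]] w_def
    by (subst sum.swap) (simp add: scaleR_sum_right mult_ac)
  have "\<exists>N. \<forall>s\<in>I. norm (w j s) \<le> N" for j
  proof -
    have "compact (w j ` I)" by (rule compact_continuous_image[OF w_cont]) (simp add: I_def)
    then show ?thesis using compact_imp_bounded bounded_iff by (metis imageI)
  qed
  then obtain N where N: "\<And>j s. s \<in> I \<Longrightarrow> norm (w j s) \<le> N j" by metis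
  define L where "L = (\<Sum>j\<in>(Basis::'e set). \<bar>N j\<bar>) + 1"
  have L: "L > 0" unfolding L_def by (intro add_nonneg_pos sum_nonneg) auto
  have bound: "norm (christoffel M nabla c (\<gamma> s) (X (\<gamma> s) c) v) \<le> L * norm v" if "s \<in> I" for s v
  proof -
    have "norm (\<Sum>j\<in>Basis. (v \<bullet> j) *\<^sub>R w j s) \<le> (\<Sum>j\<in>(Basis::'e set). norm v * \<bar>N j\<bar>)"
    proof (rule sum_norm_le)
      fix j :: 'e assume "j \<in> Basis"
      then have "\<bar>v \<bullet> j\<bar> * norm (w j s) \<le> norm v * \<bar>N j\<bar>"
        using N[OF that, of j] by (intro mult_mono) (auto simp: Basis_le_norm)
      then show "norm ((v \<bullet> j) *\<^sub>R w j s) \<le> norm v * \<bar>N j\<bar>" by simp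
    qed
    also have "\<dots> \<le> L * norm v" by (simp add: L_def sum_distrib_left[symmetric] algebra_simps)
    finally show ?thesis unfolding w[OF that] .
  qed
  show ?thesis
    by (rule that[of d L U E w], unfold I_def[symmetric]) (use d L IJ E I(2) w_cont w bound in blast)+
qed

lemma parallel_alongD:
  assumes "integral_curve M X J \<gamma>" "I \<subseteq> J" "parallel_along M nabla I \<gamma> V" "t \<in> I"
  shows "V t \<in> tangent_space M (\<gamma> t)"
    and "c \<in> charts_at M (\<gamma> t) \<Longrightarrow> ((\<lambda>s. V s c) has_vector_derivative
       - christoffel M nabla c (\<gamma> t) (X (\<gamma> t) c) (V t c)) (at t within I)"
proof -
  show "V t \<in> tangent_space M (\<gamma> t)" using assms(3,4) unfolding parallel_along_def by blast
  assume c: "c \<in> charts_at M (\<gamma> t)"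
  have "vector_derivative (\<lambda>s. snd c (\<gamma> s)) (at t) = X (\<gamma> t) c"
    by (rule vector_derivative_at[OF integral_curveD(4)[OF assms(1) _ c]]) (use assms in auto)
  moreover have "((\<lambda>s. V s c) has_vector_derivative
       - christoffel M nabla c (\<gamma> t) (vector_derivative (\<lambda>s. snd c (\<gamma> s)) (at t)) (V t c)) (at t within I)"
    using assms(3,4) c unfolding parallel_along_def by blast
  ultimately show "((\<lambda>s. V s c) has_vector_derivative
       - christoffel M nabla c (\<gamma> t) (X (\<gamma> t) c) (V t c)) (at t within I)" by simp
qed

lemma parallel_alongI:
  assumes "integral_curve M X J \<gamma>" "I \<subseteq> J"
    and "\<And>t. t \<in> I \<Longrightarrow> V t \<in> tangent_space M (\<gamma> t)"
    and "\<And>t c. t \<in> I \<Longrightarrow> c \<in> charts_at M (\<gamma> t) \<Longrightarrow> ((\<lambda>s. V s c) has_vector_derivative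
       - christoffel M nabla c (\<gamma> t) (X (\<gamma> t) c) (V t c)) (at t within I)"
  shows "parallel_along M nabla I \<gamma> V"
  unfolding parallel_along_def
proof (intro ballI conjI)
  fix t c assume t: "t \<in> I" and c: "c \<in> charts_at M (\<gamma> t)"
  have "vector_derivative (\<lambda>s. snd c (\<gamma> s)) (at t) = X (\<gamma> t) c"
    by (rule vector_derivative_at[OF integral_curveD(4)[OF assms(1) _ c]]) (use assms t in auto)
  then show "((\<lambda>s. V s c) has_vector_derivative
       - christoffel M nabla c (\<gamma> t) (vector_derivative (\<lambda>s. snd c (\<gamma> s)) (at t)) (V t c)) (at t within I)"
    using assms(4)[OF t c] by simp
qed (rule assms(3))

lemma parallel_along_subset:
  "parallel_along M nabla I \<gamma> V \<Longrightarrow> I' \<subseteq> I \<Longrightarrow> parallel_along M nabla I' \<gamma> V"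
  unfolding parallel_along_def by (meson has_vector_derivative_within_subset subsetD)

text \<open>
  In one chart, the difference of two parallel fields solves a linear equation, so by Gronwall's
  inequality agreement at one time is the same as agreement at all nearby times. Agreement is thus
  locally constant along the interval.
\<close>

lemma parallel_unique:
  assumes \<gamma>: "integral_curve M X J \<gamma>" and I: "is_interval I" "I \<subseteq> J"
    and V1: "parallel_along M nabla I \<gamma> V1" and V2: "parallel_along M nabla I \<gamma> V2"
    and ab: "a \<in> I" "b \<in> I" and eq: "V1 a = V2 a"
  shows "V1 b = V2 b"
proof -
  note P1 = parallel_alongD[OF \<gamma> I(2) V1] and P2 = parallel_alongD[OF \<gamma> I(2) V2]
  have "\<forall>\<^sub>F s in at s0 within I. (V1 s0 = V2 s0) = (V1 s = V2 s)" if s0: "s0 \<in> I" for s0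
  proof -
    obtain c where cp: "c \<in> charts_at M (\<gamma> s0)"
      using charts_at_exists integral_curveD(5)[OF \<gamma>] I(2) s0 by blast
    note c = charts_atD[OF cp]
    have s0J: "s0 \<in> J" using I(2) s0 by blast
    obtain d U E w L where d: "0 < d" "0 < L" "{s0 - d..s0 + d} \<subseteq> J" "is_frame c U E"
        "\<forall>s\<in>{s0 - d..s0 + d}. \<gamma> s \<in> U"
      and w: "\<forall>j. continuous_on {s0 - d..s0 + d} (w j)"
        "\<forall>s\<in>{s0 - d..s0 + d}. \<forall>v. christoffel M nabla c (\<gamma> s) (X (\<gamma> s) c) v = (\<Sum>j\<in>Basis. (v \<bullet> j) *\<^sub>R w j s)"
      and L: "\<forall>s\<in>{s0 - d..s0 + d}. \<forall>v. norm (christoffel M nabla c (\<gamma> s) (X (\<gamma> s) c) v) \<le> L * norm v"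
      by (rule christoffel_along[OF \<gamma> s0J cp])
    define K where "K = I \<inter> {s0 - d..s0 + d}"
    have K: "is_interval K" "s0 \<in> K"
      using I(1) s0 d(1) by (auto simp: K_def intro!: is_interval_Int is_interval_cc)
    have cK: "c \<in> charts_at M (\<gamma> s)" if "s \<in> K" for s
      using is_frameD(6)[OF d(4)] d(5) that by (auto simp: K_def)
    define u where "u = (\<lambda>s. V1 s c - V2 s c)"
    define u' where "u' = (\<lambda>s. - christoffel M nabla c (\<gamma> s) (X (\<gamma> s) c) (u s))"
    have u: "(u has_vector_derivative u' s) (at s within K)" if s: "s \<in> K" for s
    proof -
      have sI: "s \<in> I" using s by (simp add: K_def)
      have "(u has_vector_derivative - christoffel M nabla c (\<gamma> s) (X (\<gamma> s) c) (V1 s c)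
          - - christoffel M nabla c (\<gamma> s) (X (\<gamma> s) c) (V2 s c)) (at s within I)"
        unfolding u_def by (intro has_vector_derivative_diff P1(2) P2(2) sI cK s)
      moreover have "- christoffel M nabla c (\<gamma> s) (X (\<gamma> s) c) (V1 s c)
          - - christoffel M nabla c (\<gamma> s) (X (\<gamma> s) c) (V2 s c) = u' s"
        by (simp add: u'_def u_def linear_diff[OF linear_christoffel[OF cK[OF s]]])
      ultimately have "(u has_vector_derivative u' s) (at s within I)" by simp
      then show ?thesis by (rule has_vector_derivative_within_subset) (auto simp: K_def)
    qed
    have bound: "norm (u' s) \<le> L * norm (u s)" if "s \<in> K" for s
      using L that by (simp add: u'_def K_def)
    have iff: "V1 s = V2 s \<longleftrightarrow> u s = 0" if "s \<in> K" for s
    proof -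
      have sI: "s \<in> I" using that by (simp add: K_def)
      show ?thesis using tangent_eqI[OF P1(1)[OF sI] P2(1)[OF sI] cK[OF that]] by (auto simp: u_def)
    qed
    have "(V1 s0 = V2 s0) = (V1 s = V2 s)" if s: "s \<in> K" for s
      using gronwall[OF K(1) u bound K(2) s] gronwall[OF K(1) u bound s K(2)]
      unfolding iff[OF K(2)] iff[OF s] by auto
    moreover have "s \<in> K" if "s \<in> I" "dist s s0 < d" for s
      using that by (auto simp: K_def dist_real_def)
    ultimately show ?thesis unfolding eventually_at using d(1) by blast
  qed
  then have "(V1 a = V2 a) = (V1 b = V2 b)"
    by (intro connected_local_const[where A=I and f="\<lambda>s. V1 s = V2 s"])
      (use I ab is_interval_connected in auto)
  then show ?thesis using eq by simp
qed

lemma parallel_transport_eq: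
  assumes \<gamma>: "integral_curve M X J \<gamma>" and J: "a \<in> J" "b \<in> J"
    and V: "parallel_along M nabla (closed_segment a b) \<gamma> V"
  shows "parallel_transport M nabla \<gamma> a b (V a) = V b"
  unfolding parallel_transport_def
proof (rule the_equality)
  show "\<exists>V'. parallel_along M nabla (closed_segment a b) \<gamma> V' \<and> V' a = V a \<and> V' b = V b"
    using V by blast
  have sub: "closed_segment a b \<subseteq> J"
    using integral_curveD(2)[OF \<gamma>] J by (simp add: closed_segment_subset is_interval_convex)
  fix w assume "\<exists>V'. parallel_along M nabla (closed_segment a b) \<gamma> V' \<and> V' a = V a \<and> V' b = w"
  then obtain V' where "parallel_along M nabla (closed_segment a b) \<gamma> V'" "V' a = V a" "V' b = w" by blast
  then show "w = V b"
    using parallel_unique[OF \<gamma> _ sub _ V, of V' a b] by (auto simp: is_interval_convex_1)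
qed

text \<open>
  The field is sought in the form \<open>V = (\<Sum>b. y\<^sup>b E b)\<close> for a frame in one chart, where the
  linear equation for \<open>y\<close> is solved. That \<open>V\<close> is parallel in every other chart then does not require
  the transformation law of the Christoffel maps: the covariant derivative of \<open>V\<close> is
  \<open>(\<Sum>b. y\<^sup>b' E b + y\<^sup>b nabla X (E b))\<close>, a tangent vector, and vanishes because its coordinates in one
  chart do.
\<close>

lemma parallel_exists_near:
  assumes \<gamma>: "integral_curve M X J \<gamma>" and J: "0 \<in> J"
  obtains d where "0 < d" "{0..d} \<subseteq> J"
    "\<forall>t0\<in>{0..d}. \<forall>v\<in>tangent_space M (\<gamma> t0). \<exists>V. parallel_along M nabla {0..d} \<gamma> V \<and> V t0 = v"
proof -
  obtain c where cp: "c \<in> charts_at M (\<gamma> 0)"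
    using charts_at_exists integral_curveD(5)[OF \<gamma> J] by blast
  note c = charts_atD[OF cp]
  obtain d0 U E w L where d0: "0 < d0" "0 < L" "{0 - d0..0 + d0} \<subseteq> J" "is_frame c U E"
      and U: "\<forall>s\<in>{0 - d0..0 + d0}. \<gamma> s \<in> U"
    and w: "\<forall>j. continuous_on {0 - d0..0 + d0} (w j)"
      "\<forall>s\<in>{0 - d0..0 + d0}. \<forall>v. christoffel M nabla c (\<gamma> s) (X (\<gamma> s) c) v = (\<Sum>j\<in>Basis. (v \<bullet> j) *\<^sub>R w j s)"
      "\<forall>s\<in>{0 - d0..0 + d0}. \<forall>v. norm (christoffel M nabla c (\<gamma> s) (X (\<gamma> s) c) v) \<le> L * norm v"
    by (rule christoffel_along[OF \<gamma> J cp])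
  note frame = is_frameD[OF d0(4)]
  define d where "d = min d0 (1 / (2 * L))"
  have d: "d > 0" "d \<le> d0" using d0 by (auto simp: d_def)
  have Ld: "L * (d - 0) < 1"
  proof -
    have "L * d \<le> L * (1 / (2 * L))" using d0(2) by (intro mult_left_mono) (auto simp: d_def)
    then show ?thesis using d0(2) by simp
  qed
  let ?I = "{0..d}"
  have I: "s \<in> {0 - d0..0 + d0}" if "s \<in> ?I" for s using that d by auto
  have IJ: "?I \<subseteq> J" using d0(3) I by blast
  have cI: "c \<in> charts_at M (\<gamma> s)" if "s \<in> ?I" for s
    by (rule frame(6)[OF bspec[OF U I[OF that]]])
  have E_c: "E b (\<gamma> s) c = b" if "s \<in> ?I" for b s
    by (rule frame(5)[OF bspec[OF U I[OF that]]])
  have nabla_E: "nabla X (E b) (\<gamma> s) c = christoffel M nabla c (\<gamma> s) (X (\<gamma> s) c) b" if "s \<in> ?I" for b s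
    using nabla_christoffel[OF cI[OF that] X frame(4), of b]
      frame_field_derivative[OF d0(4) bspec[OF U I[OF that]]] E_c[OF that] by simp
  let ?\<Gamma> = "\<lambda>s. christoffel M nabla c (\<gamma> s) (X (\<gamma> s) c)"
  have "\<exists>V. parallel_along M nabla ?I \<gamma> V \<and> V t0 = v" if t0: "t0 \<in> ?I" and v: "v \<in> tangent_space M (\<gamma> t0)" for t0 v
  proof -
    have "continuous_on (?I \<times> UNIV) (\<lambda>(t, x). - (\<Sum>j\<in>Basis. (x \<bullet> j) *\<^sub>R w j t))"
      unfolding case_prod_unfold
      by (intro continuous_intros continuous_on_compose2[OF spec[OF w(1)] continuous_on_fst[OF continuous_on_id]])
        (use I in auto)
    moreover have "norm (- (\<Sum>j\<in>Basis. (x \<bullet> j) *\<^sub>R w j t) - - (\<Sum>j\<in>Basis. (y \<bullet> j) *\<^sub>R w j t)) \<le> L * norm (x - y)"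
      if t: "t \<in> ?I" for t x y
    proof -
      have "- (\<Sum>j\<in>Basis. (x \<bullet> j) *\<^sub>R w j t) - - (\<Sum>j\<in>Basis. (y \<bullet> j) *\<^sub>R w j t) = - ?\<Gamma> t (x - y)"
        unfolding bspec[OF w(2) I[OF t], THEN spec, symmetric] by (simp add: linear_diff[OF linear_christoffel[OF cI[OF t]]])
      then show ?thesis using bspec[OF w(3) I[OF t], THEN spec, of "x - y"] by simp
    qed
    ultimately obtain y where y0: "y t0 = v c"
      and y: "\<And>t. t \<in> ?I \<Longrightarrow> (y has_vector_derivative - (\<Sum>j\<in>Basis. (y t \<bullet> j) *\<^sub>R w j t)) (at t within ?I)"
      using picard_lindelof[of t0 0 d "\<lambda>t x. - (\<Sum>j\<in>Basis. (x \<bullet> j) *\<^sub>R w j t)" L "v c"] t0 Ld d0(2) by auto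
    define V where "V = (\<lambda>s e. \<Sum>b\<in>Basis. (y s \<bullet> b) *\<^sub>R E b (\<gamma> s) e)"
    have V_in: "V s \<in> tangent_space M (\<gamma> s)" for s
      unfolding V_def by (intro tangent_sum tangent_scaleR vector_fieldD(1)[OF frame(4)])
    have V_c: "V s c = y s" if "s \<in> ?I" for s
      using E_c[OF that] by (simp add: V_def euclidean_representation)
    have "parallel_along M nabla ?I \<gamma> V"
    proof (rule parallel_alongI[OF \<gamma> IJ V_in])
      fix t e assume t: "t \<in> ?I" and e: "e \<in> charts_at M (\<gamma> t)"
      have tJ: "t \<in> J" using IJ t by blast
      let ?\<Gamma>e = "christoffel M nabla e (\<gamma> t) (X (\<gamma> t) e)"
      define y' where "y' = - ?\<Gamma> t (y t)"
      have y': "(y has_vector_derivative y') (at t within ?I)"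
        using y[OF t] bspec[OF w(2) I[OF t], THEN spec] by (simp add: y'_def)
      \<comment> \<open>\<open>Z\<close> is the covariant derivative of \<open>V\<close> at \<open>t\<close>, as a tangent vector.\<close>
      define Z where "Z = (\<lambda>e. \<Sum>b\<in>Basis. (y' \<bullet> b) *\<^sub>R E b (\<gamma> t) e + (y t \<bullet> b) *\<^sub>R nabla X (E b) (\<gamma> t) e)"
      have Z_in: "Z \<in> tangent_space M (\<gamma> t)"
        unfolding Z_def
        by (intro tangent_sum tangent_add tangent_scaleR vector_fieldD(1)[OF frame(4)] vector_fieldD(1)[OF nabla_vector_field[OF X frame(4)]])
      have "Z c = y' + (\<Sum>b\<in>Basis. (y t \<bullet> b) *\<^sub>R ?\<Gamma> t b)"
        using E_c[OF t] nabla_E[OF t] by (simp add: Z_def sum.distrib euclidean_representation)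
      also have "(\<Sum>b\<in>Basis. (y t \<bullet> b) *\<^sub>R ?\<Gamma> t b) = ?\<Gamma> t (\<Sum>b\<in>Basis. (y t \<bullet> b) *\<^sub>R b)"
        by (simp only: linear_sum[OF linear_christoffel[OF cI[OF t]]] linear_cmul[OF linear_christoffel[OF cI[OF t]]])
      finally have "Z c = 0" by (simp add: y'_def euclidean_representation)
      then have "Z = (\<lambda>e. 0)" using tangent_eqI[OF Z_in tangent_zero cI[OF t]] by simp
      then have Ze: "Z e = 0" by simp
      have Eb: "((\<lambda>s. E b (\<gamma> s) e) has_vector_derivative nabla X (E b) (\<gamma> t) e - ?\<Gamma>e (E b (\<gamma> t) e)) (at t within ?I)" for b
      proof -
        let ?D = "frechet_derivative (\<lambda>x. E b (chart_inv e x) e) (at (snd e (\<gamma> t)))"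
        note ea = charts_atD[OF e]
        have D: "((\<lambda>x. E b (chart_inv e x) e) has_derivative ?D) (at (snd e (\<gamma> t)))"
          by (rule vector_field_has_derivative[OF frame(4) e])
        have "((\<lambda>s. E b (chart_inv e (snd e (\<gamma> s))) e) has_derivative (\<lambda>h. ?D (h *\<^sub>R X (\<gamma> t) e))) (at t)"
          by (rule has_derivative_compose[OF integral_curveD(4)[OF \<gamma> tJ e, unfolded has_vector_derivative_def] D])
        then have *: "((\<lambda>s. E b (chart_inv e (snd e (\<gamma> s))) e) has_vector_derivative ?D (X (\<gamma> t) e)) (at t)"
          unfolding has_vector_derivative_def by (simp add: linear_cmul[OF has_derivative_linear[OF D]])
        obtain d' where d': "d' > 0" "\<And>s. s \<in> J \<Longrightarrow> \<bar>s - t\<bar> < d' \<Longrightarrow> \<gamma> s \<in> fst e"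
          using curve_preimage_open[OF integral_curveD(3)[OF \<gamma>] ea(3) tJ ea(2)] by blast
        have op: "open (J \<inter> ball t d')" "t \<in> J \<inter> ball t d'"
          using integral_curveD(1)[OF \<gamma>] tJ d'(1) by auto
        have "((\<lambda>s. E b (\<gamma> s) e) has_vector_derivative ?D (X (\<gamma> t) e)) (at t)"
        proof (rule has_vector_derivative_transform_within_open[OF * op])
          fix s assume "s \<in> J \<inter> ball t d'"
          then have "\<gamma> s \<in> fst e" using d'(2) by (simp add: dist_real_def abs_minus_commute)
          then show "E b (chart_inv e (snd e (\<gamma> s))) e = E b (\<gamma> s) e" using ea(1) by simp
        qed
        then show ?thesis
          using nabla_christoffel[OF e X frame(4), of b] by (simp add: has_vector_derivative_at_within)
      qed
      have "((\<lambda>s. V s e) has_vector_derivative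
        (\<Sum>b\<in>Basis. (y t \<bullet> b) *\<^sub>R (nabla X (E b) (\<gamma> t) e - ?\<Gamma>e (E b (\<gamma> t) e)) + (y' \<bullet> b) *\<^sub>R E b (\<gamma> t) e)) (at t within ?I)"
      proof -
        have "((\<lambda>s. y s \<bullet> b) has_real_derivative y' \<bullet> b) (at t within ?I)" for b
          using bounded_linear.has_vector_derivative[OF bounded_linear_inner_left y']
          by (simp add: has_real_derivative_iff_has_vector_derivative)
        then show ?thesis
          unfolding V_def by (intro has_vector_derivative_sum has_vector_derivative_scaleR Eb)
      qed
      also have "(\<Sum>b\<in>Basis. (y t \<bullet> b) *\<^sub>R (nabla X (E b) (\<gamma> t) e - ?\<Gamma>e (E b (\<gamma> t) e)) + (y' \<bullet> b) *\<^sub>R E b (\<gamma> t) e)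
        = Z e - (\<Sum>b\<in>Basis. (y t \<bullet> b) *\<^sub>R ?\<Gamma>e (E b (\<gamma> t) e))"
        by (simp add: Z_def algebra_simps sum.distrib sum_subtractf)
      also have "(\<Sum>b\<in>Basis. (y t \<bullet> b) *\<^sub>R ?\<Gamma>e (E b (\<gamma> t) e)) = ?\<Gamma>e (V t e)"
        by (simp only: V_def linear_sum[OF linear_christoffel[OF e]] linear_cmul[OF linear_christoffel[OF e]])
      finally show "((\<lambda>s. V s e) has_vector_derivative - ?\<Gamma>e (V t e)) (at t within ?I)"
        using Ze by simp
    qed
    moreover have "V t0 = v"
      by (rule tangent_eqI[OF V_in v cI[OF t0]]) (simp add: V_c[OF t0] y0)
    ultimately show ?thesis by blast
  qed
  then show ?thesis by (intro that[OF d(1) IJ] ballI)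
qed

text \<open>
  Absence of torsion exchanges the arguments of \<open>nabla\<close> at the cost of a Lie bracket, so the Christoffel
  map appears with \<open>X\<close> in the first slot, as it does in the equation of parallel transport
  along integral curves of \<open>X\<close>.
\<close>

lemma nabla_field_torsion_free:
  assumes tf: "torsion_free M nabla" and Y: "Y \<in> vector_fields M" and c: "c \<in> charts_at M p"
  shows "nabla Y X p c = D_field c p (Y p c) + christoffel M nabla c p (X p c) (Y p c)"
proof -
  have "(\<lambda>p c. nabla Y X p c - nabla X Y p c) = lie_bracket M Y X"
    using tf Y X unfolding torsion_free_def by blast
  then have "nabla Y X p c - nabla X Y p c = lie_bracket M Y X p c" by (metis (no_types))
  then show ?thesis using nabla_christoffel[OF c X Y] c by (simp add: lie_bracket_def algebra_simps)
qed

lemma tangent_vector_extends: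
  assumes "p \<in> topspace (mtop M)" "v \<in> tangent_space M p"
  shows "\<exists>Y\<in>vector_fields M. Y p = v"
proof -
  obtain c where c: "c \<in> charts_at M p" using charts_at_exists assms(1) by blast
  obtain U E where p: "p \<in> U" and E: "is_frame c U E" by (rule frame_exists[OF c])
  have "E (v c) p = v"
    by (rule tangent_eqI[OF vector_fieldD(1)[OF is_frameD(4)[OF E]] assms(2) c is_frameD(5)[OF E p]])
  then show ?thesis using is_frameD(4)[OF E] by blast
qed

end

section \<open>Covariantly constant fields and the parallel flow\<close>

locale torsion_free_flow_mfd = conn_field_mfd M nabla X + smooth_flow_mfd M X
  for M :: "('a, 'e::euclidean_space) manifold" and nabla and X +
  assumes torsion_free: "torsion_free M nabla"
begin

text \<open>
  The covariant derivative of a push-forward \<open>V\<close> along \<open>\<gamma>\<close> is \<open>nabla\<^sub>V X\<close>.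
\<close>

lemma pushforward_parallel:
  assumes par: "\<forall>Y\<in>vector_fields M. nabla Y X = (\<lambda>p c. 0)"
    and \<gamma>: "integral_curve M X J \<gamma>" and t: "t \<in> J" and w: "w \<in> tangent_space M (\<gamma> t)"
  shows "parallel_along M nabla J \<gamma> (\<lambda>s. tangent_map M (flow M X (s - t)) (\<gamma> t) w)"
proof (rule parallel_alongI[OF \<gamma> subset_refl pushforward_tangent[OF \<gamma> t _ w]])
  fix s c assume s: "s \<in> J" and c: "c \<in> charts_at M (\<gamma> s)"
  define V where "V = tangent_map M (flow M X (s - t)) (\<gamma> t) w"
  have V: "V \<in> tangent_space M (\<gamma> s)" unfolding V_def by (rule pushforward_tangent[OF \<gamma> t s w])
  obtain Y where Y: "Y \<in> vector_fields M" "Y (\<gamma> s) = V"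
    using tangent_vector_extends[OF integral_curveD(5)[OF \<gamma> s] V] by blast
  have "nabla Y X (\<gamma> s) c = 0" using par Y(1) by simp
  then have "D_field c (\<gamma> s) (V c) = - christoffel M nabla c (\<gamma> s) (X (\<gamma> s) c) (V c)"
    using nabla_field_torsion_free[OF torsion_free Y(1) c] Y(2) by (simp add: eq_neg_iff_add_eq_0)
  then show "((\<lambda>s. tangent_map M (flow M X (s - t)) (\<gamma> t) w c) has_vector_derivative
       - christoffel M nabla c (\<gamma> s) (X (\<gamma> s) c) (tangent_map M (flow M X (s - t)) (\<gamma> t) w c)) (at s within J)"
    using has_vector_derivative_at_within[OF pushforward_has_derivative[OF \<gamma> t s w c]] by (simp add: V_def)
qed

lemma flow_integral_curve:
  assumes "m \<in> flow_dom M X T"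
  obtains J where "integral_curve M X J (\<lambda>s. flow M X s m)" "0 \<in> J" "T \<in> J" "flow M X 0 m = m"
proof -
  obtain J \<gamma> where \<gamma>: "integral_curve M X J \<gamma>" "0 \<in> J" "T \<in> J" "\<gamma> 0 = m"
    using assms by (rule flow_domE)
  have eq: "flow M X s m = \<gamma> s" if "s \<in> J" for s
    using flow_eq(1)[OF \<gamma>(1,2) that] \<gamma>(4) by simp
  have "integral_curve M X J (\<lambda>s. flow M X s m)"
    unfolding integral_curve_def
  proof (intro conjI ballI)
    show "continuous_map (top_of_set J) (mtop M) (\<lambda>s. flow M X s m)"
      by (rule continuous_map_eq[OF integral_curveD(3)[OF \<gamma>(1)]]) (simp add: eq)
    fix t c assume t: "t \<in> J" and c: "c \<in> charts_at M (flow M X t m)"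
    have "((\<lambda>s. snd c (\<gamma> s)) has_vector_derivative X (\<gamma> t) c) (at t)"
      by (rule integral_curveD(4)[OF \<gamma>(1) t]) (use c eq[OF t] in simp)
    then have "((\<lambda>s. snd c (flow M X s m)) has_vector_derivative X (\<gamma> t) c) (at t)"
      by (rule has_vector_derivative_transform_within_open[OF _ integral_curveD(1)[OF \<gamma>(1)] t]) (simp add: eq)
    then show "((\<lambda>s. snd c (flow M X s m)) has_vector_derivative X (flow M X t m) c) (at t)"
      using eq[OF t] by simp
  qed (use integral_curveD[OF \<gamma>(1)] in auto)
  then show ?thesis using that \<gamma> eq by blast
qed

lemma parallel_flow_eq_flow:
  assumes par: "\<forall>Y\<in>vector_fields M. nabla Y X = (\<lambda>p c. 0)"
    and m: "m \<in> flow_dom M X (2 * t)" and w: "w \<in> tangent_space M (flow M X t m)"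
  shows "parallel_flow M nabla X t m w = tangent_map M (flow M X (- t)) (flow M X t m) w"
proof -
  let ?\<gamma> = "\<lambda>s. flow M X s m"
  obtain J where \<gamma>: "integral_curve M X J ?\<gamma>" and J: "0 \<in> J" "2 * t \<in> J"
    using flow_integral_curve[OF m] by metis
  have seg: "closed_segment (2 * t) 0 \<subseteq> J"
    using integral_curveD(2)[OF \<gamma>] J by (simp add: closed_segment_subset is_interval_convex)
  have "t \<in> closed_segment (2 * t) 0" by (auto simp: closed_segment_eq_real_ivl)
  then have t: "t \<in> J" using seg by blast
  let ?V = "\<lambda>s. tangent_map M (flow M X (s - t)) (?\<gamma> t) w"
  have "parallel_along M nabla (closed_segment (2 * t) 0) ?\<gamma> ?V"
    by (rule parallel_along_subset[OF pushforward_parallel[OF par \<gamma> t w] seg])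
  from parallel_transport_eq[OF \<gamma> J(2,1) this]
  show ?thesis by (simp add: parallel_flow_def)
qed

text \<open>
  With \<open>u = Y p\<close>, the hypothesis identifies the push-forward \<open>W\<close> of \<open>u\<close> with the parallel field \<open>V0\<close>
  through \<open>u\<close> for short nonnegative times; comparing one-sided derivatives at \<open>0\<close> proves the claim.
\<close>

lemma nabla_zero_if_parallel_flow_eq_flow:
  assumes H: "\<And>t m w. m \<in> flow_dom M X (2 * t) \<Longrightarrow> w \<in> tangent_space M (flow M X t m) \<Longrightarrow>
       parallel_flow M nabla X t m w = tangent_map M (flow M X (- t)) (flow M X t m) w"
    and Y: "Y \<in> vector_fields M"
  shows "nabla Y X p c = 0"
proof (cases "c \<in> charts_at M p")
  case False
  then show ?thesis by (rule tangent_zero_off[OF vector_fieldD(1)[OF nabla_vector_field[OF Y X]]])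
next
  case c: True
  have p: "p \<in> topspace (mtop M)" using charts_at_topspace c by blast
  obtain a \<gamma>0 where "a > 0" "integral_curve M X {- a<..<a} \<gamma>0" "\<gamma>0 0 = p"
    using integral_curve_exists[OF p] by blast
  then have "p \<in> flow_dom M X 0" using flow_eq(2)[of "{- a<..<a}" \<gamma>0 0] by auto
  then obtain J where \<gamma>: "integral_curve M X J (\<lambda>s. flow M X s p)" and J: "0 \<in> J" and flow0: "flow M X 0 p = p"
    using flow_integral_curve by metis
  let ?\<gamma> = "\<lambda>s. flow M X s p"
  define u where "u = Y p"
  have u: "u \<in> tangent_space M p" unfolding u_def by (rule vector_fieldD(1)[OF Y])
  have u0: "u \<in> tangent_space M (?\<gamma> 0)" using u flow0 by simp
  define W where "W = (\<lambda>s. tangent_map M (flow M X s) p u)"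
  have W_in: "W s \<in> tangent_space M (?\<gamma> s)" if "s \<in> J" for s
    using pushforward_tangent[OF \<gamma> J that u0] flow0 by (simp add: W_def)
  obtain d where d: "d > 0" "{0..d} \<subseteq> J"
    and ex: "\<forall>t0\<in>{0..d}. \<forall>v\<in>tangent_space M (?\<gamma> t0). \<exists>V. parallel_along M nabla {0..d} ?\<gamma> V \<and> V t0 = v"
    by (rule parallel_exists_near[OF \<gamma> J])
  have "0 \<in> {0..d}" using d(1) by simp
  then obtain V0 where V0: "parallel_along M nabla {0..d} ?\<gamma> V0" "V0 0 = u"
    using bspec[OF bspec[OF ex] u0] by blast
  have V0W: "V0 s = W s" if s: "s \<in> {0..d}" for s
  proof -
    have sJ: "s \<in> J" using s d(2) by blast
    have hJ: "s / 2 \<in> J" using s d(2) by auto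
    have p_dom: "p \<in> flow_dom M X (2 * (s / 2))" using flow_eq(2)[OF \<gamma> J sJ] flow0 by simp
    \<comment> \<open>The parallel field that agrees with \<open>W\<close> at time \<open>s\<close>; it has to be \<open>u\<close> at time \<open>0\<close>.\<close>
    obtain Vs where Vs: "parallel_along M nabla {0..d} ?\<gamma> Vs" "Vs s = W s" using bspec[OF bspec[OF ex s] W_in[OF sJ]] by blast
    have "closed_segment s 0 \<subseteq> {0..d}" using s by (auto simp: closed_segment_eq_real_ivl)
    from parallel_transport_eq[OF \<gamma> sJ J parallel_along_subset[OF Vs(1) this]]
    have "Vs 0 = parallel_transport M nabla ?\<gamma> s 0 (W s)" by (simp add: Vs(2))
    also have "W s = tangent_map M (flow M X (s / 2)) (?\<gamma> (s / 2)) (W (s / 2))"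
      using tangent_map_flow_compose[OF \<gamma> J hJ sJ u0] flow0 s by (simp add: W_def)
    also have "parallel_transport M nabla ?\<gamma> s 0 \<dots> = parallel_flow M nabla X (s / 2) p (W (s / 2))"
      by (simp add: parallel_flow_def)
    also have "\<dots> = tangent_map M (flow M X (- (s / 2))) (?\<gamma> (s / 2)) (W (s / 2))"
      by (rule H[OF p_dom W_in[OF hJ]])
    also have "\<dots> = tangent_map M (flow M X 0) p u"
      using tangent_map_flow_compose[OF \<gamma> J hJ J u0] flow0 s by (simp add: W_def)
    also have "\<dots> = u" by (rule tangent_map_flow_0[OF p u])
    finally have "Vs 0 = V0 0" using V0(2) by simp
    then have "Vs s = V0 s"
      by (intro parallel_unique[OF \<gamma> is_interval_cc d(2) Vs(1) V0(1) _ s]) (use d(1) in auto)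
    then show ?thesis using Vs(2) by simp
  qed
  have "((\<lambda>s. W s c) has_vector_derivative D_field c p (u c)) (at 0)"
    using pushforward_has_derivative[OF \<gamma> J J u0, of c] c flow0 tangent_map_flow_0[OF p u] by (simp add: W_def)
  then have 1: "((\<lambda>s. W s c) has_vector_derivative D_field c p (u c)) (at 0 within {0..d})"
    by (rule has_vector_derivative_at_within)
  have "((\<lambda>s. V0 s c) has_vector_derivative - christoffel M nabla c p (X p c) (u c)) (at 0 within {0..d})"
    using parallel_alongD(2)[OF \<gamma> d(2) V0(1), of 0 c] d(1) c flow0 V0(2) by simp
  then have 2: "((\<lambda>s. W s c) has_vector_derivative - christoffel M nabla c p (X p c) (u c)) (at 0 within {0..d})"
    by (rule has_vector_derivative_transform[rotated 2]) (use d(1) V0W in auto)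
  have "at 0 within {0..d} \<noteq> bot" using d(1) by (simp add: at_within_Icc_at_right)
  then have "D_field c p (u c) = - christoffel M nabla c p (X p c) (u c)"
    using vector_derivative_unique_within 1 2 by blast
  then show ?thesis using nabla_field_torsion_free[OF torsion_free Y c] by (simp add: u_def)
qed

end

theorem proposition4p19:
  fixes M :: "('a, 'e::euclidean_space) manifold"
    and nabla :: "('a, 'e) conn"
    and X :: "('a, 'e) vfield"
  assumes "smooth_manifold M"
    and "affine_connection M nabla"
    and "torsion_free M nabla"
    and "X \<in> vector_fields M"
  shows "X \<in> aff0 M nabla \<longleftrightarrow>
    X \<in> aff M nabla \<and>
    (\<forall>t. \<forall>m\<in>flow_dom M X (2 * t). \<forall>w\<in>tangent_space M (flow M X t m).
       parallel_flow M nabla X t m w = tangent_map M (flow M X (- t)) (flow M X t m) w)"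
proof (cases "X \<in> aff M nabla")
  case True
  then have "diffeo_between M (flow_dom M X t) (flow_dom M X (- t)) (flow M X t)" for t
    unfolding aff_def affine_diffeo_def by blast
  then interpret torsion_free_flow_mfd M nabla X
    using assms by unfold_locales (auto simp: diffeo_between_def)
  have "nabla Y X = (\<lambda>p c. 0)"
    if "\<forall>t. \<forall>m\<in>flow_dom M X (2 * t). \<forall>w\<in>tangent_space M (flow M X t m).
       parallel_flow M nabla X t m w = tangent_map M (flow M X (- t)) (flow M X t m) w"
      and "Y \<in> vector_fields M" for Y
    using nabla_zero_if_parallel_flow_eq_flow[OF _ that(2)] that(1) by blast
  then show ?thesis
    using True parallel_flow_eq_flow unfolding aff0_def by blast
next
  case False
  then show ?thesis by (simp add: aff0_def)
qed

end
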